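(* Let $(W_n)_{n\in\mathbb{N}}$ be a sequence of classical Weyl groups (each $W_n$ is a finite irreducible Coxeter group of type $A$, $B$ or $D$) whose ranks $N_n:=\mathrm{rk}(W_n)$ satisfy $\log(n)^3=o(N_n)$. Fix one statistic $\mathrm{stat}\in\{\mathrm{inv},\mathrm{des}\}$ (the same for all $n$). For each $n$, let $X_{n1},\dots,X_{nn}$ be i.i.d. random variables, each distributed as $\mathrm{stat}(w)$ for $w$ uniform on $W_n$, and let $M_n:=\max\{X_{n1},\dots,X_{nn}\}$. Let $\mu_n:=\mathbb{E}(X_{n1})$, $s_n^2:=\mathrm{Var}(X_{n1})$ ($s_n>0$), $\alpha_n=\sqrt{2\log n}$, $\beta_n=\alpha_n-(2\alpha_n)^{-1}\bigl(\log\log n+\log(4\pi)\bigr)$, $a_n:=\alpha_n s_n$ and $b_n:=\beta_n s_n+\mu_n$. Then for every $x\in\mathbb{R}$, $$\mathbb{P}(M_n\le a_nx+b_n)\longrightarrow \exp(-\exp(-x))\quad(n\to\infty).$$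
   Context: A Coxeter system $(W,S)$: $W$ generated by finite $S$ with $s^2=e$ and $(ss')^{M(s,s')}=e$ ($M(s,s')$ the order of $ss'$); rank $\mathrm{rk}(W)=\#S$. With $l$ the word length w.r.t. $S$ and $T=\{wsw^{-1}\}$ the reflections, $\mathrm{inv}(w)=\#\{t\in T: l(wt)<l(w)\}$ and $\mathrm{des}(w)=\#\{s\in S: l(ws)<l(w)\}$. Classical Weyl groups: $A_{n-1}$ is the symmetric group $S_n$ with the adjacent transpositions as generators (rank $n-1$); $B_n$ is the group of signed permutations (bijections $\pi$ of $\{\pm1,\dots,\pm n\}$ with $\pi(-i)=-\pi(i)$), generated by adjacent transpositions and the sign change of the first entry (rank $n$); $D_n\subseteq B_n$ is the subgroup of signed permutations with an even number of negative signs, generated by adjacent transpositions and the map changing the signs of the first two entries (rank $n$). The limit $\exp(-\exp(-x))$ is the Gumbel distribution function.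
   Formalization: The printed a_n = α_n s_n makes the limit false for x ≠ 0; the theorem is proved with a_n = s_n/α_n, all else unchanged. The extra type D generator is taken to be the standard one, which changes the signs of the first two entries and also exchanges them. *)

theory Defs
  imports
    "HOL-Probability.Probability"
    "HOL-Combinatorics.Permutations"
    "HOL-Library.Landau_Symbols"
    "HOL-Algebra.Group"
begin

section \<open>Groups with a distinguished generating set\<close>

definition word_length :: "('a, 'b) monoid_scheme \<Rightarrow> 'a set \<Rightarrow> 'a \<Rightarrow> nat" where
  "word_length G S w =
     (LEAST k. \<exists>ws. set ws \<subseteq> S \<and> length ws = k \<and> foldr (\<otimes>\<^bsub>G\<^esub>) ws \<one>\<^bsub>G\<^esub> = w)"

definition reflections :: "('a, 'b) monoid_scheme \<Rightarrow> 'a set \<Rightarrow> 'a set" where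
  "reflections G S = {w \<otimes>\<^bsub>G\<^esub> s \<otimes>\<^bsub>G\<^esub> inv\<^bsub>G\<^esub> w | w s. w \<in> carrier G \<and> s \<in> S}"

definition coxeter_inv :: "('a, 'b) monoid_scheme \<Rightarrow> 'a set \<Rightarrow> 'a \<Rightarrow> nat" where
  "coxeter_inv G S w =
     card {t \<in> reflections G S. word_length G S (w \<otimes>\<^bsub>G\<^esub> t) < word_length G S w}"

definition coxeter_des :: "('a, 'b) monoid_scheme \<Rightarrow> 'a set \<Rightarrow> 'a \<Rightarrow> nat" where
  "coxeter_des G S w =
     card {s \<in> S. word_length G S (w \<otimes>\<^bsub>G\<^esub> s) < word_length G S w}"

text \<open>
  Connectedness of the Coxeter graph: two distinct generators are joined iff the order of their
  product is at least 3, i.e. iff they do not commute. The rank 0 system is not irreducible.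
\<close>

definition coxeter_irreducible :: "('a, 'b) monoid_scheme \<Rightarrow> 'a set \<Rightarrow> bool" where
  "coxeter_irreducible G S \<longleftrightarrow>
     S \<noteq> {} \<and>
     \<not> (\<exists>J. J \<noteq> {} \<and> J \<subset> S \<and> (\<forall>s\<in>J. \<forall>t\<in>S - J. s \<otimes>\<^bsub>G\<^esub> t = t \<otimes>\<^bsub>G\<^esub> s))"


section \<open>The classical Weyl groups\<close>

text \<open>
  All three families are realised as groups of bijections of the integers that fix every point
  outside the set being permuted, so that they share one type. The product is composition.
\<close>

datatype classical_type = Type_A | Type_B | Type_D

definition signed_permutations :: "nat \<Rightarrow> (int \<Rightarrow> int) set" where
  "signed_permutations n =
     {p. p permutes ({- int n..-1} \<union> {1..int n}) \<and> (\<forall>i. p (- i) = - p i)}"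

text \<open>\<open>classical_carrier Type_A n\<close> is the symmetric group on \<open>n\<close> letters, which has rank \<open>n - 1\<close>.\<close>

fun classical_carrier :: "classical_type \<Rightarrow> nat \<Rightarrow> (int \<Rightarrow> int) set" where
  "classical_carrier Type_A n = {p. p permutes {1..int n}}"
| "classical_carrier Type_B n = signed_permutations n"
| "classical_carrier Type_D n =
     {p \<in> signed_permutations n. even (card {i \<in> {1..int n}. p i < 0})}"

definition weyl_group :: "classical_type \<Rightarrow> nat \<Rightarrow> (int \<Rightarrow> int) monoid" where
  "weyl_group \<tau> n = \<lparr>carrier = classical_carrier \<tau> n, mult = (\<circ>), one = id\<rparr>"

definition signed_adjacent :: "int \<Rightarrow> int \<Rightarrow> int" where
  "signed_adjacent i =
     Transposition.transpose i (i + 1) \<circ> Transposition.transpose (- i) (- (i + 1))"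

text \<open>
  The additional generator in type D is the signed permutation with one-line notation
  \<open>[-2, -1, 3, \<dots>, n]\<close>: it changes the signs of the first two entries and exchanges them. (The map
  \<open>[-1, -2, 3, \<dots>, n]\<close>, without the exchange, is not a reflection and does not yield a Coxeter
  system.) The guards make the generators lie in the carrier for small \<open>n\<close>.
\<close>

fun weyl_generators :: "classical_type \<Rightarrow> nat \<Rightarrow> (int \<Rightarrow> int) set" where
  "weyl_generators Type_A n = {Transposition.transpose i (i + 1) | i. 1 \<le> i \<and> i < int n}"
| "weyl_generators Type_B n =
     {signed_adjacent i | i. 1 \<le> i \<and> i < int n} \<union>
     (if n \<ge> 1 then {Transposition.transpose 1 (-1)} else {})"
| "weyl_generators Type_D n =
     {signed_adjacent i | i. 1 \<le> i \<and> i < int n} \<union>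
     (if n \<ge> 2 then {Transposition.transpose 1 (-2) \<circ> Transposition.transpose (-1) 2} else {})"

definition weyl_rank :: "classical_type \<Rightarrow> nat \<Rightarrow> nat" where
  "weyl_rank \<tau> n = card (weyl_generators \<tau> n)"

text \<open>In particular \<open>pmf_of_set\<close> is the uniform distribution on these carriers.\<close>

lemma weyl_group_finite_nonempty:
  "finite (carrier (weyl_group \<tau> n))" "carrier (weyl_group \<tau> n) \<noteq> {}"
proof -
  have "finite {p. p permutes ({- int n..-1} \<union> {1..int n})}"
    by (rule finite_permutations) simp
  then have fin: "finite (signed_permutations n)"
    by (rule rev_finite_subset) (unfold signed_permutations_def, blast)
  have id: "id \<in> signed_permutations n"
    by (simp add: signed_permutations_def permutes_id)
  have no_neg: "{i \<in> {1..int n}. id i < 0} = {}" by auto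
  have "finite (classical_carrier \<tau> n) \<and> id \<in> classical_carrier \<tau> n"
  proof (cases \<tau>)
    case Type_A
    then show ?thesis by (simp add: finite_permutations permutes_id)
  next
    case Type_B
    then show ?thesis using fin id by simp
  next
    case Type_D
    have "id \<in> classical_carrier Type_D n"
      unfolding classical_carrier.simps mem_Collect_eq no_neg using id by simp
    then show ?thesis using Type_D fin by simp
  qed
  then show "finite (carrier (weyl_group \<tau> n))" "carrier (weyl_group \<tau> n) \<noteq> {}"
    unfolding weyl_group_def partial_object.simps by blast+
qed

end

theory Submission
  imports Defs "HOL-Real_Asymp.Real_Asymp" "HOL-Number_Theory.Cong"
begin

text \<open>
  Both statistics are, up to a bounded error, sums of independent symmetric bounded variables. For
  inversions this is the decomposition of a (signed) permutation by its last value. For descents,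
  the standardization of a uniform element of any of the three groups is a uniform permutation, and
  the partial sums modulo \<open>q\<close> of uniform letters in \<open>{0..<q}\<close> descend exactly when the sum passes a
  multiple of \<open>q\<close> (a discrete form of Tanny's theorem), with ties negligible for large \<open>q\<close>.

  The tail of such a sum at height \<open>y\<close> is compared with the normal tail by Lindeberg's replacement
  of one summand at a time. By symmetry three moments match, so each replacement costs the fourth
  derivative of a smoothed indicator. That derivative is bounded by a multiple of \<open>exp (y * z)\<close>,
  and the moment generating function turns this weight into the factor \<open>exp (- y\<^sup>2 / 2)\<close> that makes
  the error small relative to the normal tail as soon as \<open>y ^ 6\<close> is small against the number of
  summands. At the Gumbel threshold \<open>y ^ 6\<close> has the order of \<open>ln n ^ 3\<close>.
\<close>

section \<open>Reflections and word length\<close>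

text \<open>The sample size n may be nearly exponential in the cube root of the rank, so
  probabilities of order 1 / n must be known up to a factor 1 + o(1). An additive error of the order
  of the inverse square root of the rank, as in a uniform normal approximation, is useless at that
  height. The indicator is smoothed over a width \<kappa> / y because the normal tail near y changes
  by a factor of about exp (- \<kappa>) over that distance; \<kappa> tends to 0 only after n has
  tended to infinity.

  Bounded errors in the descent statistic, its mean or its standard deviation are harmless: the
  standard deviation is at least of the order of the square root of the rank, so they move the
  normalised threshold y by O(y / sqrt rank), while only changes of order 1 / y are visible.

  Both statistics are defined through lengths of shortest words. They have to be identified with
  counts of out-of-order pairs, which is done through the reflection cocycle instead of the Coxeter
  presentation.\<close>

text \<open>An axiomatic inversion cocycle: \<open>Inv w t\<close> is meant to say that right
  multiplication by \<open>t\<close> shortens \<open>w\<close>. By \<open>Inv_mult\<close> the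
  inversion set of a product u v is the symmetric difference of that of v and of the set that
  conjugation by v carries to that of u. Together with \<open>Inv_simple\<close> and
  \<open>Inv_trivial\<close> this yields the strong exchange property in a finite group.\<close>

locale reflection_cocycle = group G for G (structure) +
  fixes S :: "'a set" and Inv :: "'a \<Rightarrow> 'a \<Rightarrow> bool"
  assumes finite_carrier: "finite (carrier G)"
    and S_subset: "S \<subseteq> carrier G"
    and S_square: "s \<in> S \<Longrightarrow> s \<otimes> s = \<one>"
    and Inv_simple: "s \<in> S \<Longrightarrow> t \<in> reflections G S \<Longrightarrow> Inv s t \<longleftrightarrow> t = s"
    and Inv_mult: "u \<in> carrier G \<Longrightarrow> v \<in> carrier G \<Longrightarrow> t \<in> reflections G S \<Longrightarrow>
      Inv (u \<otimes> v) t \<longleftrightarrow> Inv v t \<noteq> Inv u (v \<otimes> t \<otimes> inv v)"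
    and Inv_trivial: "w \<in> carrier G \<Longrightarrow> (\<And>s. s \<in> S \<Longrightarrow> \<not> Inv w s) \<Longrightarrow> w = \<one>"
begin

abbreviation "T \<equiv> reflections G S"

lemma T_cases:
  assumes "t \<in> T"
  obtains w s where "w \<in> carrier G" "s \<in> S" "s \<in> carrier G" "t = w \<otimes> s \<otimes> inv w"
  using assms S_subset unfolding reflections_def by blast

lemma T_closed: "t \<in> T \<Longrightarrow> t \<in> carrier G"
  by (erule T_cases) auto

lemma S_T: "s \<in> S \<Longrightarrow> s \<in> T"
  unfolding reflections_def mem_Collect_eq
  by (rule exI[of _ \<one>], rule exI[of _ s]) (use S_subset in auto)

lemma T_square:
  assumes "t \<in> T"
  shows "t \<otimes> t = \<one>"
proof -
  obtain w s where w: "w \<in> carrier G" "s \<in> S" "s \<in> carrier G" "t = w \<otimes> s \<otimes> inv w"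
    using assms by (rule T_cases)
  have "t \<otimes> t = w \<otimes> (s \<otimes> (inv w \<otimes> w) \<otimes> s) \<otimes> inv w"
    using w by (simp only: w(4) m_assoc m_closed inv_closed)
  then show ?thesis using w S_square by simp
qed

lemma T_conj:
  assumes "v \<in> carrier G" "t \<in> T"
  shows "v \<otimes> t \<otimes> inv v \<in> T"
proof -
  obtain w s where w: "w \<in> carrier G" "s \<in> S" "s \<in> carrier G" "t = w \<otimes> s \<otimes> inv w"
    using assms(2) by (rule T_cases)
  have "v \<otimes> t \<otimes> inv v = (v \<otimes> w) \<otimes> s \<otimes> inv (v \<otimes> w)"
    using w assms(1) by (simp add: inv_mult_group m_assoc)
  then show ?thesis using w assms(1) unfolding reflections_def by blast
qed

lemma Inv_one: "t \<in> T \<Longrightarrow> \<not> Inv \<one> t"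
  using Inv_mult[of \<one> \<one> t] T_closed[of t] by auto

text \<open>For t conjugate to s by w, the contributions of w and of its inverse agree, because
  \<open>Inv \<one> t\<close> fails, and they cancel in the cocycle identity. What remains is
  \<open>Inv s s\<close>.\<close>

lemma Inv_self:
  assumes "t \<in> T"
  shows "Inv t t"
proof -
  obtain w s where w: "w \<in> carrier G" "s \<in> S" "s \<in> carrier G" "t = w \<otimes> s \<otimes> inv w"
    using assms by (rule T_cases)
  have tc: "t \<in> carrier G" using assms by (rule T_closed)
  have c1: "inv w \<otimes> t \<otimes> inv (inv w) = s"
  proof -
    have "inv w \<otimes> (w \<otimes> s) = s" using w(1,3) by (simp add: m_assoc[symmetric])
    then show ?thesis using w(1,3) by (simp add: w(4) m_assoc)
  qed
  have c2: "(s \<otimes> inv w) \<otimes> t \<otimes> inv (s \<otimes> inv w) = s"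
  proof -
    have "(s \<otimes> inv w) \<otimes> t \<otimes> inv (s \<otimes> inv w) = s \<otimes> (inv w \<otimes> t \<otimes> inv (inv w)) \<otimes> inv s"
      using w(1,3) tc by (simp add: inv_mult_group m_assoc)
    then show ?thesis unfolding c1 using w by (simp add: m_assoc)
  qed
  have "Inv (w \<otimes> inv w) t \<longleftrightarrow> Inv (inv w) t \<noteq> Inv w s"
    using Inv_mult[of w "inv w" t] w assms c1 by simp
  then have 1: "Inv (inv w) t \<longleftrightarrow> Inv w s"
    using Inv_one[OF assms] w by simp
  have "Inv (s \<otimes> inv w) t \<longleftrightarrow> Inv (inv w) t \<noteq> Inv s s"
    using Inv_mult[of s "inv w" t] w assms c1 by simp
  moreover have "Inv s s" using Inv_simple w S_T by blast
  moreover have "Inv (w \<otimes> (s \<otimes> inv w)) t \<longleftrightarrow> Inv (s \<otimes> inv w) t \<noteq> Inv w s"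
    using Inv_mult[of w "s \<otimes> inv w" t] w assms c2 by simp
  moreover have "w \<otimes> (s \<otimes> inv w) = t" using w by (simp add: m_assoc)
  ultimately show ?thesis using 1 by simp
qed

lemma Inv_mult_reflection:
  assumes "w \<in> carrier G" "t \<in> T"
  shows "Inv (w \<otimes> t) t \<longleftrightarrow> \<not> Inv w t"
proof -
  have "t \<otimes> t \<otimes> inv t = t" using T_closed[OF assms(2)] by (simp add: m_assoc)
  then show ?thesis using Inv_mult[of w t t] assms T_closed Inv_self by auto
qed

lemma finite_T: "finite T"
  by (rule finite_subset[OF _ finite_carrier]) (auto intro: T_closed)

text \<open>Conjugation by s maps the inversions of w s injectively to inversions of w and misses s
  itself. The number of inverted reflections thus serves as the termination measure when an element
  is written as a word in the generators.\<close>

lemma card_Inv_descent: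
  assumes w: "w \<in> carrier G" and s: "s \<in> S" and d: "Inv w s"
  shows "card {t \<in> T. Inv (w \<otimes> s) t} < card {t \<in> T. Inv w t}"
proof -
  have sc: "s \<in> carrier G" and sT: "s \<in> T" using s S_subset S_T by auto
  have invs: "inv s = s" using S_square[OF s] sc by (simp add: inv_equality)
  let ?f = "\<lambda>t. s \<otimes> t \<otimes> inv s"
  have "?f ` {t \<in> T. Inv (w \<otimes> s) t} \<subseteq> {t \<in> T. Inv w t} - {s}"
  proof safe
    fix t assume t: "t \<in> T" "Inv (w \<otimes> s) t"
    have ne: "t \<noteq> s" using t Inv_mult_reflection[OF w sT] d by auto
    show "?f t \<in> T" using T_conj sc t by blast
    show "Inv w (?f t)" using Inv_mult[of w s t] w sc t ne Inv_simple[OF s t(1)] by auto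
    assume "?f t = s"
    then have "?f t \<otimes> s = s \<otimes> s" by simp
    then have "t = s" using T_closed[OF t(1)] sc by (simp add: m_assoc)
    then show False using ne by simp
  qed
  moreover have "inj_on ?f {t \<in> T. Inv (w \<otimes> s) t}"
    by (rule inj_onI) (use T_closed sc in \<open>auto\<close>)
  ultimately have "card {t \<in> T. Inv (w \<otimes> s) t} \<le> card ({t \<in> T. Inv w t} - {s})"
    using finite_T by (intro card_inj_on_le) auto
  also have "\<dots> < card {t \<in> T. Inv w t}"
    using sT d finite_T by (intro psubset_card_mono) auto
  finally show ?thesis .
qed

lemma foldr_closed: "set ws \<subseteq> S \<Longrightarrow> foldr (\<otimes>) ws \<one> \<in> carrier G"
  using S_subset by (induction ws) auto

lemma foldr_append:
  "set ws \<subseteq> S \<Longrightarrow> v \<in> carrier G \<Longrightarrow> foldr (\<otimes>) ws v = foldr (\<otimes>) ws \<one> \<otimes> v"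
proof (induction ws)
  case (Cons s ws)
  then show ?case using S_subset foldr_closed[of ws] by (auto simp: m_assoc)
qed simp

lemma generated: "w \<in> carrier G \<Longrightarrow> \<exists>ws. set ws \<subseteq> S \<and> foldr (\<otimes>) ws \<one> = w"
proof (induction "card {t \<in> T. Inv w t}" arbitrary: w rule: less_induct)
  case less
  show ?case
  proof (cases "w = \<one>")
    case True
    then show ?thesis by (intro exI[of _ "[]"]) auto
  next
    case False
    then obtain s where s: "s \<in> S" "Inv w s" using Inv_trivial less.prems by blast
    have sc: "s \<in> carrier G" using s S_subset by auto
    obtain ws where ws: "set ws \<subseteq> S" "foldr (\<otimes>) ws \<one> = w \<otimes> s"
      using less.hyps[OF card_Inv_descent[OF less.prems s]] less.prems sc by auto
    have "foldr (\<otimes>) (ws @ [s]) \<one> = w \<otimes> s \<otimes> s"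
      using foldr_append[OF ws(1) sc] ws(2) sc by simp
    also have "\<dots> = w" using less.prems sc S_square[OF s(1)] by (simp add: m_assoc)
    finally show ?thesis using ws s by (intro exI[of _ "ws @ [s]"]) auto
  qed
qed

text \<open>By the cocycle identity, \<open>Inv w t\<close> forces one letter of any word for \<open>w\<close> to be the conjugate of \<open>t\<close> by
  the letters after it; deleting that letter multiplies \<open>w\<close> by \<open>t\<close>.\<close>

lemma exchange:
  "set ws \<subseteq> S \<Longrightarrow> t \<in> T \<Longrightarrow> Inv (foldr (\<otimes>) ws \<one>) t \<Longrightarrow>
    \<exists>us. set us \<subseteq> S \<and> length us < length ws \<and> foldr (\<otimes>) us \<one> = foldr (\<otimes>) ws \<one> \<otimes> t"
proof (induction ws)
  case Nil
  then show ?case using Inv_one by auto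
next
  case (Cons s ws)
  let ?u = "foldr (\<otimes>) ws \<one>"
  have c: "s \<in> carrier G" "?u \<in> carrier G" "t \<in> carrier G" "s \<in> S"
    using Cons.prems S_subset foldr_closed[of ws] T_closed by auto
  show ?case
  proof (cases "Inv ?u t")
    case True
    then obtain us where "set us \<subseteq> S" "length us < length ws" "foldr (\<otimes>) us \<one> = ?u \<otimes> t"
      using Cons by auto
    then show ?thesis using c by (intro exI[of _ "s # us"]) (auto simp: m_assoc)
  next
    case False
    then have "Inv s (?u \<otimes> t \<otimes> inv ?u)"
      using Inv_mult[of s ?u t] c Cons.prems by auto
    then have s: "s = ?u \<otimes> t \<otimes> inv ?u"
      using Inv_simple[OF c(4) T_conj[OF c(2) Cons.prems(2)]] by simp
    have "s \<otimes> ?u \<otimes> t = ?u \<otimes> t \<otimes> (inv ?u \<otimes> ?u) \<otimes> t"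
      using c(2,3) by (subst s) (simp only: m_assoc m_closed inv_closed)
    also have "\<dots> = ?u" using c T_square[OF Cons.prems(2)] by (simp add: m_assoc)
    finally show ?thesis using Cons.prems by (intro exI[of _ ws]) auto
  qed
qed

text \<open>If \<open>t\<close> is inverted, \<open>exchange\<close> applied to a shortest word
  shortens it. If \<open>t\<close> is not inverted by w, then it is inverted by w t, and the first
  case applied to w t gives the opposite strict inequality.\<close>

lemma word_length_reflection_less_iff:
  assumes w: "w \<in> carrier G" and t: "t \<in> T"
  shows "word_length G S (w \<otimes> t) < word_length G S w \<longleftrightarrow> Inv w t"
proof -
  have less: "word_length G S (v \<otimes> t) < word_length G S v" if v: "v \<in> carrier G" "Inv v t" for v
  proof -
    have "\<exists>k ws. set ws \<subseteq> S \<and> length ws = k \<and> foldr (\<otimes>) ws \<one> = v"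
      using generated[OF v(1)] by blast
    then have "\<exists>ws. set ws \<subseteq> S \<and> length ws = word_length G S v \<and> foldr (\<otimes>) ws \<one> = v"
      unfolding word_length_def by (rule LeastI_ex)
    then obtain ws where ws: "set ws \<subseteq> S" "length ws = word_length G S v" "foldr (\<otimes>) ws \<one> = v"
      by blast
    obtain us where "set us \<subseteq> S" "length us < length ws" "foldr (\<otimes>) us \<one> = v \<otimes> t"
      using exchange[OF ws(1) t] ws(3) v(2) by auto
    then have "word_length G S (v \<otimes> t) \<le> length us"
      unfolding word_length_def by (intro Least_le) auto
    then show ?thesis using \<open>length us < length ws\<close> ws(2) by simp
  qed
  show ?thesis
  proof
    assume l: "word_length G S (w \<otimes> t) < word_length G S w"
    show "Inv w t"
    proof (rule ccontr)
      assume "\<not> Inv w t"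
      then have "Inv (w \<otimes> t) t" using Inv_mult_reflection assms by simp
      from less[OF _ this] have "word_length G S (w \<otimes> t \<otimes> t) < word_length G S (w \<otimes> t)"
        using w T_closed[OF t] by simp
      moreover have "w \<otimes> t \<otimes> t = w" using w T_closed[OF t] T_square[OF t] by (simp add: m_assoc)
      ultimately show False using l by simp
    qed
  qed (rule less[OF w])
qed

lemma coxeter_inv_eq: "w \<in> carrier G \<Longrightarrow> coxeter_inv G S w = card {t \<in> T. Inv w t}"
  unfolding coxeter_inv_def using word_length_reflection_less_iff
  by (intro arg_cong[where f = card]) auto

lemma coxeter_des_eq: "w \<in> carrier G \<Longrightarrow> coxeter_des G S w = card {s \<in> S. Inv w s}"
  unfolding coxeter_des_def using word_length_reflection_less_iff S_T
  by (intro arg_cong[where f = card]) auto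

end

text \<open>A reflection \<open>t\<close> is handled through any pair \<open>a\<close>, \<open>t a\<close> that it exchanges, which stands for its root up
  to sign. In types B and D the second pair \<open>- a\<close>, \<open>- t a\<close> describes the same root.\<close>

definition reverses :: "(int \<Rightarrow> int) \<Rightarrow> int \<Rightarrow> int \<Rightarrow> bool" where
  "reverses w a c \<longleftrightarrow> (a < c) \<noteq> (w a < w c)"

definition inverts :: "(int \<Rightarrow> int) \<Rightarrow> (int \<Rightarrow> int) \<Rightarrow> bool" where
  "inverts w t \<longleftrightarrow> (\<exists>a. t a \<noteq> a \<and> reverses w a (t a))"

lemma reverses_comp: "reverses (u \<circ> v) a c \<longleftrightarrow> reverses v a c \<noteq> reverses u (v a) (v c)"
  by (auto simp: reverses_def)

section \<open>Groups of bijections of the integers\<close>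

locale permutation_group =
  fixes C :: "(int \<Rightarrow> int) set" and G :: "(int \<Rightarrow> int) monoid"
  assumes G: "G = \<lparr>carrier = C, mult = (\<circ>), one = id\<rparr>"
    and fin: "finite C" and bij: "w \<in> C \<Longrightarrow> bij w" and id: "id \<in> C"
    and comp: "u \<in> C \<Longrightarrow> v \<in> C \<Longrightarrow> u \<circ> v \<in> C" and inverse: "w \<in> C \<Longrightarrow> inv_into UNIV w \<in> C"
begin

lemma is_group: "group G"
proof (rule groupI)
  fix w assume "w \<in> carrier G"
  then show "\<exists>v\<in>carrier G. v \<otimes>\<^bsub>G\<^esub> w = \<one>\<^bsub>G\<^esub>"
    using inverse[of w] bij[of w] by (intro bexI[of _ "inv_into UNIV w"]) (auto simp: G bij_is_inj)
qed (auto simp: G id comp comp_assoc)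

lemma m_inv_eq: "w \<in> C \<Longrightarrow> inv\<^bsub>G\<^esub> w = inv_into UNIV w"
  using group.inv_equality[OF is_group, of "inv_into UNIV w" w] inverse[of w] bij[of w]
  by (auto simp: G bij_is_inj)

lemma reflections_eq: "reflections G S = {w \<circ> s \<circ> inv_into UNIV w | w s. w \<in> C \<and> s \<in> S}"
proof -
  have "w \<otimes>\<^bsub>G\<^esub> s \<otimes>\<^bsub>G\<^esub> inv\<^bsub>G\<^esub> w = w \<circ> s \<circ> inv_into UNIV w" if "w \<in> C" for w s
    using m_inv_eq[OF that] by (simp add: G)
  moreover have "carrier G = C" by (simp add: G)
  ultimately show ?thesis unfolding reflections_def by (intro Collect_cong iff_exI) auto
qed

lemma reflection_at:
  assumes "w \<in> C"
  shows "(w \<circ> s \<circ> inv_into UNIV w) (w a) = w (s a)"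
  using bij[OF assms] by (simp add: bij_is_inj)

end

text \<open>What remains to be checked for each type. \<open>S_consistent\<close> says that the
  inversion test does not depend on the moved point chosen to represent a reflection, of which there
  are up to four in types B and D. It is demanded for generators only and carried over to their
  conjugates below.\<close>

locale permutation_reflections = permutation_group C G for C G +
  fixes S :: "(int \<Rightarrow> int) set"
  assumes S: "S \<subseteq> C" and S_sq: "s \<in> S \<Longrightarrow> s \<circ> s = id" and S_moves: "s \<in> S \<Longrightarrow> \<exists>a. s a \<noteq> a"
    and S_consistent: "s \<in> S \<Longrightarrow> u \<in> C \<Longrightarrow> s a \<noteq> a \<Longrightarrow> s b \<noteq> b \<Longrightarrow>
      reverses u a (s a) = reverses u b (s b)"
    and S_unique: "s \<in> S \<Longrightarrow> t \<in> reflections G S \<Longrightarrow> inverts s t \<Longrightarrow> t = s"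
    and trivial: "w \<in> C \<Longrightarrow> (\<And>s. s \<in> S \<Longrightarrow> \<not> inverts w s) \<Longrightarrow> w = id"
begin

text \<open>Conjugation by w carries the exchanged pair a, s a to the pair of their images under w.
  Since \<open>reverses\<close> of a composition splits by \<open>reverses_comp\<close>, consistency
  of s under w and under u \<circ> w gives consistency of its conjugate under u.\<close>

lemma reflection_consistent:
  assumes t: "t \<in> reflections G S" and u: "u \<in> C" and ab: "t a \<noteq> a" "t b \<noteq> b"
  shows "reverses u a (t a) = reverses u b (t b)"
proof -
  obtain w s where w: "w \<in> C" "s \<in> S" "t = w \<circ> s \<circ> inv_into UNIV w"
    using t unfolding reflections_eq by blast
  obtain a' b' where a': "a = w a'" "b = w b'"
    using bij[OF w(1)] by (metis bij_pointE)
  have *: "t a = w (s a')" "t b = w (s b')" unfolding a' w(3) by (rule reflection_at[OF w(1)])+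
  have ne: "s a' \<noteq> a'" "s b' \<noteq> b'" using ab * a' by auto
  show ?thesis
    using S_consistent[OF w(2) w(1) ne] S_consistent[OF w(2) comp[OF u w(1)] ne]
    unfolding a' * [unfolded a'] reverses_comp by blast
qed

lemma reflection_moves:
  assumes "t \<in> reflections G S"
  shows "\<exists>a. t a \<noteq> a"
proof -
  obtain w s where w: "w \<in> C" "s \<in> S" "t = w \<circ> s \<circ> inv_into UNIV w"
    using assms unfolding reflections_eq by blast
  obtain a where "s a \<noteq> a" using S_moves w by blast
  then have "t (w a) \<noteq> w a"
    using reflection_at[OF w(1), of s a] bij[OF w(1)] unfolding w(3) by (auto simp: bij_def inj_eq)
  then show ?thesis by blast
qed

lemma inverts_iff:
  assumes "t \<in> reflections G S" "u \<in> C" "t a \<noteq> a"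
  shows "inverts u t \<longleftrightarrow> reverses u a (t a)"
  using reflection_consistent[OF assms(1,2) assms(3)] assms(3) unfolding inverts_def by blast

text \<open>By \<open>inverts_iff\<close> each term of the cocycle identity may be tested at one
  moved point: a for t, and v a for the conjugate of t by v. The identity then is
  \<open>reverses_comp\<close> at that point.\<close>

sublocale cocycle: reflection_cocycle G S inverts
proof (rule reflection_cocycle.intro[OF is_group], unfold_locales)
  show "finite (carrier G)" "S \<subseteq> carrier G" using fin S by (auto simp: G)
  show "s \<otimes>\<^bsub>G\<^esub> s = \<one>\<^bsub>G\<^esub>" if "s \<in> S" for s using S_sq[OF that] by (simp add: G)
  show "w = \<one>\<^bsub>G\<^esub>" if "w \<in> carrier G" "\<And>s. s \<in> S \<Longrightarrow> \<not> inverts w s" for w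
    using trivial that by (auto simp: G)
  show "inverts s t \<longleftrightarrow> t = s" if s: "s \<in> S" and t: "t \<in> reflections G S" for s t
  proof
    assume "t = s"
    obtain a where a: "s a \<noteq> a" using S_moves s by blast
    have "s (s a) = a" using S_sq[OF s] by (metis comp_apply id_apply)
    then show "inverts s t" using a \<open>t = s\<close> unfolding inverts_def reverses_def
      by (intro exI[of _ a]) auto
  qed (rule S_unique[OF s t])
  show "inverts (u \<otimes>\<^bsub>G\<^esub> v) t \<longleftrightarrow> inverts v t \<noteq> inverts u (v \<otimes>\<^bsub>G\<^esub> t \<otimes>\<^bsub>G\<^esub> inv\<^bsub>G\<^esub> v)"
    if u: "u \<in> carrier G" and v: "v \<in> carrier G" and t: "t \<in> reflections G S" for u v t
  proof -
    have c: "u \<in> C" "v \<in> C" using u v by (auto simp: G)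
    let ?t = "v \<circ> t \<circ> inv_into UNIV v"
    have eq: "v \<otimes>\<^bsub>G\<^esub> t \<otimes>\<^bsub>G\<^esub> inv\<^bsub>G\<^esub> v = ?t" using m_inv_eq[OF c(2)] by (simp add: G)
    obtain a where a: "t a \<noteq> a" using reflection_moves[OF t] by blast
    have at: "?t (v a) = v (t a)" by (rule reflection_at[OF c(2)])
    have ne: "?t (v a) \<noteq> v a" unfolding at using a bij[OF c(2)] by (simp add: bij_def inj_eq)
    have tT: "?t \<in> reflections G S"
    proof -
      obtain w s where w: "w \<in> C" "s \<in> S" "t = w \<circ> s \<circ> inv_into UNIV w"
        using t unfolding reflections_eq by blast
      have "?t = (v \<circ> w) \<circ> s \<circ> inv_into UNIV (v \<circ> w)"
        using bij[OF c(2)] bij[OF w(1)] by (simp add: w(3) o_inv_distrib comp_assoc)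
      then show ?thesis unfolding reflections_eq using comp[OF c(2) w(1)] w(2) by blast
    qed
    show ?thesis
      unfolding eq inverts_iff[OF tT c(1) ne] inverts_iff[OF t c(2) a]
      using inverts_iff[OF t comp[OF c] a] unfolding at by (simp add: G reverses_comp)
  qed
qed

end

section \<open>The classical groups\<close>

text \<open>\<open>P\<close> plays the role of the positive roots: it lists each reflection exactly
  once, by an increasing pair that the reflection exchanges. Counting inverted reflections becomes
  counting pairs put out of order.\<close>

lemma (in permutation_reflections) coxeter_inv_pairs:
  assumes image: "(\<lambda>(i, j). r i j) ` P = reflections G S" and inj: "inj_on (\<lambda>(i, j). r i j) P"
    and P: "\<And>i j. (i, j) \<in> P \<Longrightarrow> i < j \<and> r i j i = j" and w: "w \<in> C"
  shows "coxeter_inv G S w = card {(i, j) \<in> P. w j < w i}"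
proof -
  have "inverts w (r i j) \<longleftrightarrow> w j < w i" if ij: "(i, j) \<in> P" for i j
  proof -
    have "r i j \<in> reflections G S" using ij image by auto
    moreover have "r i j i \<noteq> i" using P[OF ij] by auto
    moreover have "w i \<noteq> w j" using P[OF ij] bij[OF w] by (auto simp: bij_def inj_eq)
    ultimately show ?thesis using inverts_iff[of "r i j" w i] w P[OF ij] by (auto simp: reverses_def)
  qed
  then have "{t \<in> reflections G S. inverts w t} = (\<lambda>(i, j). r i j) ` {(i, j) \<in> P. w j < w i}"
    unfolding image[symmetric] by auto
  moreover have "inj_on (\<lambda>(i, j). r i j) {(i, j) \<in> P. w j < w i}"
    by (rule inj_on_subset[OF inj]) auto
  ultimately show ?thesis
    using cocycle.coxeter_inv_eq[of w] w card_image by (auto simp: G)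
qed

text \<open>Strict growth of integers pushes the values up from the left end and down from the right
  end. This is how an element without descents is seen to be the identity; in type D it is applied
  to the absolute values.\<close>

lemma int_increasing_eq_id:
  fixes f :: "int \<Rightarrow> int"
  assumes inc: "\<And>i. 1 \<le> i \<Longrightarrow> i < m \<Longrightarrow> f i < f (i + 1)" and lo: "1 \<le> f 1" and hi: "f m \<le> m"
    and i: "1 \<le> i" "i \<le> m"
  shows "f i = i"
proof -
  have lower: "i \<le> m \<longrightarrow> i \<le> f i" if "1 \<le> i" for i
    using that
  proof (induction i rule: int_ge_induct)
    case (step i)
    then show ?case using inc[of i] by auto
  qed (use lo in auto)
  have upper: "1 \<le> i \<longrightarrow> f i \<le> i" if "i \<le> m" for i
    using that
  proof (induction i rule: int_le_induct)
    case (step i)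
    then show ?case using inc[of "i - 1"] by auto
  qed (use hi in auto)
  show ?thesis using lower upper i by (simp add: order_antisym)
qed

definition descents :: "nat \<Rightarrow> (int \<Rightarrow> int) \<Rightarrow> nat" where
  "descents n f = card {i \<in> {1..<int n}. f (i + 1) < f i}"

section \<open>Type A: transpositions and the symmetric group\<close>

lemma transpose_moved:
  "Transposition.transpose i j a \<noteq> a \<Longrightarrow> Transposition.transpose i j = Transposition.transpose a (Transposition.transpose i j a)"
  by (auto simp: Transposition.transpose_def fun_eq_iff split: if_splits)

lemma transpose_conj:
  assumes "bij w"
  shows "w \<circ> Transposition.transpose i j \<circ> inv_into UNIV w = Transposition.transpose (w i) (w j)"
proof
  fix x
  obtain y where "x = w y" using assms by (metis bij_pointE)
  then show "(w \<circ> Transposition.transpose i j \<circ> inv_into UNIV w) x = Transposition.transpose (w i) (w j) x"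
    using assms by (auto simp: Transposition.transpose_def bij_def inj_eq)
qed

lemma symmetric_group_axioms:
  "finite {p. p permutes {1..int n}}"
  "w \<in> {p. p permutes {1..int n}} \<Longrightarrow> bij w"
  "id \<in> {p. p permutes {1..int n}}"
  "u \<in> {p. p permutes {1..int n}} \<Longrightarrow> v \<in> {p. p permutes {1..int n}} \<Longrightarrow> u \<circ> v \<in> {p. p permutes {1..int n}}"
  "w \<in> {p. p permutes {1..int n}} \<Longrightarrow> inv_into UNIV w \<in> {p. p permutes {1..int n}}"
  by (auto simp: finite_permutations permutes_bij permutes_id permutes_compose permutes_inv)

abbreviation "W \<tau> n \<equiv> weyl_group \<tau> n"
abbreviation "gens \<tau> n \<equiv> weyl_generators \<tau> n"

interpretation A0: permutation_group "classical_carrier Type_A n" "W Type_A n" for n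
proof
  show "weyl_group Type_A n = \<lparr>carrier = classical_carrier Type_A n, mult = (\<circ>), one = id\<rparr>"
    by (simp add: weyl_group_def)
qed (use symmetric_group_axioms[where n = n] in \<open>simp_all\<close>)

lemma reflections_A:
  assumes "t \<in> reflections (W Type_A n) (gens Type_A n)"
  obtains i j where "i \<in> {1..int n}" "j \<in> {1..int n}" "i \<noteq> j" "t = Transposition.transpose i j"
proof -
  obtain w k where w: "w permutes {1..int n}" "1 \<le> k" "k < int n"
    and t: "t = w \<circ> Transposition.transpose k (k + 1) \<circ> inv_into UNIV w"
    using assms unfolding A0.reflections_eq by auto
  then have "t = Transposition.transpose (w k) (w (k + 1))"
    using transpose_conj[OF permutes_bij[OF w(1)]] by simp
  moreover have "w k \<in> {1..int n}" "w (k + 1) \<in> {1..int n}"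
    using w permutes_in_image[OF w(1), of k] permutes_in_image[OF w(1), of "k + 1"] by auto
  moreover have "w k \<noteq> w (k + 1)" using permutes_inj[OF w(1)] by (auto simp: inj_eq)
  ultimately show ?thesis using that by blast
qed

interpretation A: permutation_reflections "classical_carrier Type_A n" "W Type_A n" "gens Type_A n" for n
proof
  show "gens Type_A n \<subseteq> classical_carrier Type_A n"
    by (auto intro!: permutes_swap_id)
next
  fix s assume "s \<in> gens Type_A n"
  then obtain k where k: "1 \<le> k" "k < int n" and s: "s = Transposition.transpose k (k + 1)" by auto
  show "s \<circ> s = id" unfolding s by simp
  show "\<exists>a. s a \<noteq> a" unfolding s by (intro exI[of _ k]) auto
  show "reverses u a (s a) = reverses u b (s b)"
    if "u \<in> classical_carrier Type_A n" "s a \<noteq> a" "s b \<noteq> b" for u a b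
  proof -
    have "u k \<noteq> u (k + 1)" using that(1) permutes_inj[of u] by (auto simp: inj_eq)
    then show ?thesis using that(2,3) unfolding s
      by (auto simp: reverses_def Transposition.transpose_def split: if_splits)
  qed
  show "t = s" if tT: "t \<in> reflections (W Type_A n) (gens Type_A n)" and inv: "inverts s t" for t
  proof -
    obtain i j where ij: "t = Transposition.transpose i j" using reflections_A[OF tT] by metis
    obtain a where a: "t a \<noteq> a" "reverses s a (t a)" using inv unfolding inverts_def by blast
    have t: "t = Transposition.transpose a (t a)" using a(1) unfolding ij by (rule transpose_moved)
    \<comment> \<open>As \<open>k\<close> and \<open>k + 1\<close> are consecutive, their exchange
      alters the relative order of no other pair.\<close>
    have "(a = k \<and> t a = k + 1) \<or> (a = k + 1 \<and> t a = k)"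
      using a unfolding s by (auto simp: reverses_def Transposition.transpose_def split: if_splits)
    then show ?thesis using t s by (auto simp: transpose_commute)
  qed
next
  fix w assume w: "w \<in> classical_carrier Type_A n" and nd: "\<And>s. s \<in> gens Type_A n \<Longrightarrow> \<not> inverts w s"
  then have perm: "w permutes {1..int n}" by simp
  have inc: "w i < w (i + 1)" if i: "1 \<le> i" "i < int n" for i
  proof -
    have "\<not> inverts w (Transposition.transpose i (i + 1))" using nd i by auto
    then have "\<not> reverses w i (i + 1)" unfolding inverts_def by (auto dest: spec[of _ i])
    then show ?thesis by (simp add: reverses_def)
  qed
  have "w i = i" if "i \<in> {1..int n}" for i
    by (rule int_increasing_eq_id[of "int n" w])
      (use inc that permutes_in_image[OF perm, of 1] permutes_in_image[OF perm, of "int n"] in auto)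
  then show "w = id" using permutes_not_in[OF perm] by (auto simp: fun_eq_iff)
qed

lemma coxeter_inv_A:
  assumes "w permutes {1..int n}"
  shows "coxeter_inv (W Type_A n) (gens Type_A n) w = card {(i, j). 1 \<le> i \<and> i < j \<and> j \<le> int n \<and> w j < w i}"
proof -
  let ?P = "{(i, j). 1 \<le> i \<and> i < j \<and> j \<le> int n}"
  let ?T = "reflections (W Type_A n) (gens Type_A n)"
  have gen: "Transposition.transpose i (i + 1) \<in> ?T" if "1 \<le> i" "i < int n" for i
    by (rule A.cocycle.S_T) (use that in auto)
  have conj: "Transposition.transpose (w i) (w j) \<in> ?T"
    if "Transposition.transpose i j \<in> ?T" "w permutes {1..int n}" for w i j
    using A.cocycle.T_conj[of w n "Transposition.transpose i j"] that A0.m_inv_eq[of w n]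
      transpose_conj[OF permutes_bij[OF that(2)]]
    by (simp add: weyl_group_def)
  have T: "Transposition.transpose i j \<in> ?T" if "1 \<le> i" "i < j" "j \<le> int n" for i j
  proof -
    have "j \<le> int n \<longrightarrow> Transposition.transpose i j \<in> ?T" if "i + 1 \<le> j" for j
      using that
    proof (induction j rule: int_ge_induct)
      case base
      then show ?case using gen \<open>1 \<le> i\<close> by auto
    next
      case (step j)
      show ?case
      proof
        assume j: "j + 1 \<le> int n"
        \<comment> \<open>Conjugating the transposition of i and j by that of j and j + 1 moves its
          upper end one step to the right; i < j stays fixed.\<close>
        have "Transposition.transpose (Transposition.transpose j (j + 1) i) (Transposition.transpose j (j + 1) j) \<in> ?T"
          by (rule conj) (use step j \<open>1 \<le> i\<close> in \<open>auto intro: permutes_swap_id\<close>)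
        then show "Transposition.transpose i (j + 1) \<in> ?T" using step by simp
      qed
    qed
    then show ?thesis using that by auto
  qed
  have "(\<lambda>(i, j). Transposition.transpose i j) ` ?P = ?T"
  proof safe
    fix t assume "t \<in> ?T"
    then obtain i j where "i \<in> {1..int n}" "j \<in> {1..int n}" "i \<noteq> j" "t = Transposition.transpose i j"
      by (rule reflections_A)
    then show "t \<in> (\<lambda>(i, j). Transposition.transpose i j) ` ?P"
      using image_eqI[of t "\<lambda>(i, j). Transposition.transpose i j" "(i, j)" ?P]
        image_eqI[of t "\<lambda>(i, j). Transposition.transpose i j" "(j, i)" ?P] transpose_commute[of i j]
      by (cases "i < j") simp_all
  qed (use T in auto)
  moreover have "inj_on (\<lambda>(i, j). Transposition.transpose i j) ?P"
  proof (rule inj_onI, clarify)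
    fix i j k l :: int assume ij: "i < j" "k < l" and eq: "Transposition.transpose i j = Transposition.transpose k l"
    from fun_cong[OF eq, of i] fun_cong[OF eq, of j] ij show "i = k \<and> j = l"
      by (auto simp: Transposition.transpose_def split: if_splits)
  qed
  ultimately have "coxeter_inv (W Type_A n) (gens Type_A n) w = card {(i, j) \<in> ?P. w j < w i}"
    by (rule A.coxeter_inv_pairs) (use assms in auto)
  also have "{(i, j) \<in> ?P. w j < w i} = {(i, j). 1 \<le> i \<and> i < j \<and> j \<le> int n \<and> w j < w i}" by auto
  finally show ?thesis .
qed


section \<open>Signed permutations and the reflections of types B and D\<close>

text \<open>With the convention that the basis vector of index -i is minus that of index i, this is
  the reflection exchanging the vectors of indices i and j. Arguments of opposite sign give the
  reflection in a sum of two coordinates, and j = - i gives a single sign change, so one formula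
  covers all roots of both types.\<close>

definition signed_transpose :: "int \<Rightarrow> int \<Rightarrow> int \<Rightarrow> int" where
  "signed_transpose i j x =
    (if x = i then j else if x = j then i else if x = - i then - j else if x = - j then - i else x)"

abbreviation "symmetric_ints n \<equiv> {- int n..-1} \<union> {1..int n}"

lemma signed_perm_facts:
  assumes "w \<in> signed_permutations n"
  shows "w permutes symmetric_ints n" "bij w" "w (- a) = - w a" "w 0 = 0"
    "w a = w b \<longleftrightarrow> a = b" "w a = - w b \<longleftrightarrow> a = - b" "w a = 0 \<longleftrightarrow> a = 0"
proof -
  show p: "w permutes symmetric_ints n" and odd: "w (- a) = - w a" for a
    using assms by (auto simp: signed_permutations_def)
  show b: "bij w" using p by (rule permutes_bij)
  show 0: "w 0 = 0" using odd[of 0] by simp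
  show inj: "w a = w b \<longleftrightarrow> a = b" for a b using b by (auto simp: bij_def inj_eq)
  show "w a = - w b \<longleftrightarrow> a = - b" using inj[of a "- b"] odd by simp
  show "w a = 0 \<longleftrightarrow> a = 0" using inj[of a 0] 0 by simp
qed

lemma signed_perm_range:
  assumes "w \<in> signed_permutations n" "a \<noteq> 0" "\<bar>a\<bar> \<le> int n"
  shows "w a \<noteq> 0" "\<bar>w a\<bar> \<le> int n"
  using permutes_in_image[OF signed_perm_facts(1)[OF assms(1)], of a] assms(2,3) by auto

lemma signed_permutations_axioms:
  "finite (signed_permutations n)"
  "id \<in> signed_permutations n"
  "u \<in> signed_permutations n \<Longrightarrow> v \<in> signed_permutations n \<Longrightarrow> u \<circ> v \<in> signed_permutations n"
  "w \<in> signed_permutations n \<Longrightarrow> inv_into UNIV w \<in> signed_permutations n"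
proof -
  show "finite (signed_permutations n)"
    using weyl_group_finite_nonempty(1)[of Type_B n] by (simp add: weyl_group_def)
  show "id \<in> signed_permutations n" by (simp add: signed_permutations_def permutes_id)
  show "u \<circ> v \<in> signed_permutations n" if "u \<in> signed_permutations n" "v \<in> signed_permutations n"
    using that by (auto simp: signed_permutations_def intro: permutes_compose)
  show "inv_into UNIV w \<in> signed_permutations n" if w: "w \<in> signed_permutations n"
  proof -
    have "inv_into UNIV w (- i) = - inv_into UNIV w i" for i
      using signed_perm_facts[OF w] by (metis bij_inv_eq_iff)
    then show ?thesis
      using permutes_inv[OF signed_perm_facts(1)[OF w]] by (simp add: signed_permutations_def)
  qed
qed

lemma signed_transpose_perm:
  assumes "i \<noteq> 0" "j \<noteq> 0" "\<bar>i\<bar> \<le> int n" "\<bar>j\<bar> \<le> int n"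
  shows "signed_transpose i j \<in> signed_permutations n"
proof -
  have invol: "signed_transpose i j (signed_transpose i j x) = x" for x
    using assms by (auto simp: signed_transpose_def)
  have "signed_transpose i j ` symmetric_ints n \<subseteq> symmetric_ints n"
    using assms by (auto simp: signed_transpose_def abs_if split: if_splits)
  then have "bij_betw (signed_transpose i j) (symmetric_ints n) (symmetric_ints n)"
    by (intro bij_betw_byWitness[where f' = "signed_transpose i j"]) (use invol in auto)
  then have "signed_transpose i j permutes symmetric_ints n"
    by (rule bij_imp_permutes) (use assms in \<open>auto simp: signed_transpose_def abs_if split: if_splits\<close>)
  then show ?thesis using assms by (auto simp: signed_permutations_def signed_transpose_def)
qed

lemma signed_transpose_involution: "i \<noteq> 0 \<Longrightarrow> j \<noteq> 0 \<Longrightarrow> signed_transpose i j \<circ> signed_transpose i j = id"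
  by (auto simp: signed_transpose_def fun_eq_iff)

lemma signed_transpose_sym:
  assumes "i \<noteq> 0" "j \<noteq> 0"
  shows "signed_transpose i j = signed_transpose j i" "signed_transpose (- i) (- j) = signed_transpose i j"
  using assms
  by (auto simp: signed_transpose_def fun_eq_iff)

lemma signed_transpose_conj:
  assumes w: "w \<in> signed_permutations n"
  shows "w \<circ> signed_transpose i j \<circ> inv_into UNIV w = signed_transpose (w i) (w j)"
proof
  fix x
  obtain y where y: "x = w y" using signed_perm_facts(2)[OF w] by (metis bij_pointE)
  have "(w \<circ> signed_transpose i j \<circ> inv_into UNIV w) x = w (signed_transpose i j y)"
    using y signed_perm_facts(2)[OF w] by (simp add: bij_is_inj)
  also have "\<dots> = signed_transpose (w i) (w j) x"
    unfolding y signed_transpose_def using signed_perm_facts[OF w] by auto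
  finally show "(w \<circ> signed_transpose i j \<circ> inv_into UNIV w) x = signed_transpose (w i) (w j) x" .
qed

lemma signed_transpose_moved:
  "i \<noteq> 0 \<Longrightarrow> j \<noteq> 0 \<Longrightarrow> signed_transpose i j a \<noteq> a \<Longrightarrow> signed_transpose i j = signed_transpose a (signed_transpose i j a)"
  by (auto simp: signed_transpose_def fun_eq_iff)

lemma signed_transpose_moved_pairs:
  "signed_transpose i j a \<noteq> a \<Longrightarrow>
    (a, signed_transpose i j a) \<in> {(i, j), (j, i), (- i, - j), (- j, - i)}"
  by (auto simp: signed_transpose_def split: if_splits)

lemma signed_transpose_consistent:
  assumes u: "u \<in> signed_permutations n" and "i \<noteq> j"
    and a: "signed_transpose i j a \<noteq> a" and b: "signed_transpose i j b \<noteq> b"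
  shows "reverses u a (signed_transpose i j a) = reverses u b (signed_transpose i j b)"
proof -
  have "u i \<noteq> u j" using signed_perm_facts(5)[OF u] \<open>i \<noteq> j\<close> by simp
  then have "reverses u c (signed_transpose i j c) = reverses u i j" if "signed_transpose i j c \<noteq> c" for c
    using signed_transpose_moved_pairs[OF that] signed_perm_facts(3)[OF u] \<open>i \<noteq> j\<close>
    unfolding reverses_def by auto
  then show ?thesis using a b by simp
qed

lemma weyl_generators_signed:
  "gens Type_B n = (\<lambda>k. signed_transpose k (k + 1)) ` {1..<int n} \<union>
    (if n \<ge> 1 then {signed_transpose 1 (-1)} else {})"
  "gens Type_D n = (\<lambda>k. signed_transpose k (k + 1)) ` {1..<int n} \<union>
    (if n \<ge> 2 then {signed_transpose 1 (-2)} else {})"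
proof -
  have "signed_adjacent k = signed_transpose k (k + 1)" if "k \<ge> 1" for k
    using that by (auto simp: signed_adjacent_def signed_transpose_def Transposition.transpose_def fun_eq_iff)
  then have "signed_adjacent ` {1..<int n} = (\<lambda>k. signed_transpose k (k + 1)) ` {1..<int n}"
    by (intro image_cong) auto
  moreover have "{signed_adjacent i | i. 1 \<le> i \<and> i < int n} = signed_adjacent ` {1..<int n}" by auto
  ultimately have *: "{signed_adjacent i | i. 1 \<le> i \<and> i < int n} = (\<lambda>k. signed_transpose k (k + 1)) ` {1..<int n}"
    by simp
  have "Transposition.transpose 1 (-1) = signed_transpose 1 (-1)"
    by (auto simp: signed_transpose_def Transposition.transpose_def fun_eq_iff)
  moreover have "Transposition.transpose 1 (-2) \<circ> Transposition.transpose (-1) 2 = signed_transpose 1 (-2)"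
    by (auto simp: signed_transpose_def Transposition.transpose_def fun_eq_iff)
  ultimately show
    "gens Type_B n = (\<lambda>k. signed_transpose k (k + 1)) ` {1..<int n} \<union>
      (if n \<ge> 1 then {signed_transpose 1 (-1)} else {})"
    "gens Type_D n = (\<lambda>k. signed_transpose k (k + 1)) ` {1..<int n} \<union>
      (if n \<ge> 2 then {signed_transpose 1 (-2)} else {})"
    unfolding weyl_generators.simps * by simp_all
qed

lemma not_inverts_less:
  assumes "\<not> inverts w (signed_transpose i j)" "i < j"
  shows "w i < w j"
proof -
  have "signed_transpose i j i = j" by (simp add: signed_transpose_def)
  then have "\<not> reverses w i j" using assms unfolding inverts_def by (metis less_irrefl)
  then show ?thesis using assms(2) by (simp add: reverses_def)
qed

text \<open>The parity of the number of negative entries in multiplicative form: type D becomes the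
  kernel of a homomorphism, so closure under products and inverses is immediate.\<close>

definition sign_product :: "nat \<Rightarrow> (int \<Rightarrow> int) \<Rightarrow> int" where
  "sign_product n w = (\<Prod>i\<in>{1..int n}. sgn (w i))"

lemma even_negatives_iff:
  assumes "w \<in> signed_permutations n"
  shows "even (card {i \<in> {1..int n}. w i < 0}) \<longleftrightarrow> sign_product n w = 1"
proof -
  have "finite A \<Longrightarrow> \<forall>i\<in>A. w i \<noteq> 0 \<Longrightarrow> (\<Prod>i\<in>A. sgn (w i)) = (- 1) ^ card {i \<in> A. w i < 0}" for A
  proof (induction A rule: finite_induct)
    case (insert a A)
    have "{i \<in> insert a A. w i < 0} = (if w a < 0 then insert a {i \<in> A. w i < 0} else {i \<in> A. w i < 0})"
      by auto
    then show ?case using insert by auto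
  qed simp
  from this[of "{1..int n}"] have "sign_product n w = (- 1) ^ card {i \<in> {1..int n}. w i < 0}"
    unfolding sign_product_def using signed_perm_range[OF assms] by auto
  then show ?thesis by (auto simp: minus_one_power_iff)
qed

text \<open>As u is odd, the sign of u (v i) is the sign of u at \<bar>v i\<bar> times the sign of v
  i, and i \<mapsto> \<bar>v i\<bar> permutes the positive letters.\<close>

lemma sign_product_comp:
  assumes u: "u \<in> signed_permutations n" and v: "v \<in> signed_permutations n"
  shows "sign_product n (u \<circ> v) = sign_product n u * sign_product n v"
proof -
  have "sgn (u (v i)) = sgn (u \<bar>v i\<bar>) * sgn (v i)" for i
    using signed_perm_facts(3,4)[OF u]
    by (cases "v i > 0"; cases "v i = 0") (auto simp: abs_if)
  then have "sign_product n (u \<circ> v) = (\<Prod>i\<in>{1..int n}. sgn (u \<bar>v i\<bar>)) * sign_product n v"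
    unfolding sign_product_def by (simp add: prod.distrib)
  also have "(\<Prod>i\<in>{1..int n}. sgn (u \<bar>v i\<bar>)) = (\<Prod>i\<in>{1..int n}. sgn (u i))"
  proof (rule prod.reindex_bij_betw)
    have "inj_on (\<lambda>i. \<bar>v i\<bar>) {1..int n}"
      by (rule inj_onI) (use signed_perm_facts[OF v] in \<open>auto simp: abs_eq_iff\<close>)
    moreover have "(\<lambda>i. \<bar>v i\<bar>) ` {1..int n} \<subseteq> {1..int n}"
    proof safe
      fix i assume "i \<in> {1..int n}"
      then show "\<bar>v i\<bar> \<in> {1..int n}" using signed_perm_range[OF v, of i] by auto
    qed
    ultimately show "bij_betw (\<lambda>i. \<bar>v i\<bar>) {1..int n} {1..int n}"
      by (simp add: bij_betw_def endo_inj_surj)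
  qed
  finally show ?thesis by (simp add: sign_product_def)
qed

lemma type_D_carrier:
  "classical_carrier Type_D n = {w \<in> signed_permutations n. sign_product n w = 1}"
  unfolding classical_carrier.simps using even_negatives_iff by blast

lemma type_D_axioms:
  "id \<in> classical_carrier Type_D n"
  "u \<in> classical_carrier Type_D n \<Longrightarrow> v \<in> classical_carrier Type_D n \<Longrightarrow> u \<circ> v \<in> classical_carrier Type_D n"
  "w \<in> classical_carrier Type_D n \<Longrightarrow> inv_into UNIV w \<in> classical_carrier Type_D n"
proof -
  have 1: "sign_product n id = 1" by (simp add: sign_product_def)
  then show "id \<in> classical_carrier Type_D n"
    unfolding type_D_carrier using signed_permutations_axioms by simp
  show "u \<circ> v \<in> classical_carrier Type_D n"
    if "u \<in> classical_carrier Type_D n" "v \<in> classical_carrier Type_D n"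
    using that signed_permutations_axioms(3) unfolding type_D_carrier by (simp add: sign_product_comp)
  show "inv_into UNIV w \<in> classical_carrier Type_D n" if "w \<in> classical_carrier Type_D n"
  proof -
    have w: "w \<in> signed_permutations n" "sign_product n w = 1" using that unfolding type_D_carrier by auto
    have "inv_into UNIV w \<circ> w = id" using signed_perm_facts(2)[OF w(1)] by (simp add: bij_is_inj)
    then have "sign_product n (inv_into UNIV w) = 1"
      using sign_product_comp[OF signed_permutations_axioms(4)[OF w(1)] w(1)] 1 w(2) by simp
    then show ?thesis unfolding type_D_carrier using signed_permutations_axioms(4)[OF w(1)] by simp
  qed
qed

lemma signed_transpose_D:
  assumes "i \<noteq> 0" "j \<noteq> 0" "\<bar>i\<bar> \<le> int n" "\<bar>j\<bar> \<le> int n" "\<bar>i\<bar> \<noteq> \<bar>j\<bar>"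
  shows "signed_transpose i j \<in> classical_carrier Type_D n"
proof -
  have "sgn (signed_transpose i j k) = (if k = \<bar>i\<bar> \<or> k = \<bar>j\<bar> then sgn i * sgn j else 1)"
    if "k \<in> {1..int n}" for k
  proof -
    consider "k = \<bar>i\<bar>" | "k = \<bar>j\<bar>" | "k \<noteq> \<bar>i\<bar>" "k \<noteq> \<bar>j\<bar>" by blast
    then show ?thesis
    proof cases
      case 1
      then have "signed_transpose i j k = sgn i * j"
        using assms by (cases "i > 0") (auto simp: signed_transpose_def)
      then show ?thesis using 1 by (simp add: sgn_mult)
    next
      case 2
      then have "signed_transpose i j k = sgn j * i"
        using assms by (cases "j > 0") (auto simp: signed_transpose_def)
      then show ?thesis using 2 by (simp add: sgn_mult)
    next
      case 3
      then have "k \<noteq> i" "k \<noteq> j" "k \<noteq> - i" "k \<noteq> - j" using that by auto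
      then show ?thesis using 3 that by (simp add: signed_transpose_def)
    qed
  qed
  then have "sign_product n (signed_transpose i j) =
      (\<Prod>k\<in>{1..int n}. if k = \<bar>i\<bar> \<or> k = \<bar>j\<bar> then sgn i * sgn j else 1)"
    unfolding sign_product_def by (intro prod.cong) auto
  also have "\<dots> = (\<Prod>k\<in>{\<bar>i\<bar>, \<bar>j\<bar>}. sgn i * sgn j)"
    by (rule prod.mono_neutral_cong_right) (use assms in auto)
  also have "\<dots> = 1" using assms by (auto simp: sgn_if)
  finally show ?thesis unfolding type_D_carrier using signed_transpose_perm assms by simp
qed

interpretation B0: permutation_group "classical_carrier Type_B n" "W Type_B n" for n
proof
  show "weyl_group Type_B n = \<lparr>carrier = classical_carrier Type_B n, mult = (\<circ>), one = id\<rparr>"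
    by (simp add: weyl_group_def)
qed (use signed_permutations_axioms[where n = n] signed_perm_facts(2)[where n = n] in \<open>simp_all\<close>)

interpretation D0: permutation_group "classical_carrier Type_D n" "W Type_D n" for n
proof
  show "weyl_group Type_D n = \<lparr>carrier = classical_carrier Type_D n, mult = (\<circ>), one = id\<rparr>"
    by (simp add: weyl_group_def)
  show "finite (classical_carrier Type_D n)"
    using weyl_group_finite_nonempty(1)[of Type_D n] by (simp add: weyl_group_def)
  show "bij w" if "w \<in> classical_carrier Type_D n" for w
    using that signed_perm_facts(2)[of w n] by simp
qed (rule type_D_axioms; assumption)+

lemma reflections_BD:
  shows "t \<in> reflections (W Type_B n) (gens Type_B n) \<Longrightarrow>
      \<exists>i j. i \<noteq> 0 \<and> j \<noteq> 0 \<and> \<bar>i\<bar> \<le> int n \<and> \<bar>j\<bar> \<le> int n \<and> i \<noteq> j \<and> t = signed_transpose i j"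
    and "t \<in> reflections (W Type_D n) (gens Type_D n) \<Longrightarrow>
      \<exists>i j. i \<noteq> 0 \<and> j \<noteq> 0 \<and> \<bar>i\<bar> \<le> int n \<and> \<bar>j\<bar> \<le> int n \<and> \<bar>i\<bar> \<noteq> \<bar>j\<bar> \<and> t = signed_transpose i j"
proof -
  have conj: "w \<circ> signed_transpose i j \<circ> inv_into UNIV w = signed_transpose (w i) (w j) \<and>
      w i \<noteq> 0 \<and> w j \<noteq> 0 \<and> \<bar>w i\<bar> \<le> int n \<and> \<bar>w j\<bar> \<le> int n \<and> w i \<noteq> w j \<and>
      (\<bar>i\<bar> \<noteq> \<bar>j\<bar> \<longrightarrow> \<bar>w i\<bar> \<noteq> \<bar>w j\<bar>)"
    if "w \<in> signed_permutations n" "i \<noteq> 0" "j \<noteq> 0" "\<bar>i\<bar> \<le> int n" "\<bar>j\<bar> \<le> int n" "i \<noteq> j" for w i j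
    using that signed_transpose_conj[OF that(1)] signed_perm_facts(5,6)[OF that(1)]
      signed_perm_range[OF that(1), of i] signed_perm_range[OF that(1), of j]
    by (auto simp: abs_eq_iff)
  have sB: "\<exists>i j. i \<noteq> 0 \<and> j \<noteq> 0 \<and> \<bar>i\<bar> \<le> int n \<and> \<bar>j\<bar> \<le> int n \<and> i \<noteq> j \<and> s = signed_transpose i j"
    if "s \<in> gens Type_B n" for s
  proof -
    from that consider k where "1 \<le> k" "k < int n" "s = signed_transpose k (k + 1)"
      | "n \<ge> 1" "s = signed_transpose 1 (-1)"
      unfolding weyl_generators_signed by (auto split: if_splits)
    then show ?thesis
    proof cases
      case 1 then show ?thesis by (intro exI[of _ k] exI[of _ "k + 1"]) auto
    next
      case 2 then show ?thesis by (intro exI[of _ 1] exI[of _ "-1"]) auto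
    qed
  qed
  have sD: "\<exists>i j. i \<noteq> 0 \<and> j \<noteq> 0 \<and> \<bar>i\<bar> \<le> int n \<and> \<bar>j\<bar> \<le> int n \<and> \<bar>i\<bar> \<noteq> \<bar>j\<bar> \<and> s = signed_transpose i j"
    if "s \<in> gens Type_D n" for s
  proof -
    from that consider k where "1 \<le> k" "k < int n" "s = signed_transpose k (k + 1)"
      | "n \<ge> 2" "s = signed_transpose 1 (-2)"
      unfolding weyl_generators_signed by (auto split: if_splits)
    then show ?thesis
    proof cases
      case 1 then show ?thesis by (intro exI[of _ k] exI[of _ "k + 1"]) auto
    next
      case 2 then show ?thesis by (intro exI[of _ 1] exI[of _ "-2"]) auto
    qed
  qed
  show "\<exists>i j. i \<noteq> 0 \<and> j \<noteq> 0 \<and> \<bar>i\<bar> \<le> int n \<and> \<bar>j\<bar> \<le> int n \<and> i \<noteq> j \<and> t = signed_transpose i j"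
    if tT: "t \<in> reflections (W Type_B n) (gens Type_B n)"
  proof -
    obtain w s where w: "w \<in> signed_permutations n" "s \<in> gens Type_B n" "t = w \<circ> s \<circ> inv_into UNIV w"
      using tT unfolding B0.reflections_eq classical_carrier.simps by blast
    obtain i j where ij: "i \<noteq> 0" "j \<noteq> 0" "\<bar>i\<bar> \<le> int n" "\<bar>j\<bar> \<le> int n" "i \<noteq> j" "s = signed_transpose i j"
      using sB[OF w(2)] by blast
    from conj[OF w(1) ij(1-5)] show ?thesis unfolding w(3) ij(6) by blast
  qed
  show "\<exists>i j. i \<noteq> 0 \<and> j \<noteq> 0 \<and> \<bar>i\<bar> \<le> int n \<and> \<bar>j\<bar> \<le> int n \<and> \<bar>i\<bar> \<noteq> \<bar>j\<bar> \<and> t = signed_transpose i j"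
    if tT: "t \<in> reflections (W Type_D n) (gens Type_D n)"
  proof -
    obtain w s where w: "w \<in> signed_permutations n" "s \<in> gens Type_D n" "t = w \<circ> s \<circ> inv_into UNIV w"
      using tT unfolding D0.reflections_eq classical_carrier.simps by blast
    obtain i j where ij: "i \<noteq> 0" "j \<noteq> 0" "\<bar>i\<bar> \<le> int n" "\<bar>j\<bar> \<le> int n" "\<bar>i\<bar> \<noteq> \<bar>j\<bar>" "s = signed_transpose i j"
      using sD[OF w(2)] by blast
    have "i \<noteq> j" using ij(5) by auto
    from conj[OF w(1) ij(1-4) this] show ?thesis using ij(5) unfolding w(3) ij(6) by blast
  qed
qed

lemma adjacent_reverses:
  assumes "k \<ge> 1" "a \<noteq> 0" "c \<noteq> 0" "a \<noteq> c" "reverses (signed_transpose k (k + 1)) a c"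
  shows "signed_transpose a c = signed_transpose k (k + 1)"
proof -
  have "(a, c) \<in> {(k, k + 1), (k + 1, k), (- k, - (k + 1)), (- (k + 1), - k)}"
    using assms unfolding reverses_def signed_transpose_def by (auto split: if_splits)
  then show ?thesis
    using signed_transpose_sym[of k "k + 1"] signed_transpose_sym[of "k + 1" k] assms(1) by auto
qed

text \<open>Zero is the only integer between the two points exchanged. It has to be excluded, since
  the sign change also reverses the pair 0, 1, which belongs to no root.\<close>

lemma sign_change_reverses:
  assumes "a \<noteq> 0" "c \<noteq> 0" "a \<noteq> c" "reverses (signed_transpose 1 (-1)) a c"
  shows "signed_transpose a c = signed_transpose 1 (-1)"
proof -
  have "(a, c) \<in> {(1, -1), (-1, 1)}"
    using assms unfolding reverses_def signed_transpose_def by (auto split: if_splits)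
  then show ?thesis using signed_transpose_sym[of 1 "-1"] by auto
qed

text \<open>The condition on absolute values matters: this generator also reverses the pairs 1, -1
  and 2, -2, which stand for roots of type B but not of type D.\<close>

lemma branch_reverses:
  assumes "a \<noteq> 0" "c \<noteq> 0" "\<bar>a\<bar> \<noteq> \<bar>c\<bar>" "reverses (signed_transpose 1 (-2)) a c"
  shows "signed_transpose a c = signed_transpose 1 (-2)"
proof -
  have "(a, c) \<in> {(1, -2), (-2, 1), (-1, 2), (2, -1)}"
    using assms unfolding reverses_def signed_transpose_def by (auto split: if_splits)
  then show ?thesis using signed_transpose_sym[of 1 "-2"] signed_transpose_sym[of "-2" 1] by auto
qed

lemma signed_transpose_simple:
  assumes "i \<noteq> 0" "j \<noteq> 0" "i \<noteq> j"
  shows "signed_transpose i j \<circ> signed_transpose i j = id" "\<exists>a. signed_transpose i j a \<noteq> a"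
  using assms signed_transpose_involution by (auto simp: signed_transpose_def intro!: exI[of _ i])

lemma inverts_signed_transposeD:
  assumes "inverts s (signed_transpose i j)" "i \<noteq> 0" "j \<noteq> 0"
  shows "\<exists>a c. a \<noteq> 0 \<and> c \<noteq> 0 \<and> a \<noteq> c \<and> reverses s a c \<and>
    signed_transpose i j = signed_transpose a c \<and> (\<bar>i\<bar> \<noteq> \<bar>j\<bar> \<longrightarrow> \<bar>a\<bar> \<noteq> \<bar>c\<bar>)"
proof -
  obtain a where a: "signed_transpose i j a \<noteq> a" "reverses s a (signed_transpose i j a)"
    using assms(1) unfolding inverts_def by blast
  let ?c = "signed_transpose i j a"
  have p: "(a, ?c) \<in> {(i, j), (j, i), (- i, - j), (- j, - i)}"
    using a(1) by (rule signed_transpose_moved_pairs)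
  have "signed_transpose i j = signed_transpose a ?c"
    by (rule signed_transpose_moved[OF assms(2,3) a(1)])
  moreover have "a \<noteq> 0" "?c \<noteq> 0" "\<bar>i\<bar> \<noteq> \<bar>j\<bar> \<longrightarrow> \<bar>a\<bar> \<noteq> \<bar>?c\<bar>" using p assms by auto
  ultimately show ?thesis using a by (intro exI[of _ a] exI[of _ ?c]) auto
qed

lemma window_increasing:
  assumes "\<And>s. s \<in> gens \<tau> n \<Longrightarrow> \<not> inverts w s" "\<tau> \<noteq> Type_A" "1 \<le> i" "i < int n"
  shows "w i < w (i + 1)"
proof (rule not_inverts_less[of w i "i + 1"])
  have "signed_transpose i (i + 1) \<in> gens \<tau> n"
    using assms(2-) by (cases \<tau>) (auto simp: weyl_generators_signed simp del: weyl_generators.simps)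
  then show "\<not> inverts w (signed_transpose i (i + 1))" by (rule assms(1))
qed simp

lemma signed_perm_id:
  assumes w: "w \<in> signed_permutations n" and "\<And>i. 1 \<le> i \<Longrightarrow> i \<le> int n \<Longrightarrow> w i = i"
  shows "w = id"
proof
  fix i
  consider "i = 0" | "1 \<le> i" "i \<le> int n" | "1 \<le> - i" "- i \<le> int n" | "\<bar>i\<bar> > int n" by linarith
  then show "w i = id i"
  proof cases
    case 3
    then show ?thesis using assms(2)[of "- i"] signed_perm_facts(3)[OF w] by simp
  next
    case 4
    then have "i \<notin> symmetric_ints n" by auto
    then show ?thesis using permutes_not_in[OF signed_perm_facts(1)[OF w]] by simp
  qed (use assms(2) signed_perm_facts(4)[OF w] in auto)
qed

interpretation B: permutation_reflections "classical_carrier Type_B n" "W Type_B n" "gens Type_B n" for n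
proof
  show "gens Type_B n \<subseteq> classical_carrier Type_B n"
    unfolding weyl_generators_signed by (auto intro!: signed_transpose_perm split: if_splits)
next
  fix s assume "s \<in> gens Type_B n"
  then consider k where "1 \<le> k" "s = signed_transpose k (k + 1)" | "s = signed_transpose 1 (-1)"
    unfolding weyl_generators_signed by (auto split: if_splits)
  then have "\<exists>i j. i \<noteq> 0 \<and> j \<noteq> 0 \<and> i \<noteq> j \<and> s = signed_transpose i j \<and>
      (\<forall>a c. a \<noteq> 0 \<longrightarrow> c \<noteq> 0 \<longrightarrow> a \<noteq> c \<longrightarrow> reverses s a c \<longrightarrow> signed_transpose a c = s)"
  proof cases
    case 1
    show ?thesis
      by (rule exI[of _ k], rule exI[of _ "k + 1"]) (use 1 adjacent_reverses[of k] in auto)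
  next
    case 2
    show ?thesis
      by (rule exI[of _ 1], rule exI[of _ "-1"]) (use 2 sign_change_reverses in auto)
  qed
  then obtain i j where ij: "i \<noteq> 0" "j \<noteq> 0" "i \<noteq> j" and s: "s = signed_transpose i j"
    and u: "\<And>a c. a \<noteq> 0 \<Longrightarrow> c \<noteq> 0 \<Longrightarrow> a \<noteq> c \<Longrightarrow> reverses s a c \<Longrightarrow> signed_transpose a c = s"
    by blast
  show "s \<circ> s = id" "\<exists>a. s a \<noteq> a" unfolding s by (rule signed_transpose_simple[OF ij])+
  show "reverses u a (s a) = reverses u b (s b)"
    if "u \<in> classical_carrier Type_B n" "s a \<noteq> a" "s b \<noteq> b" for u a b
    unfolding s by (rule signed_transpose_consistent[of u n i j]) (use that ij s in auto)
  show "t = s" if tT: "t \<in> reflections (W Type_B n) (gens Type_B n)" and inv: "inverts s t" for t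
  proof -
    obtain k l where kl: "k \<noteq> 0" "l \<noteq> 0" "t = signed_transpose k l"
      using reflections_BD(1)[OF tT] by blast
    have "inverts s (signed_transpose k l)" using inv kl(3) by simp
    from inverts_signed_transposeD[OF this kl(1,2)] obtain a c
      where "a \<noteq> 0" "c \<noteq> 0" "a \<noteq> c" "reverses s a c" "signed_transpose k l = signed_transpose a c"
      by blast
    then show ?thesis using u[of a c] kl(3) by simp
  qed
next
  fix w assume w: "w \<in> classical_carrier Type_B n" and nd: "\<And>s. s \<in> gens Type_B n \<Longrightarrow> \<not> inverts w s"
  have w': "w \<in> signed_permutations n" using w by simp
  have inc: "w i < w (i + 1)" if "1 \<le> i" "i < int n" for i
    by (rule window_increasing[of Type_B n w i, OF nd]) (use that in simp_all)
  show "w = id"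
  proof (rule signed_perm_id[OF w'])
    fix i assume i: "1 \<le> i" "i \<le> int n"
    then have "signed_transpose 1 (-1) \<in> gens Type_B n"
      unfolding weyl_generators_signed by auto
    then have "\<not> inverts w (signed_transpose (-1) 1)" using nd signed_transpose_sym(1)[of 1 "-1"] by auto
    from not_inverts_less[OF this] have "w 1 > 0" using signed_perm_facts(3)[OF w', of 1] by simp
    then show "w i = i"
      using int_increasing_eq_id[of "int n" w i] inc i signed_perm_range(2)[OF w', of "int n"] by auto
  qed
qed

interpretation D: permutation_reflections "classical_carrier Type_D n" "W Type_D n" "gens Type_D n" for n
proof
  show "gens Type_D n \<subseteq> classical_carrier Type_D n"
    unfolding weyl_generators_signed using signed_transpose_D[of _ _ n] by (auto split: if_splits)
next
  fix s assume "s \<in> gens Type_D n"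
  then consider k where "1 \<le> k" "s = signed_transpose k (k + 1)" | "s = signed_transpose 1 (-2)"
    unfolding weyl_generators_signed by (auto split: if_splits)
  then have "\<exists>i j. i \<noteq> 0 \<and> j \<noteq> 0 \<and> i \<noteq> j \<and> s = signed_transpose i j \<and>
      (\<forall>a c. a \<noteq> 0 \<longrightarrow> c \<noteq> 0 \<longrightarrow> \<bar>a\<bar> \<noteq> \<bar>c\<bar> \<longrightarrow> reverses s a c \<longrightarrow> signed_transpose a c = s)"
  proof cases
    case 1
    show ?thesis
      by (rule exI[of _ k], rule exI[of _ "k + 1"]) (use 1 adjacent_reverses[of k] in auto)
  next
    case 2
    show ?thesis
      by (rule exI[of _ 1], rule exI[of _ "-2"]) (use 2 branch_reverses in auto)
  qed
  then obtain i j where ij: "i \<noteq> 0" "j \<noteq> 0" "i \<noteq> j" and s: "s = signed_transpose i j"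
    and u: "\<And>a c. a \<noteq> 0 \<Longrightarrow> c \<noteq> 0 \<Longrightarrow> \<bar>a\<bar> \<noteq> \<bar>c\<bar> \<Longrightarrow> reverses s a c \<Longrightarrow> signed_transpose a c = s"
    by blast
  show "s \<circ> s = id" "\<exists>a. s a \<noteq> a" unfolding s by (rule signed_transpose_simple[OF ij])+
  show "reverses u a (s a) = reverses u b (s b)"
    if "u \<in> classical_carrier Type_D n" "s a \<noteq> a" "s b \<noteq> b" for u a b
    unfolding s by (rule signed_transpose_consistent[of u n i j]) (use that ij s in auto)
  show "t = s" if tT: "t \<in> reflections (W Type_D n) (gens Type_D n)" and inv: "inverts s t" for t
  proof -
    obtain k l where kl: "k \<noteq> 0" "l \<noteq> 0" "t = signed_transpose k l" "\<bar>k\<bar> \<noteq> \<bar>l\<bar>"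
      using reflections_BD(2)[OF tT] by blast
    have "inverts s (signed_transpose k l)" using inv kl(3) by simp
    from inverts_signed_transposeD[OF this kl(1,2)] obtain a c
      where "a \<noteq> 0" "c \<noteq> 0" "\<bar>a\<bar> \<noteq> \<bar>c\<bar>" "reverses s a c" "signed_transpose k l = signed_transpose a c"
      using kl(4) by blast
    then show ?thesis using u[of a c] kl(3) by simp
  qed
next
  fix w assume w: "w \<in> classical_carrier Type_D n" and nd: "\<And>s. s \<in> gens Type_D n \<Longrightarrow> \<not> inverts w s"
  have w': "w \<in> signed_permutations n" and ev: "even (card {i \<in> {1..int n}. w i < 0})" using w by simp_all
  have inc: "w i < w (i + 1)" if "1 \<le> i" "i < int n" for i
    by (rule window_increasing[of Type_D n w i, OF nd]) (use that in simp_all)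
  have second: "- w 1 < w 2" if "n \<ge> 2"
  proof -
    have "signed_transpose 1 (-2) \<in> gens Type_D n"
      using that unfolding weyl_generators_signed by auto
    then have "\<not> inverts w (signed_transpose (-1) 2)"
      using nd signed_transpose_sym(2)[of 1 "-2"] by auto
    from not_inverts_less[OF this] show ?thesis using signed_perm_facts(3)[OF w', of 1] by simp
  qed
  have pos: "w i > 0" if "2 \<le> i" "i \<le> int n" for i
    using that
  proof (induction i rule: int_ge_induct)
    case base
    then show ?case using second inc[of 1] by auto
  next
    case (step i)
    then show ?case using inc[of i] by auto
  qed
  \<comment> \<open>Since w 2 exceeds both w 1 and - w 1, only the first entry can be negative and
    the absolute values increase strictly. They are therefore those of the identity, and the even
    number of negative entries settles the sign of the first one.\<close>
  have abs_inc: "\<bar>w i\<bar> < \<bar>w (i + 1)\<bar>" if "1 \<le> i" "i < int n" for i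
  proof (cases "i = 1")
    case True
    then show ?thesis using second inc[of 1] that by auto
  next
    case False
    then show ?thesis using pos[of i] pos[of "i + 1"] inc[of i] that by auto
  qed
  have abs_id: "\<bar>w i\<bar> = i" if "1 \<le> i" "i \<le> int n" for i
    using int_increasing_eq_id[of "int n" "\<lambda>i. \<bar>w i\<bar>" i] abs_inc that
      signed_perm_range(2)[OF w', of "int n"] signed_perm_range(1)[OF w', of 1] by auto
  show "w = id"
  proof (rule signed_perm_id[OF w'])
    fix i assume i: "1 \<le> i" "i \<le> int n"
    show "w i = i"
    proof (cases "i = 1")
      case True
      show ?thesis
      proof (rule ccontr)
        assume "w i \<noteq> i"
        then have "w 1 < 0" using abs_id[of 1] i True by auto
        moreover have "k = 1" if "1 \<le> k" "k \<le> int n" "w k < 0" for k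
          using pos[of k] that by (cases "k = 1") auto
        ultimately have "{i \<in> {1..int n}. w i < 0} = {1}"
          using i True by auto
        then show False using ev by simp
      qed
    next
      case False
      then show ?thesis using pos[of i] abs_id[of i] i by auto
    qed
  qed
qed

lemma weyl_reflections_conj:
  assumes "t \<in> reflections (W \<tau> n) (gens \<tau> n)" "w \<in> classical_carrier \<tau> n" "\<tau> \<noteq> Type_A"
    "t = signed_transpose i j"
  shows "signed_transpose (w i) (w j) \<in> reflections (W \<tau> n) (gens \<tau> n)"
proof -
  have w: "w \<in> signed_permutations n" using assms(2,3) by (cases \<tau>) auto
  show ?thesis
  proof (cases \<tau>)
    case Type_B
    then have "w \<circ> t \<circ> inv_into UNIV w \<in> reflections (W \<tau> n) (gens \<tau> n)"
      using B.cocycle.T_conj[of w n t] B0.m_inv_eq[of w n] assms(1,2) by (simp add: weyl_group_def)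
    then show ?thesis unfolding assms(4) signed_transpose_conj[OF w] .
  next
    case Type_D
    then have "w \<circ> t \<circ> inv_into UNIV w \<in> reflections (W \<tau> n) (gens \<tau> n)"
      using D.cocycle.T_conj[of w n t] D0.m_inv_eq[of w n] assms(1,2)
      by (simp add: weyl_group_def del: classical_carrier.simps)
    then show ?thesis unfolding assms(4) signed_transpose_conj[OF w] .
  qed (use assms(3) in simp)
qed

text \<open>Conjugating the reflection of a, b by the group element that exchanges b and c gives the
  reflection of a, c, provided that the three absolute values differ. Only membership of that
  element in the group is used. Starting from the generator with indices 1, 2 all pairs are reached;
  \<open>n \<ge> 3\<close> supplies the third index.\<close>

lemma signed_transpose_in_reflections:
  assumes \<tau>: "\<tau> \<noteq> Type_A" and n: "n \<ge> 3"
    and ij: "i \<noteq> 0" "j \<noteq> 0" "\<bar>i\<bar> \<le> int n" "\<bar>j\<bar> \<le> int n" "\<bar>i\<bar> \<noteq> \<bar>j\<bar>"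
  shows "signed_transpose i j \<in> reflections (W \<tau> n) (gens \<tau> n)"
proof -
  let ?T = "reflections (W \<tau> n) (gens \<tau> n)"
  define R where "R a b \<longleftrightarrow> a \<noteq> 0 \<and> b \<noteq> 0 \<and> \<bar>a\<bar> \<le> int n \<and> \<bar>b\<bar> \<le> int n \<and> \<bar>a\<bar> \<noteq> \<bar>b\<bar> \<and>
    signed_transpose a b \<in> ?T" for a b
  have carrier: "signed_transpose b c \<in> classical_carrier \<tau> n"
    if "b \<noteq> 0" "c \<noteq> 0" "\<bar>b\<bar> \<le> int n" "\<bar>c\<bar> \<le> int n" "\<bar>b\<bar> \<noteq> \<bar>c\<bar>" for b c
    using signed_transpose_D[OF that] signed_transpose_perm[OF that(1-4)] \<tau>
    by (cases \<tau>) (simp_all del: classical_carrier.simps(3))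
  have sym: "R b a" if "R a b" for a b
    using that signed_transpose_sym(1)[of a b] by (auto simp: R_def)
  have step: "R a c" if "R a b" "c \<noteq> 0" "\<bar>c\<bar> \<le> int n" "\<bar>c\<bar> \<noteq> \<bar>a\<bar>" "\<bar>c\<bar> \<noteq> \<bar>b\<bar>" for a b c
  proof -
    have "signed_transpose (signed_transpose b c a) (signed_transpose b c b) \<in> ?T"
      by (rule weyl_reflections_conj[OF _ carrier \<tau> refl]) (use that in \<open>auto simp: R_def\<close>)
    moreover have "signed_transpose b c a = a" "signed_transpose b c b = c"
      using that by (auto simp: R_def signed_transpose_def)
    ultimately show ?thesis using that by (auto simp: R_def)
  qed
  have "signed_transpose 1 2 \<in> gens \<tau> n"
  proof -
    have "signed_transpose 1 2 = (\<lambda>k. signed_transpose k (k + 1)) 1" "1 \<in> {1..<int n}" using n by auto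
    then have "signed_transpose 1 2 \<in> (\<lambda>k. signed_transpose k (k + 1)) ` {1..<int n}" by (rule image_eqI)
    then show ?thesis using \<tau>
      by (cases \<tau>) (simp_all only: weyl_generators_signed Un_iff simp_thms classical_type.distinct)
  qed
  then have "signed_transpose 1 2 \<in> ?T"
    using B.cocycle.S_T D.cocycle.S_T \<tau> by (cases \<tau>) (simp_all del: weyl_generators.simps)
  then have 12: "R 1 2" using n by (auto simp: R_def)
  have 13: "R 1 3" by (rule step[OF 12]) (use n in auto)
  have one: "R 1 c" if "c \<noteq> 0" "\<bar>c\<bar> \<le> int n" "\<bar>c\<bar> \<noteq> 1" for c
    using step[OF 12, of c] step[OF 13, of c] that by (cases "\<bar>c\<bar> = 2") auto
  have general: "R i j" if "i \<noteq> 0" "j \<noteq> 0" "\<bar>i\<bar> \<le> int n" "\<bar>j\<bar> \<le> int n" "\<bar>i\<bar> \<noteq> \<bar>j\<bar>" "\<bar>i\<bar> \<noteq> 1" "\<bar>j\<bar> \<noteq> 1" for i j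
    using step[OF sym[OF one[of j]], of i] sym that by auto
  \<comment> \<open>Index -1 is reached by way of a pair j, d with \<bar>d\<bar> different from 1
    and \<bar>j\<bar>, after which d is exchanged for -1.\<close>
  have minus1: "R (-1) j" if "j \<noteq> 0" "\<bar>j\<bar> \<le> int n" "\<bar>j\<bar> \<noteq> 1" for j
  proof -
    define d where "d = (if \<bar>j\<bar> = 2 then 3 else 2 :: int)"
    have "R j d" by (rule general) (use that n in \<open>auto simp: d_def\<close>)
    from step[OF this, of "-1"] show ?thesis using that n by (auto simp: d_def intro: sym split: if_splits)
  qed
  have "R i j"
  proof -
    consider "\<bar>i\<bar> \<noteq> 1" "\<bar>j\<bar> \<noteq> 1" | "i = 1" | "i = -1" | "j = 1" | "j = -1" by linarith
    then show ?thesis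
    proof cases
      case 1 then show ?thesis using general ij by blast
    next
      case 2 then show ?thesis using one[of j] ij by simp
    next
      case 3 then show ?thesis using minus1[of j] ij by simp
    next
      case 4 then show ?thesis using sym[OF one[of i]] ij by simp
    next
      case 5 then show ?thesis using sym[OF minus1[of i]] ij by simp
    qed
  qed
  then show ?thesis by (simp add: R_def)
qed

text \<open>In this normal form j is the largest moved point and i is its image, so both can be read
  off the map.\<close>

lemma signed_transpose_eqD:
  assumes "signed_transpose i j = signed_transpose k l"
    "- j \<le> i" "i < j" "i \<noteq> 0" "- l \<le> k" "k < l" "k \<noteq> 0"
  shows "i = k \<and> j = l"
proof -
  have "j \<le> l"
  proof (rule ccontr)
    assume "\<not> j \<le> l"
    then have "signed_transpose k l j = j" using assms(2-) by (auto simp: signed_transpose_def)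
    moreover have "signed_transpose i j j = i" using assms(2-) by (auto simp: signed_transpose_def)
    ultimately show False using assms(1,2-7) by simp
  qed
  moreover have "l \<le> j"
  proof (rule ccontr)
    assume "\<not> l \<le> j"
    then have "signed_transpose i j l = l" using assms(2-) by (auto simp: signed_transpose_def)
    moreover have "signed_transpose k l l = k" using assms(2-) by (auto simp: signed_transpose_def)
    ultimately show False using assms(1,2-7) by simp
  qed
  ultimately have "j = l" by simp
  have "signed_transpose i j j = i" "signed_transpose k l l = k"
    using assms(2-) by (auto simp: signed_transpose_def)
  then have "i = k" using assms(1) \<open>j = l\<close> by metis
  then show ?thesis using \<open>j = l\<close> by blast
qed

lemma signed_transpose_normal_form:
  assumes "i \<noteq> 0" "j \<noteq> 0" "i \<noteq> j" "\<bar>i\<bar> \<le> int n" "\<bar>j\<bar> \<le> int n"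
  obtains k l where "signed_transpose i j = signed_transpose k l" "- l \<le> k" "k < l" "k \<noteq> 0" "l \<le> int n"
    "{\<bar>k\<bar>, \<bar>l\<bar>} = {\<bar>i\<bar>, \<bar>j\<bar>}"
proof -
  have s: "signed_transpose i j = signed_transpose j i" "signed_transpose i j = signed_transpose (- i) (- j)"
    "signed_transpose i j = signed_transpose (- j) (- i)"
    using signed_transpose_sym[of i j] signed_transpose_sym[of j i] assms by auto
  consider "\<bar>i\<bar> \<le> j" | "\<bar>i\<bar> \<le> - j" | "\<bar>j\<bar> < i" | "\<bar>j\<bar> < - i" by linarith
  then show ?thesis
  proof cases
    case 1 show ?thesis by (rule that[of i j]) (use 1 assms in auto)
  next
    case 2 show ?thesis by (rule that[of "- i" "- j"]) (use 2 assms s in auto)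
  next
    case 3 show ?thesis by (rule that[of j i]) (use 3 assms s in auto)
  next
    case 4 show ?thesis by (rule that[of "- j" "- i"]) (use 4 assms s in auto)
  qed
qed

section \<open>Inversions of types B and D as pairs of positions\<close>

text \<open>One pair per positive root of type D: i > 0 stands for the difference of the coordinates
  i and j, and i < 0 for the sum of the coordinates -i and j. Admitting i = - j, as in
  \<open>inv_B\<close>, adds the short roots of type B.\<close>

definition inv_D :: "nat \<Rightarrow> (int \<Rightarrow> int) \<Rightarrow> nat" where
  "inv_D n w = card {(i, j). - j < i \<and> i < j \<and> i \<noteq> 0 \<and> j \<le> int n \<and> w j < w i}"

definition inv_B :: "nat \<Rightarrow> (int \<Rightarrow> int) \<Rightarrow> nat" where
  "inv_B n w = card {(i, j). - j \<le> i \<and> i < j \<and> i \<noteq> 0 \<and> j \<le> int n \<and> w j < w i}"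

lemma coxeter_inv_D:
  assumes w: "w \<in> classical_carrier Type_D n" and n: "n \<ge> 3"
  shows "coxeter_inv (W Type_D n) (gens Type_D n) w = inv_D n w"
proof -
  let ?P = "{(i, j). - j < i \<and> i < j \<and> i \<noteq> 0 \<and> j \<le> int n}"
  let ?T = "reflections (W Type_D n) (gens Type_D n)"
  have "(\<lambda>(i, j). signed_transpose i j) ` ?P = ?T"
  proof safe
    fix i j :: int assume "- j < i" "i < j" "i \<noteq> 0" "j \<le> int n"
    then show "signed_transpose i j \<in> ?T" using n by (intro signed_transpose_in_reflections) auto
  next
    fix t assume "t \<in> ?T"
    then obtain i j where ij: "i \<noteq> 0" "j \<noteq> 0" "\<bar>i\<bar> \<le> int n" "\<bar>j\<bar> \<le> int n" "\<bar>i\<bar> \<noteq> \<bar>j\<bar>" "t = signed_transpose i j"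
      using reflections_BD(2) by blast
    then have "i \<noteq> j" by auto
    from ij(1,2) this ij(3,4) obtain k l where kl: "t = signed_transpose k l" "- l \<le> k" "k < l" "k \<noteq> 0" "l \<le> int n"
      "{\<bar>k\<bar>, \<bar>l\<bar>} = {\<bar>i\<bar>, \<bar>j\<bar>}" unfolding ij(6) by (rule signed_transpose_normal_form)
    have "k \<noteq> - l" using kl(6) ij(5) by (auto simp: doubleton_eq_iff)
    then show "t \<in> (\<lambda>(i, j). signed_transpose i j) ` ?P"
      using kl by (intro image_eqI[of _ _ "(k, l)"]) auto
  qed
  moreover have "inj_on (\<lambda>(i, j). signed_transpose i j) ?P"
    by (rule inj_onI, clarify) (rule signed_transpose_eqD, auto)
  ultimately have "coxeter_inv (W Type_D n) (gens Type_D n) w = card {(i, j) \<in> ?P. w j < w i}"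
    by (rule D.coxeter_inv_pairs) (use w in \<open>auto simp: signed_transpose_def\<close>)
  also have "{(i, j) \<in> ?P. w j < w i} = {(i, j). - j < i \<and> i < j \<and> i \<noteq> 0 \<and> j \<le> int n \<and> w j < w i}" by auto
  finally show ?thesis unfolding inv_D_def .
qed

lemma coxeter_inv_B:
  assumes w: "w \<in> classical_carrier Type_B n" and n: "n \<ge> 3"
  shows "coxeter_inv (W Type_B n) (gens Type_B n) w = inv_B n w"
proof -
  let ?P = "{(i, j). - j \<le> i \<and> i < j \<and> i \<noteq> 0 \<and> j \<le> int n}"
  let ?T = "reflections (W Type_B n) (gens Type_B n)"
  have "signed_transpose 1 (-1) \<in> gens Type_B n" using n unfolding weyl_generators_signed by auto
  then have "signed_transpose 1 (-1) \<in> ?T" by (rule B.cocycle.S_T)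
  then have s1: "signed_transpose (-1) 1 \<in> ?T" using signed_transpose_sym(1)[of 1 "-1"] by simp
  have short: "signed_transpose (- j) j \<in> ?T" if j: "1 \<le> j" "j \<le> int n" for j
  proof (cases "j = 1")
    case False
    \<comment> \<open>The short root at j is obtained from the one at 1 by conjugation with the
      exchange of 1 and j.\<close>
    have "signed_transpose (signed_transpose 1 j (-1)) (signed_transpose 1 j 1) \<in> ?T"
      by (rule weyl_reflections_conj[OF s1 _ _ refl]) (use j False n in \<open>auto intro!: signed_transpose_perm\<close>)
    then show ?thesis using False j by (simp add: signed_transpose_def[of 1 j])
  qed (use s1 in simp)
  have "(\<lambda>(i, j). signed_transpose i j) ` ?P = ?T"
  proof safe
    fix i j :: int assume "- j \<le> i" "i < j" "i \<noteq> 0" "j \<le> int n"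
    then show "signed_transpose i j \<in> ?T"
      using n short[of j] signed_transpose_in_reflections[of Type_B n i j] by (cases "i = - j") auto
  next
    fix t assume "t \<in> ?T"
    then obtain i j where ij: "i \<noteq> 0" "j \<noteq> 0" "\<bar>i\<bar> \<le> int n" "\<bar>j\<bar> \<le> int n" "i \<noteq> j" "t = signed_transpose i j"
      using reflections_BD(1) by blast
    from ij(1,2,5,3,4) obtain k l where kl: "t = signed_transpose k l" "- l \<le> k" "k < l" "k \<noteq> 0" "l \<le> int n"
      unfolding ij(6) by (rule signed_transpose_normal_form)
    then show "t \<in> (\<lambda>(i, j). signed_transpose i j) ` ?P"
      by (intro image_eqI[of _ _ "(k, l)"]) auto
  qed
  moreover have "inj_on (\<lambda>(i, j). signed_transpose i j) ?P"
    by (rule inj_onI, clarify) (rule signed_transpose_eqD, auto)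
  ultimately have "coxeter_inv (W Type_B n) (gens Type_B n) w = card {(i, j) \<in> ?P. w j < w i}"
    by (rule B.coxeter_inv_pairs) (use w in \<open>auto simp: signed_transpose_def\<close>)
  also have "{(i, j) \<in> ?P. w j < w i} = {(i, j). - j \<le> i \<and> i < j \<and> i \<noteq> 0 \<and> j \<le> int n \<and> w j < w i}" by auto
  finally show ?thesis unfolding inv_B_def .
qed

section \<open>Descents of the window and the rank\<close>

lemma card_image_Un_bounds:
  assumes fin: "finite K" "finite E" and E: "card E \<le> 1" and inj: "inj_on f K"
    and Q: "\<And>k. k \<in> K \<Longrightarrow> Q (f k) \<longleftrightarrow> R k"
  shows "card {k \<in> K. R k} \<le> card {s \<in> f ` K \<union> E. Q s}"
    "card {s \<in> f ` K \<union> E. Q s} \<le> card {k \<in> K. R k} + 1"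
proof -
  have "f ` {k \<in> K. R k} = {s \<in> f ` K. Q s}" using Q by auto
  then have eq: "card {k \<in> K. R k} = card {s \<in> f ` K. Q s}"
    using card_image[OF inj_on_subset[OF inj], of "{k \<in> K. R k}"] by auto
  show "card {k \<in> K. R k} \<le> card {s \<in> f ` K \<union> E. Q s}"
    unfolding eq using fin by (intro card_mono) auto
  have "{s \<in> f ` K \<union> E. Q s} \<subseteq> {s \<in> f ` K. Q s} \<union> E" by auto
  then have "card {s \<in> f ` K \<union> E. Q s} \<le> card ({s \<in> f ` K. Q s} \<union> E)"
    using fin by (intro card_mono) auto
  also have "\<dots> \<le> card {s \<in> f ` K. Q s} + card E" by (rule card_Un_le)
  finally show "card {s \<in> f ` K \<union> E. Q s} \<le> card {k \<in> K. R k} + 1" using E eq by simp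
qed

text \<open>The adjacent generators account exactly for the descents of the window. The one further
  generator of types B and D contributes 0 or 1, a bounded error that the limit law does not
  see.\<close>

lemma coxeter_des_bounds:
  assumes w: "w \<in> classical_carrier \<tau> n"
  shows "descents n w \<le> coxeter_des (W \<tau> n) (gens \<tau> n) w"
    "coxeter_des (W \<tau> n) (gens \<tau> n) w \<le> descents n w + 1"
proof -
  have eq: "coxeter_des (W \<tau> n) (gens \<tau> n) w = card {s \<in> gens \<tau> n. inverts w s}"
    using A.cocycle.coxeter_des_eq[of w n] B.cocycle.coxeter_des_eq[of w n] D.cocycle.coxeter_des_eq[of w n] w
    by (cases \<tau>) (simp_all add: weyl_group_def del: weyl_generators.simps)
  have "descents n w \<le> card {s \<in> gens \<tau> n. inverts w s} \<and>
    card {s \<in> gens \<tau> n. inverts w s} \<le> descents n w + 1"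
  proof (cases "\<tau> = Type_A")
    case True
    have A: "gens \<tau> n = (\<lambda>k. Transposition.transpose k (k + 1)) ` {1..<int n} \<union> {}"
      using True by (auto simp: image_iff)
    have wC: "w \<in> classical_carrier Type_A n" using w True by simp
    have ne: "w k \<noteq> w (k + 1)" for k using wC permutes_inj[of w] by (auto simp: inj_eq)
    have Q: "inverts w (Transposition.transpose k (k + 1)) \<longleftrightarrow> w (k + 1) < w k" if k: "k \<in> {1..<int n}" for k
    proof -
      have "Transposition.transpose k (k + 1) \<in> gens Type_A n" using k by auto
      from A.inverts_iff[OF A.cocycle.S_T[OF this] wC, of k]
      have "inverts w (Transposition.transpose k (k + 1)) \<longleftrightarrow> reverses w k (k + 1)" by simp
      then show ?thesis using ne[of k] by (auto simp: reverses_def)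
    qed
    have inj: "inj_on (\<lambda>k. Transposition.transpose k (k + 1)) {1..<int n}"
    proof (rule inj_onI)
      fix k l :: int assume "Transposition.transpose k (k + 1) = Transposition.transpose l (l + 1)"
      from fun_cong[OF this, of k] have *: "Transposition.transpose l (l + 1) k = k + 1" by simp
      show "k = l"
      proof (rule ccontr)
        assume "k \<noteq> l"
        then have "Transposition.transpose l (l + 1) k \<in> {l, k}" "k \<noteq> l + 1 \<longrightarrow> Transposition.transpose l (l + 1) k = k"
          by (auto simp: Transposition.transpose_def)
        then show False using * by (cases "k = l + 1") auto
      qed
    qed
    show ?thesis unfolding A descents_def
      using card_image_Un_bounds[where Q = "inverts w" and R = "\<lambda>k. w (k + 1) < w k" and E = "{}", OF _ _ _ inj Q] by simp
  next
    case False
    obtain E where E: "gens \<tau> n = (\<lambda>k. signed_transpose k (k + 1)) ` {1..<int n} \<union> E" "finite E" "card E \<le> 1"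
    proof (cases \<tau>)
      case Type_B
      show ?thesis by (rule that[OF weyl_generators_signed(1)[of n, folded Type_B]]) auto
    next
      case Type_D
      show ?thesis by (rule that[OF weyl_generators_signed(2)[of n, folded Type_D]]) auto
    qed (use False in simp)
    have w': "w \<in> signed_permutations n" using w False by (cases \<tau>) auto
    have ne: "w k \<noteq> w (k + 1)" for k using signed_perm_facts(5)[OF w'] by simp
    have Q: "inverts w (signed_transpose k (k + 1)) \<longleftrightarrow> w (k + 1) < w k" if k: "k \<in> {1..<int n}" for k
    proof -
      have "signed_transpose k (k + 1) \<in> gens \<tau> n" unfolding E(1) using k by auto
      moreover have at: "signed_transpose k (k + 1) k = k + 1" by (simp add: signed_transpose_def)
      ultimately have "inverts w (signed_transpose k (k + 1)) \<longleftrightarrow> reverses w k (k + 1)"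
        using B.inverts_iff[of "signed_transpose k (k + 1)" n w k] B.cocycle.S_T[of "signed_transpose k (k + 1)" n]
          D.inverts_iff[of "signed_transpose k (k + 1)" n w k] D.cocycle.S_T[of "signed_transpose k (k + 1)" n] w False
        by (cases \<tau>) (simp_all del: weyl_generators.simps classical_carrier.simps)
      then show ?thesis using ne[of k] by (auto simp: reverses_def)
    qed
    have inj: "inj_on (\<lambda>k. signed_transpose k (k + 1)) {1..<int n}"
    proof (rule inj_onI)
      fix k l assume "k \<in> {1..<int n}" "l \<in> {1..<int n}" "signed_transpose k (k + 1) = signed_transpose l (l + 1)"
      then show "k = l" using signed_transpose_eqD[of k "k + 1" l "l + 1"] by auto
    qed
    show ?thesis unfolding E(1) descents_def
      using card_image_Un_bounds[where Q = "inverts w" and R = "\<lambda>k. w (k + 1) < w k", OF _ E(2,3) inj Q] by simp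
  qed
  then show "descents n w \<le> coxeter_des (W \<tau> n) (gens \<tau> n) w"
    "coxeter_des (W \<tau> n) (gens \<tau> n) w \<le> descents n w + 1" unfolding eq by auto
qed

text \<open>Transfers the growth hypothesis from the rank to the number of letters, which is the
  number of summands in the later estimates.\<close>

lemma weyl_rank_le: "weyl_rank \<tau> n \<le> n"
proof -
  have bound: "card (f ` {1..<int n} \<union> E) \<le> n" if "finite E" "card E \<le> (if n = 0 then 0 else 1)"
    for f :: "int \<Rightarrow> int \<Rightarrow> int" and E
  proof -
    have "card (f ` {1..<int n} \<union> E) \<le> card (f ` {1..<int n}) + card E" by (rule card_Un_le)
    also have "card (f ` {1..<int n}) \<le> card {1..<int n}" by (rule card_image_le) simp
    finally show ?thesis using that(2) by (auto split: if_splits)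
  qed
  have A: "gens Type_A n = (\<lambda>k. Transposition.transpose k (k + 1)) ` {1..<int n} \<union> {}"
    by (auto simp: image_iff)
  show ?thesis
    unfolding weyl_rank_def
  proof (cases \<tau>)
    case Type_A
    show "card (gens \<tau> n) \<le> n" unfolding Type_A A by (rule bound) auto
  next
    case Type_B
    show "card (gens \<tau> n) \<le> n" unfolding Type_B weyl_generators_signed by (rule bound) auto
  next
    case Type_D
    show "card (gens \<tau> n) \<le> n" unfolding Type_D weyl_generators_signed by (rule bound) auto
  qed
qed

section \<open>Comparison with the normal law\<close>

definition std_gauss :: "real measure" where
  "std_gauss = density lborel std_normal_density"

lemma prob_space_std_gauss: "prob_space std_gauss"
  unfolding std_gauss_def by (rule prob_space_normal_density) simp

lemma sets_std_gauss [measurable_cong, simp]: "sets std_gauss = sets borel"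
  by (simp add: std_gauss_def)

lemma space_std_gauss [simp]: "space std_gauss = UNIV"
  by (simp add: std_gauss_def)

interpretation std_gauss: prob_space std_gauss
  by (rule prob_space_std_gauss)

interpretation std_gauss2: pair_prob_space std_gauss std_gauss ..

lemma integral_std_gauss:
  fixes f :: "real \<Rightarrow> real"
  assumes "f \<in> borel_measurable borel"
  shows "(\<integral>x. f x \<partial>std_gauss) = (\<integral>x. std_normal_density x * f x \<partial>lborel)"
  unfolding std_gauss_def using assms by (subst integral_density) auto

lemma integrable_std_gauss_iff:
  fixes f :: "real \<Rightarrow> real"
  assumes "f \<in> borel_measurable borel"
  shows "integrable std_gauss f \<longleftrightarrow> integrable lborel (\<lambda>x. std_normal_density x * f x)"
  unfolding std_gauss_def using assms by (subst integrable_density) auto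

lemma std_gauss_exp:
  fixes t :: real
  shows "integrable std_gauss (\<lambda>z. exp (t * z))" "(\<integral>z. exp (t * z) \<partial>std_gauss) = exp (t\<^sup>2 / 2)"
proof -
  have eq: "std_normal_density z * exp (t * z) = exp (t\<^sup>2 / 2) * normal_density t 1 z" for z
    unfolding normal_density_def by (simp add: exp_add[symmetric] exp_diff[symmetric] field_simps power2_eq_square)
  show "integrable std_gauss (\<lambda>z. exp (t * z))"
    by (subst integrable_std_gauss_iff) (auto simp: eq)
  show "(\<integral>z. exp (t * z) \<partial>std_gauss) = exp (t\<^sup>2 / 2)"
    by (subst integral_std_gauss) (auto simp: eq)
qed

lemma std_gauss_moments:
  "integrable std_gauss (\<lambda>z. z ^ k)"
  "(\<integral>z. z \<partial>std_gauss) = 0" "(\<integral>z. z\<^sup>2 \<partial>std_gauss) = 1" "(\<integral>z. z ^ 3 \<partial>std_gauss) = 0"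
proof -
  show "integrable std_gauss (\<lambda>z. z ^ k)"
    by (subst integrable_std_gauss_iff) (auto intro: integrable_std_normal_moment)
  show "(\<integral>z. z \<partial>std_gauss) = 0"
    using integral_std_normal_moment_odd[of 0] by (subst integral_std_gauss) auto
  show "(\<integral>z. z\<^sup>2 \<partial>std_gauss) = 1"
    using integral_std_normal_moment_even[of 1] by (subst integral_std_gauss) (auto simp: fact_numeral)
  show "(\<integral>z. z ^ 3 \<partial>std_gauss) = 0"
    using integral_std_normal_moment_odd[of 1] by (subst integral_std_gauss) (auto simp: numeral_3_eq_3)
qed

lemma distributed_scaled_gauss:
  assumes "c > 0"
  shows "distributed std_gauss lborel (\<lambda>z. c * z) (normal_density 0 c)"
proof -
  have "distributed std_gauss lborel (\<lambda>z. z) std_normal_density"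
    unfolding distributed_def
    by (auto simp: std_gauss_def intro!: measure_eqI simp: emeasure_distr)
  from std_gauss.normal_density_affine[OF this, of c 0] show ?thesis using assms by simp
qed

lemma distr_scaled_gauss_add:
  assumes "v > 0" "w > 0"
  shows "distr (std_gauss \<Otimes>\<^sub>M std_gauss) lborel (\<lambda>(y, z). sqrt v * y + sqrt w * z) =
    distr std_gauss lborel (\<lambda>z. sqrt (v + w) * z)"
proof -
  let ?P = "std_gauss \<Otimes>\<^sub>M std_gauss"
  have fst: "distr ?P std_gauss fst = std_gauss"
    by (rule std_gauss.distr_pair_fst)
  have snd: "distr ?P std_gauss snd = std_gauss"
    by (intro measure_eqI)
      (auto simp: emeasure_distr snd_vimage_eq_Times space_pair_measure std_gauss.emeasure_pair_measure_Times
        std_gauss.emeasure_space_1[simplified] Times_Int_Times)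
  have b: "distr ?P borel fst = distr std_gauss borel id" "distr ?P borel snd = distr std_gauss borel id"
    by (subst fst[symmetric] snd[symmetric], subst distr_distr, auto simp: comp_def)+
  have id: "distr std_gauss borel id = std_gauss"
    by (auto intro!: measure_eqI simp: emeasure_distr)
  have "std_gauss2.indep_var borel fst borel snd"
    unfolding std_gauss2.indep_var_distribution_eq
    by (auto simp: b id intro!: measure_eqI simp: emeasure_distr cong: sets_pair_measure_cong)
  then have "std_gauss2.indep_var borel ((\<lambda>y. sqrt v * y) \<circ> fst) borel ((\<lambda>y. sqrt w * y) \<circ> snd)"
    by (rule std_gauss2.indep_var_compose) auto
  then have ind: "std_gauss2.indep_var borel (\<lambda>p. sqrt v * fst p) borel (\<lambda>p. sqrt w * snd p)"
    by (simp add: comp_def)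
  have d1: "distributed ?P lborel (\<lambda>p. sqrt v * fst p) (normal_density 0 (sqrt v))"
  proof -
    have "distr ?P lborel (\<lambda>p. sqrt v * fst p) = distr (distr ?P std_gauss fst) lborel (\<lambda>z. sqrt v * z)"
      by (subst distr_distr) (auto simp: comp_def)
    then show ?thesis
      using distributed_scaled_gauss[of "sqrt v"] assms unfolding fst by (simp add: distributed_def)
  qed
  have d2: "distributed ?P lborel (\<lambda>p. sqrt w * snd p) (normal_density 0 (sqrt w))"
  proof -
    have "distr ?P lborel (\<lambda>p. sqrt w * snd p) = distr (distr ?P std_gauss snd) lborel (\<lambda>z. sqrt w * z)"
      by (subst distr_distr) (auto simp: comp_def)
    then show ?thesis
      using distributed_scaled_gauss[of "sqrt w"] assms unfolding snd by (simp add: distributed_def)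
  qed
  have "distributed ?P lborel (\<lambda>p. sqrt v * fst p + sqrt w * snd p) (normal_density (0 + 0) (sqrt ((sqrt v)\<^sup>2 + (sqrt w)\<^sup>2)))"
    by (rule std_gauss2.add_indep_normal[OF ind _ _ d1 d2]) (use assms in auto)
  moreover have "distributed std_gauss lborel (\<lambda>z. sqrt (v + w) * z) (normal_density 0 (sqrt (v + w)))"
    by (rule distributed_scaled_gauss) (use assms in auto)
  ultimately show ?thesis using assms by (simp add: distributed_def case_prod_beta')
qed

text \<open>Lets a freshly substituted Gaussian summand of variance v merge with the Gaussian part
  already present. Zero variances are treated apart because the density of a scaled normal law needs
  a positive scale.\<close>

lemma gauss_semigroup:
  fixes f :: "real \<Rightarrow> real"
  assumes [measurable]: "f \<in> borel_measurable borel" and bd: "\<And>x. \<bar>f x\<bar> \<le> B"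
    and "v \<ge> 0" "w \<ge> 0"
  shows "(\<integral>y. (\<integral>z. f (r + sqrt v * y + sqrt w * z) \<partial>std_gauss) \<partial>std_gauss) =
    (\<integral>z. f (r + sqrt (v + w) * z) \<partial>std_gauss)"
proof -
  consider "v = 0" | "w = 0" | "v > 0" "w > 0" using assms by linarith
  then show ?thesis
  proof cases
    case 3
    let ?P = "std_gauss \<Otimes>\<^sub>M std_gauss"
    have int: "integrable ?P (\<lambda>(y, z). f (r + sqrt v * y + sqrt w * z))"
      by (rule std_gauss2.integrable_const_bound[where B = B]) (use bd in auto)
    have "(\<integral>y. (\<integral>z. f (r + sqrt v * y + sqrt w * z) \<partial>std_gauss) \<partial>std_gauss) =
      (\<integral>p. (case p of (y, z) \<Rightarrow> f (r + sqrt v * y + sqrt w * z)) \<partial>?P)"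
      using std_gauss2.integral_fst'[OF int] by simp
    also have "\<dots> = (\<integral>x. f (r + x) \<partial>distr ?P lborel (\<lambda>(y, z). sqrt v * y + sqrt w * z))"
      by (subst integral_distr) (auto simp: case_prod_beta' add.assoc)
    also have "\<dots> = (\<integral>z. f (r + sqrt (v + w) * z) \<partial>std_gauss)"
      unfolding distr_scaled_gauss_add[OF 3] by (subst integral_distr) auto
    finally show ?thesis .
  qed (simp_all add: std_gauss.prob_space[simplified])
qed


section \<open>Sums of independent symmetric variables\<close>

primrec sum_pmf :: "real pmf list \<Rightarrow> real pmf" where
  "sum_pmf [] = return_pmf 0"
| "sum_pmf (p # ps) = bind_pmf p (\<lambda>x. map_pmf (\<lambda>y. x + y) (sum_pmf ps))"

text \<open>Finite support turns expectations into finite sums, so integrability and the exchange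
  with Gaussian integrals come for free.\<close>

definition symmetric_pmf :: "real \<Rightarrow> real pmf \<Rightarrow> bool" where
  "symmetric_pmf \<rho> p \<longleftrightarrow> finite (set_pmf p) \<and> (\<forall>x\<in>set_pmf p. \<bar>x\<bar> \<le> \<rho>) \<and> map_pmf uminus p = p"

abbreviation second_moment :: "real pmf \<Rightarrow> real" where
  "second_moment p \<equiv> measure_pmf.expectation p (\<lambda>x. x\<^sup>2)"

lemma finite_set_sum_pmf:
  assumes "\<And>p. p \<in> set ps \<Longrightarrow> finite (set_pmf p)"
  shows "finite (set_pmf (sum_pmf ps))"
  using assms by (induction ps) auto

lemma expectation_bind_finite:
  fixes f :: "'b \<Rightarrow> real"
  assumes "finite (set_pmf p)" "\<And>x. x \<in> set_pmf p \<Longrightarrow> finite (set_pmf (q x))"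
  shows "measure_pmf.expectation (bind_pmf p q) f =
    measure_pmf.expectation p (\<lambda>x. measure_pmf.expectation (q x) f)"
proof -
  have "measure_pmf.expectation (bind_pmf p q) f =
    (\<Sum>a\<in>set_pmf p. pmf p a *\<^sub>R measure_pmf.expectation (q a) f)"
    by (rule pmf_expectation_bind) (use assms in auto)
  also have "\<dots> = measure_pmf.expectation p (\<lambda>x. measure_pmf.expectation (q x) f)"
    by (subst integral_measure_pmf[of "set_pmf p"]) (use assms in \<open>auto simp: set_pmf_iff\<close>)
  finally show ?thesis .
qed

lemma expectation_sum_pmf_Cons:
  fixes f :: "real \<Rightarrow> real"
  assumes "\<And>q. q \<in> set (p # ps) \<Longrightarrow> finite (set_pmf q)"
  shows "measure_pmf.expectation (sum_pmf (p # ps)) f =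
    measure_pmf.expectation p (\<lambda>x. measure_pmf.expectation (sum_pmf ps) (\<lambda>y. f (x + y)))"
  unfolding sum_pmf.simps using assms finite_set_sum_pmf[of ps]
  by (subst expectation_bind_finite) auto

section \<open>Lindeberg replacement under an exponential weight\<close>

text \<open>The Lagrange remainder is evaluated at some point within \<bar>h\<bar> of r. Moving the
  weight from there to r costs the factor exp (t \<bar>h\<bar>).\<close>

lemma taylor_exp_bound:
  fixes f :: "nat \<Rightarrow> real \<Rightarrow> real"
  assumes deriv: "\<And>m x. m < 4 \<Longrightarrow> (f m has_real_derivative f (Suc m) x) (at x)"
    and bound: "\<And>x. \<bar>f 4 x\<bar> \<le> L * exp (t * x)" and t: "t \<ge> 0"
  shows "\<bar>f 0 (r + h) - (f 0 r + f 1 r * h + f 2 r / 2 * h\<^sup>2 + f 3 r / 6 * h ^ 3)\<bar>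
    \<le> L / 24 * exp (t * r) * (h ^ 4 * exp (t * \<bar>h\<bar>))"
proof (cases "h = 0")
  case False
  have L: "L \<ge> 0"
    using bound[of 0] by (auto intro: order_trans[OF abs_ge_zero])
  have "\<exists>x. \<bar>x - r\<bar> \<le> \<bar>h\<bar> \<and> f 0 (r + h) = (\<Sum>m<4. f m r / fact m * h ^ m) + f 4 x / fact 4 * h ^ 4"
  proof (cases "h > 0")
    case True
    have "\<exists>x. r < x \<and> x < r + h \<and> f 0 (r + h) = (\<Sum>m<4. f m r / fact m * (r + h - r) ^ m) + f 4 x / fact 4 * (r + h - r) ^ 4"
      by (rule Taylor_up[of 4 f "f 0" r "r + h" r]) (use deriv True in auto)
    then obtain x where "r < x" "x < r + h"
      "f 0 (r + h) = (\<Sum>m<4. f m r / fact m * h ^ m) + f 4 x / fact 4 * h ^ 4"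
      unfolding add_diff_cancel_left' by blast
    then show ?thesis by (intro exI[of _ x] conjI) linarith+
  next
    case nonpos: False
    have "\<exists>x. r + h < x \<and> x < r \<and> f 0 (r + h) = (\<Sum>m<4. f m r / fact m * (r + h - r) ^ m) + f 4 x / fact 4 * (r + h - r) ^ 4"
      by (rule Taylor_down[of 4 f "f 0" "r + h" r r]) (use deriv nonpos False in auto)
    then obtain x where "r + h < x" "x < r"
      "f 0 (r + h) = (\<Sum>m<4. f m r / fact m * h ^ m) + f 4 x / fact 4 * h ^ 4"
      unfolding add_diff_cancel_left' by blast
    then show ?thesis using nonpos by (intro exI[of _ x] conjI) linarith+
  qed
  then obtain x where x: "\<bar>x - r\<bar> \<le> \<bar>h\<bar>"
    and eq: "f 0 (r + h) = (\<Sum>m<4. f m r / fact m * h ^ m) + f 4 x / fact 4 * h ^ 4"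
    by blast
  have "f 0 (r + h) - (f 0 r + f 1 r * h + f 2 r / 2 * h\<^sup>2 + f 3 r / 6 * h ^ 3) = f 4 x / 24 * h ^ 4"
    unfolding eq by (simp add: numeral_eq_Suc lessThan_Suc power2_eq_square)
  then have "\<bar>f 0 (r + h) - (f 0 r + f 1 r * h + f 2 r / 2 * h\<^sup>2 + f 3 r / 6 * h ^ 3)\<bar> = \<bar>f 4 x\<bar> / 24 * h ^ 4"
    by (simp only:) (simp add: abs_mult)
  also have "\<dots> \<le> (L * exp (t * (r + \<bar>h\<bar>))) / 24 * h ^ 4"
  proof -
    have "\<bar>f 4 x\<bar> \<le> L * exp (t * x)" by (rule bound)
    also have "\<dots> \<le> L * exp (t * (r + \<bar>h\<bar>))"
      using x t L by (intro mult_left_mono) (auto intro!: mult_left_mono)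
    finally show ?thesis by (intro mult_right_mono divide_right_mono) auto
  qed
  finally show ?thesis by (simp add: exp_add distrib_left mult_ac)
qed simp

text \<open>The remainder constant for a Gaussian increment. The factor
  \<open>exp \<bar>z\<bar>\<close> pays for the exponential weight over an unbounded step, as
  \<open>t * sqrt v \<le> 1\<close> in its use.\<close>

definition gauss_const :: real where
  "gauss_const = (\<integral>z. z ^ 4 * exp \<bar>z\<bar> \<partial>std_gauss)"

lemma integrable_gauss_const: "integrable std_gauss (\<lambda>z. z ^ 4 * exp \<bar>z\<bar>)"
proof (rule Bochner_Integration.integrable_bound)
  show "integrable std_gauss (\<lambda>z. 24 * exp (2 * z) + 24 * exp ((-2) * z))"
    by (intro Bochner_Integration.integrable_add integrable_mult_right std_gauss_exp)
  \<comment> \<open>The constant is \<open>fact 4\<close>: the fourth term of the exponential series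
    bounds z^4 by 24 exp \<bar>z\<bar>, and exp (2 \<bar>z\<bar>) is at most the sum of the two
    one-sided exponentials.\<close>
  have "z ^ 4 * exp \<bar>z\<bar> \<le> 24 * exp (2 * z) + 24 * exp (- (2 * z))" for z :: real
  proof -
    have "\<bar>z\<bar> ^ 4 / 24 \<le> exp \<bar>z\<bar>"
    proof -
      have "(\<Sum>n\<in>{4}. inverse (fact n) * \<bar>z\<bar> ^ n) \<le> (\<Sum>n. inverse (fact n) * \<bar>z\<bar> ^ n)"
        by (rule sum_le_suminf) (use summable_exp[of "\<bar>z\<bar>"] in auto)
      then show ?thesis by (simp add: exp_def fact_numeral scaleR_conv_of_real field_simps)
    qed
    then have "z ^ 4 * exp \<bar>z\<bar> \<le> 24 * exp \<bar>z\<bar> * exp \<bar>z\<bar>"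
      by (intro mult_right_mono) (auto simp: power_even_abs)
    also have "\<dots> = 24 * exp (2 * \<bar>z\<bar>)"
      by (simp add: mult_exp_exp)
    also have "\<dots> \<le> 24 * exp (2 * z) + 24 * exp (- (2 * z))"
      by (cases "z \<ge> 0") auto
    finally show ?thesis .
  qed
  then show "AE z in std_gauss. norm (z ^ 4 * exp \<bar>z\<bar>) \<le> norm (24 * exp (2 * z) + 24 * exp ((-2) * z))"
    by (intro AE_I2) auto
qed auto

context
  fixes f :: "nat \<Rightarrow> real \<Rightarrow> real" and L t B :: real
  assumes deriv: "\<And>m x. m < 4 \<Longrightarrow> (f m has_real_derivative f (Suc m) x) (at x)"
    and bound: "\<And>x. \<bar>f 4 x\<bar> \<le> L * exp (t * x)" and t: "t \<ge> 0"
begin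

lemma symmetric_pmf_taylor:
  assumes p: "symmetric_pmf \<rho> p" and tr: "t * \<rho> \<le> 1"
  shows "\<bar>measure_pmf.expectation p (\<lambda>x. f 0 (r + x)) - (f 0 r + f 2 r / 2 * second_moment p)\<bar>
    \<le> L / 24 * exp (t * r) * (\<rho> ^ 4 * exp 1)"
proof -
  have fin: "finite (set_pmf p)" and le: "\<And>x. x \<in> set_pmf p \<Longrightarrow> \<bar>x\<bar> \<le> \<rho>" and sym: "map_pmf uminus p = p"
    using p by (auto simp: symmetric_pmf_def)
  note [simp] = integrable_measure_pmf_finite[OF fin]
  have L: "L \<ge> 0"
    using bound[of 0] by (auto intro: order_trans[OF abs_ge_zero])
  have odd0: "measure_pmf.expectation p (\<lambda>x. x ^ k) = 0" if "odd k" for k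
  proof -
    have "measure_pmf.expectation p (\<lambda>x. x ^ k) = measure_pmf.expectation (map_pmf uminus p) (\<lambda>x. x ^ k)"
      by (simp only: sym)
    also have "\<dots> = - measure_pmf.expectation p (\<lambda>x. x ^ k)"
      using that by simp
    finally show ?thesis by simp
  qed
  let ?P = "\<lambda>x. f 0 r + f 1 r * x + f 2 r / 2 * x\<^sup>2 + f 3 r / 6 * x ^ 3"
  have "measure_pmf.expectation p ?P = f 0 r + f 2 r / 2 * second_moment p"
    using odd0[of 1] odd0[of 3] by simp
  then have "\<bar>measure_pmf.expectation p (\<lambda>x. f 0 (r + x)) - (f 0 r + f 2 r / 2 * second_moment p)\<bar>
    = \<bar>measure_pmf.expectation p (\<lambda>x. f 0 (r + x) - ?P x)\<bar>"
    by (subst Bochner_Integration.integral_diff) auto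
  also have "\<dots> \<le> measure_pmf.expectation p (\<lambda>x. \<bar>f 0 (r + x) - ?P x\<bar>)"
    by (rule integral_abs_bound)
  also have "\<dots> \<le> measure_pmf.expectation p (\<lambda>x. L / 24 * exp (t * r) * (\<rho> ^ 4 * exp 1))"
  proof (rule integral_mono_AE)
    show "AE x in measure_pmf p. \<bar>f 0 (r + x) - ?P x\<bar> \<le> L / 24 * exp (t * r) * (\<rho> ^ 4 * exp 1)"
    proof (rule AE_pmfI)
      fix x assume x: "x \<in> set_pmf p"
      have "\<bar>f 0 (r + x) - ?P x\<bar> \<le> L / 24 * exp (t * r) * (x ^ 4 * exp (t * \<bar>x\<bar>))"
        by (rule taylor_exp_bound[OF deriv bound t])
      also have "\<dots> \<le> L / 24 * exp (t * r) * (\<rho> ^ 4 * exp 1)"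
      proof -
        have "t * \<bar>x\<bar> \<le> 1"
          using mult_left_mono[OF le[OF x] t] tr by simp
        moreover have "x ^ 4 \<le> \<rho> ^ 4"
          using power_mono[OF le[OF x], of 4] by simp
        ultimately show ?thesis using L
          by (intro mult_left_mono mult_mono) auto
      qed
      finally show "\<bar>f 0 (r + x) - ?P x\<bar> \<le> L / 24 * exp (t * r) * (\<rho> ^ 4 * exp 1)" .
    qed
  qed auto
  finally show ?thesis by simp
qed

text \<open>The same second-order polynomial as in \<open>symmetric_pmf_taylor\<close> once
  \<open>v\<close> is the second moment. When a summand is replaced by a Gaussian of equal variance
  only the two remainders survive.\<close>

lemma gauss_taylor:
  assumes v: "v \<ge> 0" "v \<le> \<rho>\<^sup>2" and tr: "t * \<rho> \<le> 1" "\<rho> \<ge> 0"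
    and int: "integrable std_gauss (\<lambda>z. f 0 (r + sqrt v * z))"
  shows "\<bar>(\<integral>z. f 0 (r + sqrt v * z) \<partial>std_gauss) - (f 0 r + f 2 r / 2 * v)\<bar>
    \<le> L / 24 * exp (t * r) * (\<rho> ^ 4 * gauss_const)"
proof -
  note [simp] = std_gauss_moments std_gauss_moments(1)[of 1, simplified] integrable_gauss_const int
  have L: "L \<ge> 0"
    using bound[of 0] by (auto intro: order_trans[OF abs_ge_zero])
  let ?P = "\<lambda>x. f 0 r + f 1 r * x + f 2 r / 2 * x\<^sup>2 + f 3 r / 6 * x ^ 3"
  have intP: "integrable std_gauss (\<lambda>z. ?P (sqrt v * z))"
    by (simp add: power_mult_distrib)
  have "(\<integral>z. ?P (sqrt v * z) \<partial>std_gauss) = f 0 r + f 2 r / 2 * v"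
    using v std_gauss.prob_space by (simp add: power_mult_distrib)
  then have "\<bar>(\<integral>z. f 0 (r + sqrt v * z) \<partial>std_gauss) - (f 0 r + f 2 r / 2 * v)\<bar>
    = \<bar>\<integral>z. f 0 (r + sqrt v * z) - ?P (sqrt v * z) \<partial>std_gauss\<bar>"
    using intP by (subst Bochner_Integration.integral_diff) auto
  also have "\<dots> \<le> (\<integral>z. \<bar>f 0 (r + sqrt v * z) - ?P (sqrt v * z)\<bar> \<partial>std_gauss)"
    by (rule integral_abs_bound)
  also have "\<dots> \<le> (\<integral>z. L / 24 * exp (t * r) * (\<rho> ^ 4 * (z ^ 4 * exp \<bar>z\<bar>)) \<partial>std_gauss)"
  proof (rule integral_mono)
    fix z
    have "\<bar>f 0 (r + sqrt v * z) - ?P (sqrt v * z)\<bar> \<le>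
        L / 24 * exp (t * r) * ((sqrt v * z) ^ 4 * exp (t * \<bar>sqrt v * z\<bar>))"
      by (rule taylor_exp_bound[OF deriv bound t])
    also have "\<dots> \<le> L / 24 * exp (t * r) * (\<rho> ^ 4 * (z ^ 4 * exp \<bar>z\<bar>))"
    proof -
      have sv: "sqrt v \<le> \<rho>" using real_sqrt_le_mono[OF v(2)] tr by simp
      have "t * sqrt v \<le> 1" using mult_left_mono[OF sv t] tr by simp
      then have "t * \<bar>sqrt v * z\<bar> \<le> \<bar>z\<bar>"
        using mult_right_mono[of "t * sqrt v" 1 "\<bar>z\<bar>"] v by (simp add: abs_mult mult_ac)
      moreover have "(sqrt v * z) ^ 4 \<le> \<rho> ^ 4 * z ^ 4"
        unfolding power_mult_distrib by (intro mult_right_mono power_mono sv) (use v in auto)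
      ultimately show ?thesis using L
        by (subst mult.assoc[symmetric, of "\<rho> ^ 4"], intro mult_left_mono mult_mono) auto
    qed
    finally show "\<bar>f 0 (r + sqrt v * z) - ?P (sqrt v * z)\<bar> \<le> L / 24 * exp (t * r) * (\<rho> ^ 4 * (z ^ 4 * exp \<bar>z\<bar>))" .
  next
    show "integrable std_gauss (\<lambda>z. \<bar>f 0 (r + sqrt v * z) - ?P (sqrt v * z)\<bar>)"
      using int intP by (intro integrable_abs Bochner_Integration.integrable_diff)
  qed simp
  also have "\<dots> = L / 24 * exp (t * r) * (\<rho> ^ 4 * gauss_const)"
    by (simp add: gauss_const_def)
  finally show ?thesis .
qed

end

lemma symmetric_pmf_second_moment:
  assumes "symmetric_pmf \<rho> p"
  shows "second_moment p \<ge> 0" "second_moment p \<le> \<rho>\<^sup>2" "\<rho> \<ge> 0"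
proof -
  have fin: "finite (set_pmf p)" and le: "\<And>x. x \<in> set_pmf p \<Longrightarrow> \<bar>x\<bar> \<le> \<rho>"
    using assms by (auto simp: symmetric_pmf_def)
  show "second_moment p \<ge> 0" by simp
  obtain x where "x \<in> set_pmf p" using set_pmf_not_empty by fast
  from le[OF this] show "\<rho> \<ge> 0" by linarith
  have "second_moment p \<le> measure_pmf.expectation p (\<lambda>x. \<rho>\<^sup>2)"
  proof (rule integral_mono_AE)
    show "AE x in measure_pmf p. x\<^sup>2 \<le> \<rho>\<^sup>2"
      using le \<open>\<rho> \<ge> 0\<close> by (intro AE_pmfI abs_le_square_iff[THEN iffD1]) auto
  qed (auto intro: integrable_measure_pmf_finite fin)
  then show "second_moment p \<le> \<rho>\<^sup>2" by simp
qed

text \<open>The Taylor estimate applied to the weight itself, at r = 0. The factor 1 / 24 of the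
  remainder absorbs exp 1. In the induction it tells how the weight grows when it is averaged over
  one summand.\<close>

lemma symmetric_pmf_mgf:
  assumes p: "symmetric_pmf \<rho> p" and t: "t \<ge> 0" "t * \<rho> \<le> 1"
  shows "measure_pmf.expectation p (\<lambda>x. exp (t * x)) \<le> exp (t\<^sup>2 * second_moment p / 2 + (t * \<rho>) ^ 4)"
proof -
  have "\<bar>measure_pmf.expectation p (\<lambda>x. t ^ 0 * exp (t * (0 + x))) -
      (t ^ 0 * exp (t * 0) + (t\<^sup>2 * exp (t * 0)) / 2 * second_moment p)\<bar>
    \<le> t ^ 4 / 24 * exp (t * 0) * (\<rho> ^ 4 * exp 1)"
    by (rule symmetric_pmf_taylor[of "\<lambda>m x. t ^ m * exp (t * x)", OF _ _ t(1) p t(2)])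
      (auto intro!: derivative_eq_intros)
  then have "measure_pmf.expectation p (\<lambda>x. exp (t * x)) \<le> 1 + t\<^sup>2 / 2 * second_moment p + t ^ 4 / 24 * (\<rho> ^ 4 * exp 1)"
    by (simp only: abs_le_iff power_0 mult_1 mult_zero_right exp_zero mult_1_right add_0) linarith
  also have "\<dots> \<le> 1 + (t\<^sup>2 * second_moment p / 2 + (t * \<rho>) ^ 4)"
  proof -
    have "(t * \<rho>) ^ 4 * exp 1 \<le> (t * \<rho>) ^ 4 * 24"
      using exp_le by (intro mult_left_mono) auto
    then show ?thesis by (simp add: power_mult_distrib mult_ac)
  qed
  also have "\<dots> \<le> exp (t\<^sup>2 * second_moment p / 2 + (t * \<rho>) ^ 4)"
    by (rule exp_ge_add_one_self)
  finally show ?thesis .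
qed

definition lindeberg_const :: real where
  "lindeberg_const = (exp 1 + gauss_const) / 24"

lemma lindeberg_const_nonneg: "lindeberg_const \<ge> 0"
  unfolding lindeberg_const_def gauss_const_def
  by (intro divide_nonneg_nonneg add_nonneg_nonneg Bochner_Integration.integral_nonneg) auto

text \<open>The exponent is shaped for the induction on the list, with \<open>r\<close> arbitrary:
  the error for the tail of the list at r + x is averaged over the first summand x, and
  \<open>symmetric_pmf_mgf\<close> supplies exactly the terms that the longer list adds to the
  exponent. The first summand is then replaced in the presence of the Gaussian tail.\<close>

lemma lindeberg:
  fixes f :: "nat \<Rightarrow> real \<Rightarrow> real" and r t \<rho> L B :: real
  assumes deriv: "\<And>m x. m < 4 \<Longrightarrow> (f m has_real_derivative f (Suc m) x) (at x)"
    and bound: "\<And>x. \<bar>f 4 x\<bar> \<le> L * exp (t * x)" and t: "t \<ge> 0"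
    and bd: "\<And>x. \<bar>f 0 x\<bar> \<le> B"
    and ps: "\<And>p. p \<in> set ps \<Longrightarrow> symmetric_pmf \<rho> p" and tr: "t * \<rho> \<le> 1"
  shows "\<bar>measure_pmf.expectation (sum_pmf ps) (\<lambda>x. f 0 (r + x)) -
      (\<integral>z. f 0 (r + sqrt (\<Sum>p\<leftarrow>ps. second_moment p) * z) \<partial>std_gauss)\<bar>
    \<le> length ps * (lindeberg_const * \<rho> ^ 4 * L) *
      exp (t * r + t\<^sup>2 * (\<Sum>p\<leftarrow>ps. second_moment p) / 2 + length ps * (t * \<rho>) ^ 4)"
  using ps
proof (induction ps arbitrary: r)
  case Nil
  show ?case by (simp add: std_gauss.prob_space[simplified])
next
  case (Cons p ps)
  have L: "L \<ge> 0"
    using bound[of 0] by (auto intro: order_trans[OF abs_ge_zero])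
  have meas [measurable]: "f 0 \<in> borel_measurable borel"
    by (rule borel_measurable_continuous_onI, rule continuous_at_imp_continuous_on)
      (use deriv[of 0] in \<open>auto intro: DERIV_isCont\<close>)
  have sp: "symmetric_pmf \<rho> p" using Cons.prems by simp
  have fins: "finite (set_pmf q)" if "q \<in> set (p # ps)" for q
    using Cons.prems[OF that] by (simp add: symmetric_pmf_def)
  have fin: "finite (set_pmf p)" by (rule fins) simp
  note [simp] = integrable_measure_pmf_finite[OF fin]
  define V v where "V = (\<Sum>p\<leftarrow>ps. second_moment p)" and "v = second_moment p"
  have v: "v \<ge> 0" "v \<le> \<rho>\<^sup>2" "\<rho> \<ge> 0" using symmetric_pmf_second_moment[OF sp] by (auto simp: v_def)
  have V: "V \<ge> 0" unfolding V_def by (intro sum_list_nonneg) auto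
  have integ: "integrable std_gauss (\<lambda>z. f 0 (s + c * z))" for s c
    by (rule std_gauss.integrable_const_bound[where B = B]) (use bd in auto)
  define G where "G = (\<lambda>s. \<integral>z. f 0 (s + sqrt V * z) \<partial>std_gauss)"
  define A where "A = (\<lambda>s. measure_pmf.expectation p (\<lambda>x. f 0 (s + x)))"
  define N where "N = (\<lambda>s. \<integral>z. f 0 (s + sqrt v * z) \<partial>std_gauss)"
  define M where "M = exp (t * r + t\<^sup>2 * (v + V) / 2 + Suc (length ps) * (t * \<rho>) ^ 4)"
  have N_bd: "\<bar>N s\<bar> \<le> B" for s
  proof -
    have "\<bar>N s\<bar> \<le> (\<integral>z. \<bar>f 0 (s + sqrt v * z)\<bar> \<partial>std_gauss)"
      unfolding N_def by (rule integral_abs_bound)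
    also have "\<dots> \<le> (\<integral>z. B \<partial>std_gauss)"
      by (intro integral_mono integrable_abs integ) (use bd in auto)
    finally show ?thesis using std_gauss.prob_space by simp
  qed
  have A_sum: "A s = (\<Sum>x\<in>set_pmf p. f 0 (s + x) * pmf p x)" for s
    unfolding A_def using fin by (subst integral_measure_pmf_real[of "set_pmf p"]) auto
  have A_bd: "\<bar>A s\<bar> \<le> B" for s
  proof -
    have "\<bar>A s\<bar> \<le> measure_pmf.expectation p (\<lambda>x. \<bar>f 0 (s + x)\<bar>)"
      unfolding A_def by (rule integral_abs_bound)
    also have "\<dots> \<le> measure_pmf.expectation p (\<lambda>x. B)"
      by (intro integral_mono) (use bd in auto)
    finally show ?thesis by simp
  qed
  have [measurable]: "A \<in> borel_measurable borel"
    unfolding A_sum by measurable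
  have [measurable]: "N \<in> borel_measurable borel"
    unfolding N_def by measurable
  \<comment> \<open>The first summand and the Gaussian part are independent; integrating over x
    inside gives \<open>A\<close> at a Gaussian argument, where it can be compared pointwise with
    \<open>N\<close>.\<close>
  have swap: "measure_pmf.expectation p (\<lambda>x. G (r + x)) = (\<integral>z. A (r + sqrt V * z) \<partial>std_gauss)"
  proof -
    have "measure_pmf.expectation p (\<lambda>x. G (r + x)) = (\<Sum>x\<in>set_pmf p. G (r + x) * pmf p x)"
      using fin by (subst integral_measure_pmf_real[of "set_pmf p"]) auto
    also have "\<dots> = (\<Sum>x\<in>set_pmf p. \<integral>z. f 0 (r + x + sqrt V * z) * pmf p x \<partial>std_gauss)"
      unfolding G_def by simp
    also have "\<dots> = (\<integral>z. (\<Sum>x\<in>set_pmf p. f 0 (r + x + sqrt V * z) * pmf p x) \<partial>std_gauss)"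
      by (subst Bochner_Integration.integral_sum) (auto intro!: integrable_mult_left integ)
    also have "\<dots> = (\<integral>z. A (r + sqrt V * z) \<partial>std_gauss)"
      unfolding A_sum by (simp add: add_ac)
    finally show ?thesis .
  qed
  have semi: "(\<integral>z. N (r + sqrt V * z) \<partial>std_gauss) = (\<integral>z. f 0 (r + sqrt (v + V) * z) \<partial>std_gauss)"
    unfolding N_def using gauss_semigroup[OF meas bd V v(1), of r] by (simp add: add_ac)
  have intA: "integrable std_gauss (\<lambda>z. A (r + sqrt V * z))"
    by (rule std_gauss.integrable_const_bound[where B = B]) (use A_bd in auto)
  have intN: "integrable std_gauss (\<lambda>z. N (r + sqrt V * z))"
    by (rule std_gauss.integrable_const_bound[where B = B]) (use N_bd in auto)
  have AN: "\<bar>A s - N s\<bar> \<le> lindeberg_const * \<rho> ^ 4 * L * exp (t * s)" for s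
  proof -
    have "\<bar>A s - (f 0 s + f 2 s / 2 * v)\<bar> \<le> L / 24 * exp (t * s) * (\<rho> ^ 4 * exp 1)"
      unfolding A_def v_def by (rule symmetric_pmf_taylor[OF deriv bound t sp tr])
    moreover have "\<bar>N s - (f 0 s + f 2 s / 2 * v)\<bar> \<le> L / 24 * exp (t * s) * (\<rho> ^ 4 * gauss_const)"
      unfolding N_def by (rule gauss_taylor[OF deriv bound t v(1,2) tr v(3) integ])
    ultimately have "\<bar>A s - N s\<bar> \<le> L / 24 * exp (t * s) * (\<rho> ^ 4 * exp 1) + L / 24 * exp (t * s) * (\<rho> ^ 4 * gauss_const)"
      by linarith
    then show ?thesis by (simp add: lindeberg_const_def field_simps)
  qed
  let ?C = "lindeberg_const * \<rho> ^ 4 * L"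
  have C: "?C \<ge> 0" using lindeberg_const_nonneg L v(3) by simp
  have first: "\<bar>measure_pmf.expectation p (\<lambda>x. measure_pmf.expectation (sum_pmf ps) (\<lambda>y. f 0 (r + x + y)))
      - measure_pmf.expectation p (\<lambda>x. G (r + x))\<bar> \<le> length ps * ?C * M"
  proof -
    have "\<bar>measure_pmf.expectation p (\<lambda>x. measure_pmf.expectation (sum_pmf ps) (\<lambda>y. f 0 (r + x + y)))
        - measure_pmf.expectation p (\<lambda>x. G (r + x))\<bar> =
      \<bar>measure_pmf.expectation p (\<lambda>x. measure_pmf.expectation (sum_pmf ps) (\<lambda>y. f 0 (r + x + y)) - G (r + x))\<bar>"
      by (subst Bochner_Integration.integral_diff) auto
    also have "\<dots> \<le> measure_pmf.expectation p (\<lambda>x. \<bar>measure_pmf.expectation (sum_pmf ps) (\<lambda>y. f 0 (r + x + y)) - G (r + x)\<bar>)"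
      by (rule integral_abs_bound)
    also have "\<dots> \<le> measure_pmf.expectation p (\<lambda>x. length ps * ?C * exp (t * (r + x) + t\<^sup>2 * V / 2 + length ps * (t * \<rho>) ^ 4))"
      by (rule integral_mono) (use Cons.IH Cons.prems in \<open>auto simp: G_def V_def\<close>)
    also have "\<dots> = length ps * ?C * exp (t * r + t\<^sup>2 * V / 2 + length ps * (t * \<rho>) ^ 4) *
        measure_pmf.expectation p (\<lambda>x. exp (t * x))"
      by (simp add: exp_add distrib_left mult_ac)
    also have "\<dots> \<le> length ps * ?C * exp (t * r + t\<^sup>2 * V / 2 + length ps * (t * \<rho>) ^ 4) *
        exp (t\<^sup>2 * v / 2 + (t * \<rho>) ^ 4)"
      using symmetric_pmf_mgf[OF sp t tr] C
      by (intro mult_left_mono) (auto simp: v_def)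
    also have "\<dots> = length ps * ?C * M"
      unfolding M_def by (simp add: exp_add[symmetric] algebra_simps add_divide_distrib)
    finally show ?thesis .
  qed
  \<comment> \<open>Here the weight is averaged over the Gaussian part, whose moment generating
    function is exact.\<close>
  have second: "\<bar>measure_pmf.expectation p (\<lambda>x. G (r + x)) - (\<integral>z. f 0 (r + sqrt (v + V) * z) \<partial>std_gauss)\<bar> \<le> ?C * M"
  proof -
    have "\<bar>measure_pmf.expectation p (\<lambda>x. G (r + x)) - (\<integral>z. f 0 (r + sqrt (v + V) * z) \<partial>std_gauss)\<bar> =
      \<bar>\<integral>z. A (r + sqrt V * z) - N (r + sqrt V * z) \<partial>std_gauss\<bar>"
      unfolding swap semi[symmetric] using intA intN by (subst Bochner_Integration.integral_diff) auto
    also have "\<dots> \<le> (\<integral>z. \<bar>A (r + sqrt V * z) - N (r + sqrt V * z)\<bar> \<partial>std_gauss)"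
      by (rule integral_abs_bound)
    also have "\<dots> \<le> (\<integral>z. ?C * exp (t * r) * exp (t * sqrt V * z) \<partial>std_gauss)"
    proof (rule integral_mono)
      fix z show "\<bar>A (r + sqrt V * z) - N (r + sqrt V * z)\<bar> \<le> ?C * exp (t * r) * exp (t * sqrt V * z)"
        using AN[of "r + sqrt V * z"] by (simp add: exp_add distrib_left mult_ac)
    next
      show "integrable std_gauss (\<lambda>z. \<bar>A (r + sqrt V * z) - N (r + sqrt V * z)\<bar>)"
        by (intro integrable_abs Bochner_Integration.integrable_diff intA intN)
      show "integrable std_gauss (\<lambda>z. ?C * exp (t * r) * exp (t * sqrt V * z))"
        by (intro integrable_mult_right std_gauss_exp)
    qed
    also have "\<dots> = ?C * exp (t * r + t\<^sup>2 * V / 2)"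
      using V by (simp add: std_gauss_exp exp_add power_mult_distrib)
    also have "\<dots> \<le> ?C * M"
      unfolding M_def using C v by (intro mult_left_mono) (auto simp: algebra_simps add_divide_distrib)
    finally show ?thesis .
  qed
  have "measure_pmf.expectation (sum_pmf (p # ps)) (\<lambda>x. f 0 (r + x)) =
     measure_pmf.expectation p (\<lambda>x. measure_pmf.expectation (sum_pmf ps) (\<lambda>y. f 0 (r + x + y)))"
    by (subst expectation_sum_pmf_Cons) (use fins in \<open>auto simp: add.assoc\<close>)
  then have "\<bar>measure_pmf.expectation (sum_pmf (p # ps)) (\<lambda>x. f 0 (r + x)) -
      (\<integral>z. f 0 (r + sqrt (v + V) * z) \<partial>std_gauss)\<bar> \<le> length ps * ?C * M + ?C * M"
    using first second by linarith
  also have "\<dots> = Suc (length ps) * ?C * M" by (simp add: algebra_simps)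
  finally show ?case by (simp add: M_def V_def v_def)
qed

text \<open>
  \<open>gamma5 m\<close> is the \<open>m\<close>-th derivative of the distribution function of the Gamma(5) law. All of them
  vanish at \<open>0\<close> for \<open>m \<le> 4\<close>, so precomposition with \<open>max 0\<close> yields a four times differentiable step.
\<close>

definition gamma5 :: "nat \<Rightarrow> real \<Rightarrow> real" where
  "gamma5 m x =
    (if m = 0 then 1 - exp (- x) * (1 + x + x\<^sup>2 / 2 + x ^ 3 / 6 + x ^ 4 / 24)
     else if m = 1 then x ^ 4 * exp (- x) / 24
     else if m = 2 then (4 * x ^ 3 - x ^ 4) * exp (- x) / 24
     else if m = 3 then (12 * x\<^sup>2 - 8 * x ^ 3 + x ^ 4) * exp (- x) / 24
     else (24 * x - 36 * x\<^sup>2 + 12 * x ^ 3 - x ^ 4) * exp (- x) / 24)"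

lemma gamma5_deriv:
  assumes "m < 4"
  shows "(gamma5 m has_real_derivative gamma5 (Suc m) x) (at x)"
proof -
  consider "m = 0" | "m = 1" | "m = 2" | "m = 3" using assms by linarith
  then show ?thesis
    by cases (auto simp: gamma5_def[abs_def] intro!: derivative_eq_intros
      simp: field_simps power2_eq_square power3_eq_cube power4_eq_xxxx)
qed

lemma gamma5_0: "gamma5 m 0 = 0"
  by (simp add: gamma5_def)

text \<open>At the kink the difference quotient is either zero or that of h, and the latter tends to
  h' 0 = 0.\<close>

lemma DERIV_max_zero:
  fixes h :: "real \<Rightarrow> real"
  assumes deriv: "\<And>x. (h has_real_derivative h' x) (at x)" and "h 0 = 0" "h' 0 = 0"
  shows "((\<lambda>x. h (max 0 x)) has_real_derivative h' (max 0 x)) (at x)"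
proof -
  consider "x > 0" | "x < 0" | "x = 0" by linarith
  then show ?thesis
  proof cases
    case 1
    then have "(h has_real_derivative h' (max 0 x)) (at x)" using deriv[of x] by simp
    then show ?thesis
      by (rule has_field_derivative_transform_within_open[of _ _ _ "{0<..}"]) (use 1 in auto)
  next
    case 2
    then have "((\<lambda>x. 0) has_real_derivative h' (max 0 x)) (at x)" using assms by simp
    then show ?thesis
      by (rule has_field_derivative_transform_within_open[of _ _ _ "{..<0}"]) (use 2 assms in auto)
  next
    case 3
    have "((\<lambda>y. (h y - h 0) / (y - 0)) \<longlongrightarrow> 0) (at 0)"
      using deriv[of 0] assms unfolding has_field_derivative_iff by simp
    then have "((\<lambda>y. (h (max 0 y) - h (max 0 0)) / (y - 0)) \<longlongrightarrow> 0) (at 0)"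
      by (rule Lim_null_comparison[rotated, OF tendsto_rabs_zero])
        (intro always_eventually, use assms in \<open>auto simp: max_def divide_le_0_iff\<close>)
    then show ?thesis using 3 assms by (simp add: has_field_derivative_iff)
  qed
qed

lemma pow_exp_neg_le: "x ^ k * exp (- x) \<le> fact k" if "x \<ge> 0" for x :: real
proof -
  have "(\<Sum>n\<in>{k}. inverse (fact n) * x ^ n) \<le> (\<Sum>n. inverse (fact n) * x ^ n)"
    by (rule sum_le_suminf) (use summable_exp[of x] that in auto)
  then have "x ^ k / fact k \<le> exp x"
    by (simp add: exp_def scaleR_conv_of_real field_simps)
  then show ?thesis by (simp add: exp_minus field_simps)
qed

text \<open>Each power of degree k times the exponential is at most k!. The positive terms then add
  up to at most 96 / 24, and so do the negative ones, within the round constant 8.\<close>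

lemma gamma5_4_bound: "\<bar>gamma5 4 x\<bar> \<le> 8" if "x \<ge> 0"
proof -
  define A where "A k = x ^ k * exp (- x)" for k
  have A: "0 \<le> A k" "A k \<le> fact k" for k
    unfolding A_def using that pow_exp_neg_le[of x k] by auto
  have eq: "gamma5 4 x = (24 * A 1 - 36 * A 2 + 12 * A 3 - A 4) / 24"
    by (simp add: gamma5_def A_def algebra_simps)
  have le: "A 1 \<le> 1" "A 2 \<le> 2" "A 3 \<le> 6" "A 4 \<le> 24"
    using A(2)[of 1] A(2)[of 2] A(2)[of 3] A(2)[of 4] by (simp_all add: fact_numeral)
  have "\<bar>(24 * a - 36 * b + 12 * c - d) / 24\<bar> \<le> 8"
    if "0 \<le> a" "a \<le> 1" "0 \<le> b" "b \<le> 2" "0 \<le> c" "c \<le> 6" "0 \<le> d" "d \<le> 24" for a b c d :: real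
    using that by (auto simp: abs_le_iff)
  then show ?thesis unfolding eq using A(1) le by blast
qed

lemma gamma5_mono: "0 \<le> x \<Longrightarrow> x \<le> y \<Longrightarrow> gamma5 0 x \<le> gamma5 0 y"
proof (erule DERIV_nonneg_imp_nondecreasing)
  fix z
  show "\<exists>d. (gamma5 0 has_real_derivative d) (at z) \<and> 0 \<le> d"
    using gamma5_deriv[of 0 z] by (intro exI[of _ "gamma5 (Suc 0) z"]) (auto simp: gamma5_def)
qed

lemma gamma5_le_1: "0 \<le> x \<Longrightarrow> gamma5 0 x \<le> 1"
  by (simp add: gamma5_def)

lemma gamma5_nonneg: "0 \<le> x \<Longrightarrow> 0 \<le> gamma5 0 x"
  using gamma5_mono[of 0 x] by (simp add: gamma5_0)

lemma gamma5_tendsto: "(gamma5 0 \<longlongrightarrow> 1) at_top"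
proof -
  have "((\<lambda>x :: real. 1 - exp (- x) * (1 + x + x\<^sup>2 / 2 + x ^ 3 / 6 + x ^ 4 / 24)) \<longlongrightarrow> 1) at_top"
    by real_asymp
  then show ?thesis by (simp add: gamma5_def[abs_def])
qed

section \<open>Smoothed indicators\<close>

text \<open>The step starts at u and rises over a length of order 1 / c; the index m counts
  derivatives, which is the format that \<open>lindeberg\<close> expects.\<close>

definition ramp :: "real \<Rightarrow> real \<Rightarrow> nat \<Rightarrow> real \<Rightarrow> real" where
  "ramp c u m z = c ^ m * gamma5 m (max 0 (c * (z - u)))"

lemma ramp_deriv:
  assumes "m < 4"
  shows "(ramp c u m has_real_derivative ramp c u (Suc m) z) (at z)"
proof -
  have "((\<lambda>x. gamma5 m (max 0 x)) has_real_derivative gamma5 (Suc m) (max 0 (c * (z - u)))) (at (c * (z - u)))"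
    by (rule DERIV_max_zero) (auto simp: gamma5_0 intro: gamma5_deriv assms)
  moreover have "((\<lambda>z. c * (z - u)) has_real_derivative c) (at z)"
    by (auto intro!: derivative_eq_intros)
  ultimately have "((\<lambda>z. gamma5 m (max 0 (c * (z - u)))) has_real_derivative
      gamma5 (Suc m) (max 0 (c * (z - u))) * c) (at z)"
    by (rule DERIV_chain2)
  from DERIV_cmult[OF this, of "c ^ m"] show ?thesis
    unfolding ramp_def by (simp add: mult_ac)
qed

lemma ramp_bounds: "0 \<le> ramp c u 0 z" "ramp c u 0 z \<le> 1"
  by (simp_all add: ramp_def gamma5_nonneg gamma5_le_1)

lemma ramp_le_indicator: "c \<ge> 0 \<Longrightarrow> ramp c u 0 z \<le> indicator {u<..} z"
  using ramp_bounds[of c u z]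
  by (auto simp: indicator_def ramp_def gamma5_0 max_absorb1 mult_nonneg_nonpos)

lemma ramp_ge_indicator:
  assumes "c \<ge> 0" "d \<ge> 0"
  shows "gamma5 0 (c * d) * indicator {u + d..} z \<le> ramp c u 0 z"
proof (cases "z \<ge> u + d")
  case True
  then have "c * d \<le> c * (z - u)" using assms by (intro mult_left_mono) auto
  then show ?thesis using True assms by (auto simp: ramp_def intro!: gamma5_mono)
qed (simp add: ramp_bounds)

text \<open>The derivative vanishes below u, and above u the factor exp (t (z - u)) is at least 1.
  Multiplying by it turns a uniform bound into an exponential one with the small prefactor exp (- t
  u).\<close>

lemma ramp_4_bound:
  assumes "c \<ge> 0" "t \<ge> 0"
  shows "\<bar>ramp c u 4 z\<bar> \<le> 8 * c ^ 4 * exp (- (t * u)) * exp (t * z)"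
proof (cases "z \<ge> u")
  case True
  have "\<bar>ramp c u 4 z\<bar> = c ^ 4 * \<bar>gamma5 4 (max 0 (c * (z - u)))\<bar>"
    using assms by (simp add: ramp_def abs_mult)
  also have "\<dots> \<le> c ^ 4 * 8"
    by (intro mult_left_mono gamma5_4_bound) (use assms in auto)
  also have "\<dots> \<le> c ^ 4 * 8 * exp (t * (z - u))"
    using mult_left_mono[of 1 "exp (t * (z - u))" "c ^ 4 * 8"] True assms by simp
  finally show ?thesis by (simp add: exp_diff exp_minus right_diff_distrib field_simps)
next
  case False
  then have "max 0 (c * (z - u)) = 0" using assms by (simp add: max_absorb1 mult_nonneg_nonpos)
  then show ?thesis using assms by (simp add: ramp_def gamma5_0)
qed


section \<open>The normal tail\<close>

definition gauss_tail :: "real \<Rightarrow> real" where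
  "gauss_tail y = measure std_gauss {y..}"

definition mills :: "real \<Rightarrow> real" where
  "mills y = exp (- (y\<^sup>2 / 2)) / (y * sqrt (2 * pi))"

text \<open>The negative of \<open>mills\<close> is an antiderivative of the normal density times 1
  + 1 / z^2, a factor that lies between 1 and 1 + 1 / y^2 on the half-line from y.\<close>

lemma mills_bounds:
  assumes y: "y > 0"
  shows "gauss_tail y \<le> mills y" "mills y \<le> (1 + 1 / y\<^sup>2) * gauss_tail y"
proof -
  let ?g = "\<lambda>z. std_normal_density z * (1 + 1 / z\<^sup>2)"
  have tail: "ennreal (gauss_tail y) = (\<integral>\<^sup>+x. ennreal (std_normal_density x) * indicator {y..} x \<partial>lborel)"
    unfolding gauss_tail_def std_gauss.emeasure_eq_measure[symmetric]
    unfolding std_gauss_def by (subst emeasure_density) auto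
  have "(\<integral>\<^sup>+x. ennreal (?g x) * indicator {y..} x \<partial>lborel) = ennreal (0 - (- mills y))"
  proof (rule nn_integral_FTC_atLeast)
    fix x assume "y \<le> x"
    then have x: "x > 0" using y by simp
    show "((\<lambda>y. - mills y) has_real_derivative ?g x) (at x)"
    proof -
      have "((\<lambda>y. - (exp (- (y\<^sup>2 / 2)) / (y * c))) has_real_derivative (1 / c) * exp (- (x\<^sup>2 / 2)) * (1 + 1 / x\<^sup>2)) (at x)"
        if "c > 0" for c :: real
        using x that by (auto intro!: derivative_eq_intros simp: field_simps power2_eq_square)
      from this[of "sqrt (2 * pi)"] show ?thesis
        unfolding mills_def std_normal_density_def by simp
    qed
    show "0 \<le> ?g x" by simp
  next
    show "((\<lambda>y. - mills y) \<longlongrightarrow> 0) at_top"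
      unfolding mills_def by real_asymp
  qed auto
  then have eq: "(\<integral>\<^sup>+x. ennreal (?g x) * indicator {y..} x \<partial>lborel) = ennreal (mills y)" by simp
  have "ennreal (gauss_tail y) \<le> ennreal (mills y)"
    unfolding tail eq[symmetric]
    by (intro nn_integral_mono mult_right_mono ennreal_leI) (auto simp: field_simps)
  moreover have m: "mills y \<ge> 0" using y by (simp add: mills_def)
  ultimately show "gauss_tail y \<le> mills y" by simp
  have "ennreal (mills y) \<le> (\<integral>\<^sup>+x. ennreal (1 + 1 / y\<^sup>2) * (ennreal (std_normal_density x) * indicator {y..} x) \<partial>lborel)"
    unfolding eq[symmetric]
  proof (intro nn_integral_mono)
    fix x :: real
    show "ennreal (?g x) * indicator {y..} x \<le> ennreal (1 + 1 / y\<^sup>2) * (ennreal (std_normal_density x) * indicator {y..} x)"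
    proof (cases "x \<ge> y")
      case True
      then have "1 + 1 / x\<^sup>2 \<le> 1 + 1 / y\<^sup>2"
        using y by (auto intro!: divide_left_mono power_mono mult_pos_pos)
      then have "?g x \<le> (1 + 1 / y\<^sup>2) * std_normal_density x"
        by (subst mult.commute) (intro mult_right_mono, auto)
      then have "ennreal (?g x) \<le> ennreal ((1 + 1 / y\<^sup>2) * std_normal_density x)"
        by (rule ennreal_leI)
      then show ?thesis using True by (simp add: ennreal_mult)
    qed simp
  qed
  also have "\<dots> = ennreal ((1 + 1 / y\<^sup>2) * gauss_tail y)"
    by (subst nn_integral_cmult) (auto simp: tail[symmetric] ennreal_mult gauss_tail_def)
  finally have "ennreal (mills y) \<le> ennreal ((1 + 1 / y\<^sup>2) * gauss_tail y)" .
  then show "mills y \<le> (1 + 1 / y\<^sup>2) * gauss_tail y"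
    by (subst (asm) ennreal_le_iff) (auto simp: gauss_tail_def)
qed

lemma gauss_tail_asymp: "((\<lambda>y. gauss_tail y / mills y) \<longlongrightarrow> 1) at_top"
proof (rule tendsto_sandwich)
  have pos: "mills y > 0" if "y > 0" for y using that by (simp add: mills_def)
  show "\<forall>\<^sub>F y in at_top. inverse (1 + 1 / y\<^sup>2) \<le> gauss_tail y / mills y"
    using eventually_gt_at_top[of 0]
  proof eventually_elim
    case (elim y)
    have "1 + 1 / y\<^sup>2 > 0" by (simp add: add_pos_nonneg)
    then show ?case using mills_bounds(2)[OF elim] pos[OF elim] by (simp add: inverse_eq_divide field_simps)
  qed
  show "\<forall>\<^sub>F y in at_top. gauss_tail y / mills y \<le> 1"
    using eventually_gt_at_top[of 0]
    by eventually_elim (use mills_bounds(1) pos in auto)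
  show "((\<lambda>y. inverse (1 + 1 / y\<^sup>2)) \<longlongrightarrow> (1 :: real)) at_top" by real_asymp
qed simp

text \<open>Moving y by d / y changes y^2 / 2 by d + d^2 / (2 y^2). This is the distance at which
  the tail changes by a constant factor, and it dictates the smoothing width below.\<close>

lemma gauss_tail_shift:
  "((\<lambda>y. gauss_tail (y + d / y) / mills y) \<longlongrightarrow> exp (- d)) at_top"
proof -
  have lim: "filterlim (\<lambda>y. y + d / y) at_top at_top" by real_asymp
  have 1: "((\<lambda>y. gauss_tail (y + d / y) / mills (y + d / y)) \<longlongrightarrow> 1) at_top"
    by (rule filterlim_compose[OF gauss_tail_asymp lim])
  have 2: "((\<lambda>y. mills (y + d / y) / mills y) \<longlongrightarrow> exp (- d)) at_top"
  proof -
    have "((\<lambda>y :: real. exp (- d - d\<^sup>2 / (2 * y\<^sup>2)) * (y / (y + d / y))) \<longlongrightarrow> exp (- d) * 1) at_top"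
      by (intro tendsto_mult) (real_asymp+)
    moreover have "\<forall>\<^sub>F y in at_top. exp (- d - d\<^sup>2 / (2 * y\<^sup>2)) * (y / (y + d / y)) = mills (y + d / y) / mills y"
      using eventually_gt_at_top[of 0]
    proof eventually_elim
      case (elim y)
      have "- ((y + d / y)\<^sup>2 / 2) = - (y\<^sup>2 / 2) + (- d - d\<^sup>2 / (2 * y\<^sup>2))"
        using elim by (simp add: field_simps power2_eq_square)
      then have "exp (- ((y + d / y)\<^sup>2 / 2)) = exp (- (y\<^sup>2 / 2)) * exp (- d - d\<^sup>2 / (2 * y\<^sup>2))"
        by (metis exp_add)
      moreover have "E * (y / w) = a * E / (w * c) / (a / (y * c))" if "a > 0" "c > 0" for a c E w :: real
        using that elim by (simp add: field_simps)
      ultimately show ?case unfolding mills_def by simp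
    qed
    ultimately show ?thesis by (simp add: tendsto_cong)
  qed
  have "((\<lambda>y. gauss_tail (y + d / y) / mills (y + d / y) * (mills (y + d / y) / mills y)) \<longlongrightarrow> 1 * exp (- d)) at_top"
    by (intro tendsto_mult 1 2)
  then have "((\<lambda>y. gauss_tail (y + d / y) / mills (y + d / y) * (mills (y + d / y) / mills y)) \<longlongrightarrow> exp (- d)) at_top"
    by (simp only: mult_1)
  moreover have "\<forall>\<^sub>F y in at_top. gauss_tail (y + d / y) / mills (y + d / y) * (mills (y + d / y) / mills y)
      = gauss_tail (y + d / y) / mills y"
    using filterlim_at_top_dense[THEN iffD1, OF lim, rule_format, of 0]
    by eventually_elim (auto simp: mills_def)
  ultimately show ?thesis by (rule Lim_transform_eventually)
qed

section \<open>Moderate deviations of normalised sums\<close>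

text \<open>Lindeberg's bound with tilt t = y and r = 0. For total variance 1 the weight contributes
  exp (y^2 / 2) and the ramp exp (- y u), so for u near y their product has the order of exp (- y^2
  / 2), as the normal density at y.\<close>

lemma sum_pmf_ramp_bound:
  fixes \<rho> y c u :: real
  assumes ps: "\<And>p. p \<in> set ps \<Longrightarrow> symmetric_pmf \<rho> p" and var: "(\<Sum>p\<leftarrow>ps. second_moment p) = 1"
    and y: "y \<ge> 0" "y * \<rho> \<le> 1" and c: "c \<ge> 0"
  shows "\<bar>measure_pmf.expectation (sum_pmf ps) (ramp c u 0) - (\<integral>z. ramp c u 0 z \<partial>std_gauss)\<bar>
    \<le> length ps * (lindeberg_const * \<rho> ^ 4 * (8 * c ^ 4 * exp (- (y * u)))) *
      exp (y\<^sup>2 / 2 + length ps * (y * \<rho>) ^ 4)"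
proof -
  have "\<bar>measure_pmf.expectation (sum_pmf ps) (\<lambda>x. ramp c u 0 (0 + x)) -
      (\<integral>z. ramp c u 0 (0 + sqrt (\<Sum>p\<leftarrow>ps. second_moment p) * z) \<partial>std_gauss)\<bar>
    \<le> length ps * (lindeberg_const * \<rho> ^ 4 * (8 * c ^ 4 * exp (- (y * u)))) *
      exp (y * 0 + y\<^sup>2 * (\<Sum>p\<leftarrow>ps. second_moment p) / 2 + length ps * (y * \<rho>) ^ 4)"
    by (rule lindeberg[where B = 1])
      (use ramp_deriv ramp_4_bound ramp_bounds ps y c in \<open>auto simp: abs_le_iff intro: order_trans[of _ 0]\<close>)
  then show ?thesis unfolding var by simp
qed

lemma ramp_measurable [measurable]: "ramp c u 0 \<in> borel_measurable borel"
  by (rule borel_measurable_continuous_onI, rule continuous_at_imp_continuous_on)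
    (use ramp_deriv[of 0] in \<open>auto intro: DERIV_isCont\<close>)

lemma ramp_gauss_bounds:
  assumes "c \<ge> 0" "d \<ge> 0"
  shows "(\<integral>z. ramp c u 0 z \<partial>std_gauss) \<le> gauss_tail u"
    "gamma5 0 (c * d) * gauss_tail (u + d) \<le> (\<integral>z. ramp c u 0 z \<partial>std_gauss)"
proof -
  have int: "integrable std_gauss (ramp c u 0)"
    by (rule std_gauss.integrable_const_bound[where B = 1]) (use ramp_bounds in auto)
  have ind: "integrable std_gauss (indicator {v..} :: real \<Rightarrow> real)" for v
    by (rule std_gauss.integrable_const_bound[where B = 1]) auto
  have "ramp c u 0 z \<le> indicator {u..} z" for z
    by (rule order_trans[OF ramp_le_indicator[OF assms(1)]]) (auto simp: indicator_def)
  then have "(\<integral>z. ramp c u 0 z \<partial>std_gauss) \<le> (\<integral>z. indicator {u..} z \<partial>std_gauss)"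
    by (intro integral_mono[OF int ind])
  then show "(\<integral>z. ramp c u 0 z \<partial>std_gauss) \<le> gauss_tail u"
    by (simp add: gauss_tail_def)
  have "(\<integral>z. gamma5 0 (c * d) * indicator {u + d..} z \<partial>std_gauss) \<le> (\<integral>z. ramp c u 0 z \<partial>std_gauss)"
    by (rule integral_mono[OF _ int])
      (auto intro!: integrable_mult_right ind ramp_ge_indicator assms)
  then show "gamma5 0 (c * d) * gauss_tail (u + d) \<le> (\<integral>z. ramp c u 0 z \<partial>std_gauss)"
    by (simp add: gauss_tail_def)
qed

lemma ramp_pmf_bounds:
  assumes "c \<ge> 0" "d \<ge> 0" "finite (set_pmf p)"
  shows "measure_pmf.expectation p (ramp c u 0) \<le> measure_pmf.prob p {u<..}"
    "gamma5 0 (c * d) * measure_pmf.prob p {u + d..} \<le> measure_pmf.expectation p (ramp c u 0)"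
proof -
  note [simp] = integrable_measure_pmf_finite[OF assms(3)]
  have "measure_pmf.expectation p (ramp c u 0) \<le> measure_pmf.expectation p (indicator {u<..})"
    by (rule integral_mono) (auto intro: ramp_le_indicator assms)
  then show "measure_pmf.expectation p (ramp c u 0) \<le> measure_pmf.prob p {u<..}" by simp
  have "measure_pmf.expectation p (\<lambda>z. gamma5 0 (c * d) * indicator {u + d..} z) \<le> measure_pmf.expectation p (ramp c u 0)"
    by (rule integral_mono) (auto intro: ramp_ge_indicator assms)
  then show "gamma5 0 (c * d) * measure_pmf.prob p {u + d..} \<le> measure_pmf.expectation p (ramp c u 0)" by simp
qed

text \<open>The ramp has steepness y / \<kappa>^2 and is compared with indicators at distance
  \<kappa> / y. Over that distance its argument grows by 1 / \<kappa>, so it reaches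
  \<open>gamma5 0 (1 / \<kappa>)\<close>, close to 1 for small \<kappa>, while the normal tail
  changes only by the factor exp (- \<kappa>). The bounds are taken to the limit in n for fixed
  \<kappa>, which is then chosen small.\<close>

lemma normalized_moderate_deviation:
  fixes ps :: "nat \<Rightarrow> real pmf list" and \<rho> y :: "nat \<Rightarrow> real"
  assumes sym: "\<forall>\<^sub>F n in sequentially. \<forall>p\<in>set (ps n). symmetric_pmf (\<rho> n) p"
    and var: "\<forall>\<^sub>F n in sequentially. (\<Sum>p\<leftarrow>ps n. second_moment p) = 1"
    and y: "filterlim y at_top sequentially"
    and small: "(\<lambda>n. y n * \<rho> n) \<longlonglongrightarrow> 0"
    and err: "(\<lambda>n. length (ps n) * \<rho> n ^ 4 * y n ^ 5) \<longlonglongrightarrow> 0"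
  shows "(\<lambda>n. measure_pmf.prob (sum_pmf (ps n)) {y n<..} / mills (y n)) \<longlonglongrightarrow> 1"
proof -
  let ?a = "\<lambda>n. measure_pmf.prob (sum_pmf (ps n)) {y n<..} / mills (y n)"
  define F where "F = gamma5 0"
  \<comment> \<open>The replacement error relative to \<open>mills (y n)\<close>. Four of the five
    powers of y come from the fourth derivative of the ramp; the fifth, with sqrt (2 * pi), is the
    denominator of \<open>mills\<close>. The factor exp \<kappa> allows the ramp to start as low as
    y - \<kappa> / y.\<close>
  define R where "R \<kappa> n = 8 * lindeberg_const * (1 / \<kappa>\<^sup>2) ^ 4 * sqrt (2 * pi) * exp \<kappa> *
    (length (ps n) * \<rho> n ^ 4 * y n ^ 5) * exp (length (ps n) * (y n * \<rho> n) ^ 4)" for \<kappa> n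
  have y1: "\<forall>\<^sub>F n in sequentially. y n \<ge> 1"
    using y by (simp add: filterlim_at_top)
  have yr: "\<forall>\<^sub>F n in sequentially. y n * \<rho> n < 1"
    using small by (rule order_tendstoD) simp
  have small4: "(\<lambda>n. length (ps n) * (y n * \<rho> n) ^ 4) \<longlonglongrightarrow> 0"
  proof (rule Lim_null_comparison[OF _ err])
    show "\<forall>\<^sub>F n in sequentially. norm (length (ps n) * (y n * \<rho> n) ^ 4) \<le> length (ps n) * \<rho> n ^ 4 * y n ^ 5"
      using y1
    proof eventually_elim
      case (elim n)
      have "y n ^ 4 * 1 \<le> y n ^ 4 * y n" using elim by (intro mult_left_mono) auto
      then have "y n ^ 4 \<le> y n ^ 5" by (simp add: eval_nat_numeral mult_ac)
      then have "length (ps n) * \<rho> n ^ 4 * y n ^ 4 \<le> length (ps n) * \<rho> n ^ 4 * y n ^ 5"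
        by (intro mult_left_mono) auto
      then show ?case by (simp add: power_mult_distrib mult_ac)
    qed
  qed
  have R0: "R \<kappa> \<longlonglongrightarrow> 0" for \<kappa>
  proof -
    have "R \<kappa> \<longlonglongrightarrow> 8 * lindeberg_const * (1 / \<kappa>\<^sup>2) ^ 4 * sqrt (2 * pi) * exp \<kappa> * 0 * exp 0"
      unfolding R_def by (intro tendsto_mult tendsto_const err tendsto_exp small4)
    then show ?thesis by simp
  qed
  have close: "\<forall>\<^sub>F n in sequentially. mills (y n) > 0 \<and>
      (\<forall>u \<ge> y n - \<kappa> / y n. \<bar>measure_pmf.expectation (sum_pmf (ps n)) (ramp (y n / \<kappa>\<^sup>2) u 0) -
        (\<integral>z. ramp (y n / \<kappa>\<^sup>2) u 0 z \<partial>std_gauss)\<bar> \<le> R \<kappa> n * mills (y n))"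
    if k: "\<kappa> > 0" for \<kappa>
    using sym var y1 yr
  proof (eventually_elim, intro conjI allI impI)
    case (elim n)
    have ypos: "y n > 0" using elim by linarith
    then show "mills (y n) > 0" by (simp add: mills_def)
    fix u assume u: "u \<ge> y n - \<kappa> / y n"
    let ?N = "real (length (ps n))"
    have "\<bar>measure_pmf.expectation (sum_pmf (ps n)) (ramp (y n / \<kappa>\<^sup>2) u 0) - (\<integral>z. ramp (y n / \<kappa>\<^sup>2) u 0 z \<partial>std_gauss)\<bar>
      \<le> ?N * (lindeberg_const * \<rho> n ^ 4 * (8 * (y n / \<kappa>\<^sup>2) ^ 4 * exp (- (y n * u)))) *
        exp ((y n)\<^sup>2 / 2 + ?N * (y n * \<rho> n) ^ 4)"
      by (rule sum_pmf_ramp_bound) (use elim ypos k in auto)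
    also have "\<dots> \<le> ?N * (lindeberg_const * \<rho> n ^ 4 * (8 * (y n / \<kappa>\<^sup>2) ^ 4 * exp (\<kappa> - (y n)\<^sup>2))) *
        exp ((y n)\<^sup>2 / 2 + ?N * (y n * \<rho> n) ^ 4)"
    proof -
      have "(y n)\<^sup>2 - \<kappa> \<le> y n * u"
        using mult_left_mono[OF u, of "y n"] ypos by (simp add: right_diff_distrib power2_eq_square)
      then show ?thesis using lindeberg_const_nonneg ypos k
        by (intro mult_right_mono mult_left_mono mult_nonneg_nonneg) auto
    qed
    also have "\<dots> = R \<kappa> n * mills (y n)"
    proof -
      have "exp (\<kappa> - (y n)\<^sup>2) * exp ((y n)\<^sup>2 / 2 + ?N * (y n * \<rho> n) ^ 4) =
        exp \<kappa> * exp (- ((y n)\<^sup>2 / 2)) * exp (?N * (y n * \<rho> n) ^ 4)"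
        by (simp add: exp_add[symmetric])
      moreover have "N * (C * r * (8 * (Y / k) ^ 4 * e1)) * e2 =
          8 * C * (1 / k) ^ 4 * s * k' * (N * r * Y ^ 5) * e4 * (e3 / (Y * s))"
        if "e1 * e2 = k' * e3 * e4" "Y > 0" "s > 0" for N C r Y k k' e1 e2 e3 e4 s :: real
      proof -
        have "N * (C * r * (8 * (Y / k) ^ 4 * e1)) * e2 = 8 * C * N * r * (Y / k) ^ 4 * (e1 * e2)"
          by (simp add: mult_ac)
        then show ?thesis unfolding that(1) using that(2,3)
          by (simp add: power_divide eval_nat_numeral mult_ac)
      qed
      ultimately show ?thesis unfolding R_def mills_def using ypos by simp
    qed
    finally show "\<bar>measure_pmf.expectation (sum_pmf (ps n)) (ramp (y n / \<kappa>\<^sup>2) u 0) -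
        (\<integral>z. ramp (y n / \<kappa>\<^sup>2) u 0 z \<partial>std_gauss)\<bar> \<le> R \<kappa> n * mills (y n)" .
  qed
  have fin: "\<forall>\<^sub>F n in sequentially. finite (set_pmf (sum_pmf (ps n)))"
    using sym by eventually_elim (auto intro!: finite_set_sum_pmf simp: symmetric_pmf_def)
  \<comment> \<open>The ramp starting at y itself lies below the indicator of the event and, on the
    Gaussian side, is at least F (1 / \<kappa>) from y + \<kappa> / y on.\<close>
  have lower: "\<forall>\<^sub>F n in sequentially. F (1 / \<kappa>) * (gauss_tail (y n + \<kappa> / y n) / mills (y n)) - R \<kappa> n \<le> ?a n"
    if k: "\<kappa> > 0" for \<kappa>
    using close[OF k] fin y1
  proof eventually_elim
    case (elim n)
    let ?c = "y n / \<kappa>\<^sup>2" and ?d = "\<kappa> / y n"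
    have c: "?c \<ge> 0" "?d \<ge> 0" and cd: "?c * ?d = 1 / \<kappa>"
      using elim k by (auto simp: power2_eq_square)
    have "F (1 / \<kappa>) * gauss_tail (y n + ?d) \<le> (\<integral>z. ramp ?c (y n) 0 z \<partial>std_gauss)"
      using ramp_gauss_bounds(2)[OF c, of "y n"] unfolding cd F_def .
    also have "\<dots> \<le> measure_pmf.expectation (sum_pmf (ps n)) (ramp ?c (y n) 0) + R \<kappa> n * mills (y n)"
      using elim c(2) by (auto simp: abs_le_iff algebra_simps dest!: spec[of _ "y n"])
    also have "\<dots> \<le> measure_pmf.prob (sum_pmf (ps n)) {y n<..} + R \<kappa> n * mills (y n)"
      using ramp_pmf_bounds(1)[OF c] elim by auto
    finally have le: "F (1 / \<kappa>) * gauss_tail (y n + ?d) \<le> measure_pmf.prob (sum_pmf (ps n)) {y n<..} + R \<kappa> n * mills (y n)" .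
    have "A * (g / m) - r \<le> q / m" if "A * g \<le> q + r * m" "m > 0" for A g q r m :: real
    proof -
      have "A * g / m \<le> (q + r * m) / m" using that by (intro divide_right_mono) auto
      then show ?thesis using that by (simp add: add_divide_distrib)
    qed
    from this[OF le elim(1)[THEN conjunct1]] show ?case .
  qed
  \<comment> \<open>The ramp now starts at y - \<kappa> / y, so that it has reached F (1 / \<kappa>)
    at y.\<close>
  have upper: "\<forall>\<^sub>F n in sequentially. ?a n \<le> (gauss_tail (y n + (- \<kappa>) / y n) / mills (y n) + R \<kappa> n) / F (1 / \<kappa>)"
    if k: "\<kappa> > 0" and F: "F (1 / \<kappa>) > 0" for \<kappa>
    using close[OF k] fin y1
  proof eventually_elim
    case (elim n)
    let ?c = "y n / \<kappa>\<^sup>2" and ?d = "\<kappa> / y n" and ?u = "y n + (- \<kappa>) / y n"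
    have c: "?c \<ge> 0" "?d \<ge> 0" and cd: "?c * ?d = 1 / \<kappa>" "?u + ?d = y n"
      using elim k by (auto simp: power2_eq_square)
    have "F (1 / \<kappa>) * measure_pmf.prob (sum_pmf (ps n)) {y n<..} \<le> F (1 / \<kappa>) * measure_pmf.prob (sum_pmf (ps n)) {y n..}"
      using F by (intro mult_left_mono measure_pmf.finite_measure_mono) auto
    also have "\<dots> \<le> measure_pmf.expectation (sum_pmf (ps n)) (ramp ?c ?u 0)"
      using ramp_pmf_bounds(2)[OF c, of "sum_pmf (ps n)" ?u] elim unfolding cd F_def by auto
    also have "\<dots> \<le> (\<integral>z. ramp ?c ?u 0 z \<partial>std_gauss) + R \<kappa> n * mills (y n)"
      using elim by (auto simp: abs_le_iff algebra_simps dest!: spec[of _ ?u])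
    also have "\<dots> \<le> gauss_tail ?u + R \<kappa> n * mills (y n)"
      using ramp_gauss_bounds(1)[OF c] by auto
    finally show ?case using elim F by (simp add: field_simps)
  qed
  have Flim: "((\<lambda>\<kappa>. F (1 / \<kappa>)) \<longlongrightarrow> 1) (at_right 0)"
    unfolding F_def by (rule filterlim_compose[OF gamma5_tendsto]) real_asymp
  have shift: "(\<lambda>n. gauss_tail (y n + d / y n) / mills (y n)) \<longlonglongrightarrow> exp (- d)" for d
    by (rule filterlim_compose[OF gauss_tail_shift y])
  show ?thesis
  proof (rule order_tendstoI)
    fix l :: real assume l: "l < 1"
    \<comment> \<open>The lower bound converges in n to this function of \<kappa>, which tends to 1;
      a \<kappa> is fixed for which it exceeds l.\<close>
    have "((\<lambda>\<kappa>. F (1 / \<kappa>) * exp (- \<kappa>)) \<longlongrightarrow> 1 * exp (- 0)) (at_right 0)"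
      by (intro tendsto_intros Flim)
    then have "\<forall>\<^sub>F \<kappa> in at_right 0. l < F (1 / \<kappa>) * exp (- \<kappa>)"
      by (rule order_tendstoD) (use l in simp)
    then have "\<forall>\<^sub>F \<kappa> in at_right 0. l < F (1 / \<kappa>) * exp (- \<kappa>) \<and> \<kappa> > 0"
      using eventually_at_right_less by eventually_elim auto
    from eventually_happens'[OF trivial_limit_at_right_real this]
    obtain \<kappa> where k: "l < F (1 / \<kappa>) * exp (- \<kappa>)" "\<kappa> > 0"
      by blast
    have "(\<lambda>n. F (1 / \<kappa>) * (gauss_tail (y n + \<kappa> / y n) / mills (y n)) - R \<kappa> n) \<longlonglongrightarrow> F (1 / \<kappa>) * exp (- \<kappa>) - 0"
      by (intro tendsto_intros shift R0)
    then have "\<forall>\<^sub>F n in sequentially. l < F (1 / \<kappa>) * (gauss_tail (y n + \<kappa> / y n) / mills (y n)) - R \<kappa> n"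
      by (rule order_tendstoD) (use k in simp)
    then show "\<forall>\<^sub>F n in sequentially. l < ?a n"
      using lower[OF k(2)] by eventually_elim linarith
  next
    fix l :: real assume l: "1 < l"
    have "((\<lambda>\<kappa>. (exp (- (- \<kappa>)) + 0) / F (1 / \<kappa>)) \<longlongrightarrow> (exp (- (- 0)) + 0) / 1) (at_right 0)"
      by (intro tendsto_intros Flim) auto
    then have "\<forall>\<^sub>F \<kappa> in at_right 0. (exp (- (- \<kappa>)) + 0) / F (1 / \<kappa>) < l"
      by (rule order_tendstoD) (use l in simp)
    moreover have "\<forall>\<^sub>F \<kappa> in at_right 0. F (1 / \<kappa>) > 0"
      using Flim by (rule order_tendstoD) simp
    ultimately have "\<forall>\<^sub>F \<kappa> in at_right 0. (exp (- (- \<kappa>)) + 0) / F (1 / \<kappa>) < l \<and> F (1 / \<kappa>) > 0 \<and> \<kappa> > 0"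
      using eventually_at_right_less by eventually_elim auto
    from eventually_happens'[OF trivial_limit_at_right_real this]
    obtain \<kappa> where k: "(exp (- (- \<kappa>)) + 0) / F (1 / \<kappa>) < l" "\<kappa> > 0" "F (1 / \<kappa>) > 0"
      by blast
    have "(\<lambda>n. (gauss_tail (y n + (- \<kappa>) / y n) / mills (y n) + R \<kappa> n) / F (1 / \<kappa>)) \<longlonglongrightarrow> (exp (- (- \<kappa>)) + 0) / F (1 / \<kappa>)"
      by (intro tendsto_intros shift R0) (use k in auto)
    then have "\<forall>\<^sub>F n in sequentially. (gauss_tail (y n + (- \<kappa>) / y n) / mills (y n) + R \<kappa> n) / F (1 / \<kappa>) < l"
      by (rule order_tendstoD) (use k in simp)
    then show "\<forall>\<^sub>F n in sequentially. ?a n < l"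
      using upper[OF k(2,3)] by eventually_elim linarith
  qed
qed

section \<open>Moderate deviations and the Gumbel limit\<close>

lemma sum_pmf_scale: "sum_pmf (map (map_pmf (\<lambda>x. x / c)) ps) = map_pmf (\<lambda>x. x / c) (sum_pmf ps)"
proof (induction ps)
  case (Cons p ps)
  show ?case
    by (simp only: list.map sum_pmf.simps Cons.IH)
      (simp add: bind_map_pmf map_bind_pmf pmf.map_comp comp_def add_divide_distrib)
qed simp

lemma symmetric_pmf_scale:
  assumes "symmetric_pmf \<rho> p" "c > 0"
  shows "symmetric_pmf (\<rho> / c) (map_pmf (\<lambda>x. x / c) p)"
proof -
  have "map_pmf uminus (map_pmf (\<lambda>x. x / c) p) = map_pmf (\<lambda>x. x / c) (map_pmf uminus p)"
    by (simp add: pmf.map_comp comp_def)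
  then show ?thesis using assms
    by (auto simp: symmetric_pmf_def abs_divide divide_right_mono)
qed

lemma sum_list_divide: "(\<Sum>x\<leftarrow>xs. f x / c) = (\<Sum>x\<leftarrow>xs. f x) / (c :: real)"
  by (induction xs) (auto simp: add_divide_distrib)

lemma sum_pmf_moments:
  assumes "\<And>p. p \<in> set ps \<Longrightarrow> symmetric_pmf \<rho> p"
  shows "measure_pmf.expectation (sum_pmf ps) (\<lambda>x. x) = 0 \<and>
    second_moment (sum_pmf ps) = (\<Sum>p\<leftarrow>ps. second_moment p)"
  using assms
proof (induction ps)
  case (Cons p ps)
  have sp: "symmetric_pmf \<rho> p" using Cons.prems by simp
  have fins: "finite (set_pmf q)" if "q \<in> set (p # ps)" for q
    using Cons.prems[OF that] by (simp add: symmetric_pmf_def)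
  have fin: "finite (set_pmf p)" "finite (set_pmf (sum_pmf ps))"
    using fins by (auto intro: finite_set_sum_pmf)
  note [simp] = integrable_measure_pmf_finite[OF fin(1)] integrable_measure_pmf_finite[OF fin(2)]
  have "measure_pmf.expectation p (\<lambda>x. x) = measure_pmf.expectation (map_pmf uminus p) (\<lambda>x. x)"
    using sp by (simp add: symmetric_pmf_def)
  then have 0: "measure_pmf.expectation p (\<lambda>x. x) = 0" by simp
  have IH: "measure_pmf.expectation (sum_pmf ps) (\<lambda>x. x) = 0"
    "second_moment (sum_pmf ps) = (\<Sum>p\<leftarrow>ps. second_moment p)"
    using Cons.IH Cons.prems by auto
  have "measure_pmf.expectation (sum_pmf (p # ps)) (\<lambda>x. x) = 0"
    by (subst expectation_sum_pmf_Cons) (use fins IH in \<open>auto simp: 0\<close>)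
  moreover have "second_moment (sum_pmf (p # ps)) = second_moment p + second_moment (sum_pmf ps)"
    by (subst expectation_sum_pmf_Cons) (use fins IH(1) in \<open>auto simp: 0 power2_sum\<close>)
  ultimately show ?case using IH(2) by simp
qed auto

text \<open>Reduction to variance 1. Hypothesis \<open>K\<close> keeps the bound \<rho> comparable
  to the root mean square size of a summand. After scaling the squared bound is at most K / N for N
  summands, and the error term of the normalised case is at most K^2 y^5 / N.\<close>

lemma moderate_deviation:
  fixes ps :: "nat \<Rightarrow> real pmf list" and \<rho> y V :: "nat \<Rightarrow> real" and K :: real
  assumes sym: "\<forall>\<^sub>F n in sequentially. \<forall>p\<in>set (ps n). symmetric_pmf (\<rho> n) p"
    and V: "\<And>n. V n = (\<Sum>p\<leftarrow>ps n. second_moment p)" "\<forall>\<^sub>F n in sequentially. V n > 0"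
    and K: "\<forall>\<^sub>F n in sequentially. length (ps n) * (\<rho> n)\<^sup>2 \<le> K * V n"
    and y: "filterlim y at_top sequentially"
    and err: "(\<lambda>n. y n ^ 6 / length (ps n)) \<longlonglongrightarrow> 0"
  shows "(\<lambda>n. measure_pmf.prob (sum_pmf (ps n)) {y n * sqrt (V n)<..} / mills (y n)) \<longlonglongrightarrow> 1"
proof -
  define qs where "qs n = map (map_pmf (\<lambda>x. x / sqrt (V n))) (ps n)" for n
  define r where "r n = \<rho> n / sqrt (V n)" for n
  have y1: "\<forall>\<^sub>F n in sequentially. y n \<ge> 1"
    using y by (simp add: filterlim_at_top)
  have ev: "\<forall>\<^sub>F n in sequentially. length (ps n) > 0"
    using V(2) by eventually_elim (auto simp: V(1))
  have r2: "\<forall>\<^sub>F n in sequentially. length (ps n) * (r n)\<^sup>2 \<le> K"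
    using K V(2) by eventually_elim (simp add: r_def power_divide field_simps)
  have pow: "(\<lambda>n. C * y n ^ k / length (ps n)) \<longlonglongrightarrow> 0" if "k \<le> 6" for C k
  proof (rule Lim_null_comparison)
    show "(\<lambda>n. \<bar>C\<bar> * (y n ^ 6 / length (ps n))) \<longlonglongrightarrow> 0"
      using err by (rule tendsto_mult_right_zero)
    show "\<forall>\<^sub>F n in sequentially. norm (C * y n ^ k / length (ps n)) \<le> \<bar>C\<bar> * (y n ^ 6 / length (ps n))"
      using y1
      by eventually_elim
        (use that in \<open>auto simp: abs_mult intro!: divide_right_mono mult_left_mono power_increasing\<close>)
  qed
  have "(\<lambda>n. measure_pmf.prob (sum_pmf (qs n)) {y n<..} / mills (y n)) \<longlonglongrightarrow> 1"
  proof (rule normalized_moderate_deviation[where \<rho> = r])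
    show "\<forall>\<^sub>F n in sequentially. \<forall>p\<in>set (qs n). symmetric_pmf (r n) p"
      using sym V(2) by eventually_elim (auto simp: qs_def r_def intro: symmetric_pmf_scale)
    show "\<forall>\<^sub>F n in sequentially. (\<Sum>p\<leftarrow>qs n. second_moment p) = 1"
      using V(2)
      by eventually_elim
        (simp add: qs_def comp_def power_divide sum_list_divide V(1)[symmetric])
    have rpos: "\<forall>\<^sub>F n in sequentially. r n \<ge> 0"
      using sym V(2) ev
    proof eventually_elim
      case (elim n)
      then have "hd (ps n) \<in> set (ps n)" by auto
      then have "\<rho> n \<ge> 0" using elim symmetric_pmf_second_moment(3) by blast
      then show ?case using elim by (simp add: r_def)
    qed
    have "(\<lambda>n. (y n * r n)\<^sup>2) \<longlonglongrightarrow> 0"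
    proof (rule Lim_null_comparison[OF _ pow[of 2 K]])
      show "\<forall>\<^sub>F n in sequentially. norm ((y n * r n)\<^sup>2) \<le> K * (y n)\<^sup>2 / length (ps n)"
        using r2 ev
      proof eventually_elim
        case (elim n)
        then show ?case using mult_right_mono[OF elim(1), of "(y n)\<^sup>2"]
          by (simp add: power_mult_distrib field_simps)
      qed
    qed simp
    from tendsto_real_sqrt[OF this] have "(\<lambda>n. \<bar>y n * r n\<bar>) \<longlonglongrightarrow> 0" by simp
    then show "(\<lambda>n. y n * r n) \<longlonglongrightarrow> 0" by (rule tendsto_rabs_zero_cancel)
    show "(\<lambda>n. length (qs n) * r n ^ 4 * y n ^ 5) \<longlonglongrightarrow> 0"
    proof (rule Lim_null_comparison[OF _ pow[of 5 "K\<^sup>2"]])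
      show "\<forall>\<^sub>F n in sequentially. norm (length (qs n) * r n ^ 4 * y n ^ 5) \<le> K\<^sup>2 * y n ^ 5 / length (ps n)"
        using r2 ev y1
      proof eventually_elim
        case (elim n)
        have "(length (ps n) * (r n)\<^sup>2)\<^sup>2 \<le> K\<^sup>2"
          using elim(1) by (intro power_mono) auto
        then have "length (ps n) * r n ^ 4 * length (ps n) \<le> K\<^sup>2"
          by (simp add: power_mult_distrib power2_eq_square power4_eq_xxxx mult_ac)
        then have "length (ps n) * r n ^ 4 \<le> K\<^sup>2 / length (ps n)"
          using elim by (simp add: field_simps)
        from mult_right_mono[OF this, of "y n ^ 5"] show ?case
          using elim by (simp add: qs_def abs_mult)
      qed
    qed simp
  qed (fact y)
  moreover have "\<forall>\<^sub>F n in sequentially. measure_pmf.prob (sum_pmf (qs n)) {y n<..} / mills (y n) =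
    measure_pmf.prob (sum_pmf (ps n)) {y n * sqrt (V n)<..} / mills (y n)"
    using V(2)
  proof eventually_elim
    case (elim n)
    have "(\<lambda>x. x / sqrt (V n)) -` {y n<..} = {y n * sqrt (V n)<..}"
      using elim by (auto simp: field_simps)
    then show ?case by (simp add: qs_def sum_pmf_scale)
  qed
  ultimately show ?thesis by (rule Lim_transform_eventually)
qed

section \<open>Gumbel normalisation and maxima of samples\<close>

text \<open>Writing y = \<alpha> + D / \<alpha>, half the square of y is ln n + D up to a vanishing
  term. The logarithms in the hypothesis cancel the factor y sqrt (2 pi) in \<open>mills\<close>. A
  limit is assumed instead of an exact formula for y because descents lead to perturbed
  thresholds.\<close>

lemma gumbel_threshold:
  fixes y :: "nat \<Rightarrow> real" and x :: real
  defines "\<alpha> \<equiv> \<lambda>n :: nat. sqrt (2 * ln (real n))"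
  assumes lim: "(\<lambda>n. \<alpha> n * (y n - \<alpha> n) + (ln (ln (real n)) + ln (4 * pi)) / 2) \<longlonglongrightarrow> x"
  shows "filterlim y at_top sequentially"
    and "(\<lambda>n. y n / \<alpha> n) \<longlonglongrightarrow> 1"
    and "(\<lambda>n. real n * mills (y n)) \<longlonglongrightarrow> exp (- x)"
proof -
  define X where "X n = \<alpha> n * (y n - \<alpha> n) + (ln (ln (real n)) + ln (4 * pi)) / 2" for n
  define D where "D n = \<alpha> n * (y n - \<alpha> n)" for n
  have X: "X \<longlonglongrightarrow> x" using lim by (simp add: X_def[abs_def])
  have \<alpha>_top: "filterlim \<alpha> at_top sequentially"
    unfolding \<alpha>_def by real_asymp
  have \<alpha>pos: "\<forall>\<^sub>F n in sequentially. \<alpha> n > 0"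
    using \<alpha>_top by (simp add: filterlim_at_top_dense)
  have 0: "(\<lambda>n. D n / \<alpha> n) \<longlonglongrightarrow> 0"
  proof -
    have "(\<lambda>n. X n / \<alpha> n - (ln (ln (real n)) + ln (4 * pi)) / (2 * \<alpha> n)) \<longlonglongrightarrow> 0 - 0"
    proof (intro tendsto_diff)
      show "(\<lambda>n. X n / \<alpha> n) \<longlonglongrightarrow> 0"
        by (rule tendsto_divide_0[OF X]) (rule filterlim_at_top_imp_at_infinity[OF \<alpha>_top])
      show "(\<lambda>n. (ln (ln (real n)) + ln (4 * pi)) / (2 * \<alpha> n)) \<longlonglongrightarrow> 0"
        unfolding \<alpha>_def by real_asymp
    qed
    moreover have "X n / \<alpha> n - (ln (ln (real n)) + ln (4 * pi)) / (2 * \<alpha> n) = D n / \<alpha> n" for n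
      unfolding X_def D_def by (simp add: add_divide_distrib)
    ultimately show ?thesis by simp
  qed
  have 1: "(\<lambda>n. D n / \<alpha> n / \<alpha> n) \<longlonglongrightarrow> 0"
    by (rule tendsto_divide_0[OF 0]) (rule filterlim_at_top_imp_at_infinity[OF \<alpha>_top])
  have yD: "\<forall>\<^sub>F n in sequentially. y n = \<alpha> n + D n / \<alpha> n"
    using \<alpha>pos by eventually_elim (simp add: D_def)
  have "(\<lambda>n. 1 + D n / \<alpha> n / \<alpha> n) \<longlonglongrightarrow> 1 + 0"
    by (intro tendsto_intros 1)
  moreover have "\<forall>\<^sub>F n in sequentially. 1 + D n / \<alpha> n / \<alpha> n = y n / \<alpha> n"
    using \<alpha>pos yD by eventually_elim (simp add: field_simps)
  ultimately show ya: "(\<lambda>n. y n / \<alpha> n) \<longlonglongrightarrow> 1"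
    using Lim_transform_eventually by fastforce
  have "filterlim (\<lambda>n. D n / \<alpha> n + \<alpha> n) at_top sequentially"
    by (rule filterlim_tendsto_add_at_top[OF 0 \<alpha>_top])
  then show y_top: "filterlim y at_top sequentially"
    by (rule filterlim_mono_eventually) (use yD in \<open>auto elim!: eventually_mono\<close>)
  have ypos: "\<forall>\<^sub>F n in sequentially. y n > 0"
    using y_top by (simp add: filterlim_at_top_dense)
  have "(\<lambda>n. exp (- X n) * exp (- ((D n / \<alpha> n)\<^sup>2 / 2)) / (y n / \<alpha> n)) \<longlonglongrightarrow> exp (- x) * exp (- (0\<^sup>2 / 2)) / 1"
    by (intro tendsto_intros X 0 ya) auto
  moreover have "\<forall>\<^sub>F n in sequentially. exp (- X n) * exp (- ((D n / \<alpha> n)\<^sup>2 / 2)) / (y n / \<alpha> n) = real n * mills (y n)"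
    using \<alpha>pos yD ypos eventually_gt_at_top[of 1]
  proof eventually_elim
    case (elim n)
    have n: "real n > 1" using elim by simp
    then have ln: "ln (real n) > 0" by simp
    have "y n ^ 2 / 2 = (\<alpha> n)\<^sup>2 / 2 + D n + (D n / \<alpha> n)\<^sup>2 / 2"
      unfolding elim(2) using elim(1) by (simp add: power2_eq_square field_simps)
    moreover have "(\<alpha> n)\<^sup>2 / 2 = ln (real n)" using ln by (simp add: \<alpha>_def)
    moreover have "D n = X n - (ln (ln (real n)) + ln (4 * pi)) / 2" by (simp add: X_def D_def)
    \<comment> \<open>The origin of the constant 4 pi: \<alpha> sqrt (2 pi) is the square root of 4
      pi ln n.\<close>
    moreover have "(ln (ln (real n)) + ln (4 * pi)) / 2 = ln (\<alpha> n * sqrt (2 * pi))"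
      using ln by (simp add: \<alpha>_def ln_mult ln_sqrt real_sqrt_mult[symmetric] field_simps)
    ultimately have "- (y n ^ 2 / 2) = - ln (real n) + (- X n) + ln (\<alpha> n * sqrt (2 * pi)) + (- ((D n / \<alpha> n)\<^sup>2 / 2))"
      by linarith
    then have "exp (- (y n ^ 2 / 2)) = exp (- X n) * (\<alpha> n * sqrt (2 * pi)) * exp (- ((D n / \<alpha> n)\<^sup>2 / 2)) / real n"
      using n elim(1) by (simp only: exp_add exp_minus[of "ln _"] exp_ln) (simp add: exp_ln field_simps)
    then have "mills (y n) = exp (- X n) * (\<alpha> n * sqrt (2 * pi)) * exp (- ((D n / \<alpha> n)\<^sup>2 / 2)) / real n / (y n * sqrt (2 * pi))"
      by (simp add: mills_def)
    then show ?case using n elim(1,3) by (simp add: field_simps)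
  qed
  ultimately show "(\<lambda>n. real n * mills (y n)) \<longlonglongrightarrow> exp (- x)"
    using Lim_transform_eventually by fastforce
qed

text \<open>The logarithm of 1 - p lies between - p - 2 p^2 and - p for small p, and n p^2 vanishes
  because p does.\<close>

lemma one_minus_power_limit:
  fixes p :: "nat \<Rightarrow> real"
  assumes lim: "(\<lambda>n. real n * p n) \<longlonglongrightarrow> c" and p: "\<And>n. 0 \<le> p n"
  shows "(\<lambda>n. (1 - p n) ^ n) \<longlonglongrightarrow> exp (- c)"
proof -
  have p0: "p \<longlonglongrightarrow> 0"
  proof -
    have "(\<lambda>n. (real n * p n) / real n) \<longlonglongrightarrow> 0"
      by (rule tendsto_divide_0[OF lim]) (rule filterlim_at_top_imp_at_infinity[OF filterlim_real_sequentially])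
    moreover have "\<forall>\<^sub>F n in sequentially. (real n * p n) / real n = p n"
      using eventually_gt_at_top[of 0] by eventually_elim simp
    ultimately show ?thesis using Lim_transform_eventually by fastforce
  qed
  have half: "\<forall>\<^sub>F n in sequentially. p n < 1 / 2"
    using p0 by (rule order_tendstoD) simp
  show ?thesis
  proof (rule tendsto_sandwich)
    show "\<forall>\<^sub>F n in sequentially. exp (- (real n * p n) - 2 * (real n * p n) * p n) \<le> (1 - p n) ^ n"
      using half
    proof eventually_elim
      case (elim n)
      have "- p n - 2 * (p n)\<^sup>2 \<le> ln (1 - p n)"
        using ln_one_minus_pos_lower_bound[of "p n"] p[of n] elim by simp
      then have "exp (- p n - 2 * (p n)\<^sup>2) \<le> 1 - p n"
        using elim by (simp add: exp_le_cancel_iff[symmetric, of _ "ln _"] del: exp_le_cancel_iff)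
      then have "exp (- p n - 2 * (p n)\<^sup>2) ^ n \<le> (1 - p n) ^ n"
        by (intro power_mono) auto
      then show ?case by (simp add: exp_of_nat_mult[symmetric] algebra_simps power2_eq_square)
    qed
    show "\<forall>\<^sub>F n in sequentially. (1 - p n) ^ n \<le> exp (- (real n * p n))"
      using half
    proof eventually_elim
      case (elim n)
      have "(1 - p n) ^ n \<le> exp (- p n) ^ n"
        using exp_ge_add_one_self[of "- p n"] elim by (intro power_mono) auto
      then show ?case by (simp add: exp_of_nat_mult[symmetric])
    qed
    have "(\<lambda>n. exp (- (real n * p n) - 2 * (real n * p n) * p n)) \<longlonglongrightarrow> exp (- c - 2 * c * 0)"
      by (intro tendsto_intros lim p0)
    then show "(\<lambda>n. exp (- (real n * p n) - 2 * (real n * p n) * p n)) \<longlonglongrightarrow> exp (- c)" by simp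
    show "(\<lambda>n. exp (- (real n * p n))) \<longlonglongrightarrow> exp (- c)"
      by (intro tendsto_intros lim)
  qed
qed

lemma (in prob_space) prob_Max_iid:
  fixes X :: "nat \<Rightarrow> 'a \<Rightarrow> real"
  assumes indep: "indep_vars (\<lambda>_. borel) X {1..n}" and n: "n \<ge> 1"
    and d: "\<And>i. 1 \<le> i \<Longrightarrow> i \<le> n \<Longrightarrow> distr M borel (X i) = distr (measure_pmf p) borel g"
  shows "prob {\<omega> \<in> space M. Max ((\<lambda>i. X i \<omega>) ` {1..n}) \<le> z} = (1 - measure_pmf.prob (map_pmf g p) {z<..}) ^ n"
proof -
  have rv: "X i \<in> borel_measurable M" if "i \<in> {1..n}" for i
    using indep that by (auto simp: indep_vars_def)
  have "{\<omega> \<in> space M. Max ((\<lambda>i. X i \<omega>) ` {1..n}) \<le> z} = (\<Inter>i\<in>{1..n}. X i -` {..z} \<inter> space M)"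
    using n by auto
  then have "prob {\<omega> \<in> space M. Max ((\<lambda>i. X i \<omega>) ` {1..n}) \<le> z} = (\<Prod>i\<in>{1..n}. prob (X i -` {..z} \<inter> space M))"
    using indep_varsD_finite[OF indep, of "\<lambda>_. {..z}"] n by simp
  also have "\<dots> = (\<Prod>i\<in>{1..n}. 1 - measure_pmf.prob (map_pmf g p) {z<..})"
  proof (rule prod.cong[OF refl])
    fix i assume i: "i \<in> {1..n}"
    have "prob (X i -` {..z} \<inter> space M) = measure (distr M borel (X i)) {..z}"
      using rv[OF i] by (subst measure_distr) auto
    also have "\<dots> = measure (distr (measure_pmf p) borel g) {..z}"
      using d i by simp
    also have "\<dots> = measure_pmf.prob (map_pmf g p) {..z}"
      by (subst measure_distr) auto
    also have "\<dots> = 1 - measure_pmf.prob (map_pmf g p) {z<..}"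
      using measure_pmf.prob_compl[of "{z<..}" "map_pmf g p"]
      by (simp add: Compl_eq_Diff_UNIV[symmetric] not_less[symmetric] ivl_disj_un set_eq_iff Compl_greaterThan)
    finally show "prob (X i -` {..z} \<inter> space M) = 1 - measure_pmf.prob (map_pmf g p) {z<..}" .
  qed
  also have "\<dots> = (1 - measure_pmf.prob (map_pmf g p) {z<..}) ^ n" by simp
  finally show ?thesis .
qed

lemma (in prob_space) moments_via_pmf:
  fixes X :: "'a \<Rightarrow> real"
  assumes rv: "X \<in> borel_measurable M" and d: "distr M borel X = distr (measure_pmf p) borel g"
  shows "expectation X = measure_pmf.expectation (map_pmf g p) (\<lambda>x. x)"
    "variance X = measure_pmf.variance (map_pmf g p) (\<lambda>x. x)"
proof -
  have *: "expectation (\<lambda>\<omega>. f (X \<omega>)) = measure_pmf.expectation (map_pmf g p) f"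
    if [measurable]: "f \<in> borel_measurable borel" for f :: "real \<Rightarrow> real"
  proof -
    have "expectation (\<lambda>\<omega>. f (X \<omega>)) = (\<integral>x. f x \<partial>distr M borel X)"
      using rv by (subst integral_distr) auto
    also have "\<dots> = measure_pmf.expectation (map_pmf g p) f"
      unfolding d by (subst integral_distr) auto
    finally show ?thesis .
  qed
  show e: "expectation X = measure_pmf.expectation (map_pmf g p) (\<lambda>x. x)"
    using *[of "\<lambda>x. x"] by simp
  show "variance X = measure_pmf.variance (map_pmf g p) (\<lambda>x. x)"
    unfolding e by (rule *) simp
qed

section \<open>Inversions as sums of independent variables\<close>

lemma pmf_of_set_Times:
  assumes "finite A" "A \<noteq> {}" "finite B" "B \<noteq> {}"
  shows "pmf_of_set (A \<times> B) = pair_pmf (pmf_of_set A) (pmf_of_set B)"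
proof (rule pmf_eqI)
  fix p :: "'a \<times> 'b"
  show "pmf (pmf_of_set (A \<times> B)) p = pmf (pair_pmf (pmf_of_set A) (pmf_of_set B)) p"
    using assms by (cases p) (simp add: pmf_pair card_cartesian_product indicator_def)
qed

text \<open>\<open>C'\<close> is the stabiliser of N in \<open>C\<close>, and its left cosets are
  distinguished by the value at N. The element \<open>c v\<close> is a chosen representative of the
  coset with value v.\<close>

lemma bij_betw_coset:
  fixes C C' :: "(int \<Rightarrow> int) set" and N :: int
  assumes C: "\<And>u v. u \<in> C \<Longrightarrow> v \<in> C \<Longrightarrow> u \<circ> v \<in> C" "\<And>u. u \<in> C \<Longrightarrow> inv_into UNIV u \<in> C"
      "\<And>u. u \<in> C \<Longrightarrow> bij u" "\<And>u. u \<in> C \<Longrightarrow> u N \<in> V"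
    and C': "C' \<subseteq> C" "\<And>u. u \<in> C' \<Longrightarrow> u N = N" "\<And>u. u \<in> C \<Longrightarrow> u N = N \<Longrightarrow> u \<in> C'"
    and c: "\<And>v. v \<in> V \<Longrightarrow> c v \<in> C" "\<And>v. v \<in> V \<Longrightarrow> c v N = v"
  shows "bij_betw (\<lambda>(v, w). c v \<circ> w) (V \<times> C') C"
proof (rule bij_betwI')
  fix p q assume "p \<in> V \<times> C'" "q \<in> V \<times> C'"
  then obtain v w v' w' where p: "p = (v, w)" "v \<in> V" "w \<in> C'" and q: "q = (v', w')" "v' \<in> V" "w' \<in> C'"
    by auto
  show "((\<lambda>(v, w). c v \<circ> w) p = (\<lambda>(v, w). c v \<circ> w) q) = (p = q)"
  proof
    assume "(\<lambda>(v, w). c v \<circ> w) p = (\<lambda>(v, w). c v \<circ> w) q"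
    then have eq: "c v \<circ> w = c v' \<circ> w'" using p q by simp
    have "w N = N" "w' N = N" using C'(2) p q by auto
    then have v: "v = v'" using fun_cong[OF eq, of N] c(2)[OF p(2)] c(2)[OF q(2)] by simp
    have "inj (c v)" using C(3)[OF c(1)[OF p(2)]] by (rule bij_is_inj)
    then have "w = w'" using eq unfolding v by (metis fun.inj_map_strong comp_apply ext injD)
    then show "p = q" using v p q by simp
  qed auto
next
  fix p assume "p \<in> V \<times> C'"
  then show "(\<lambda>(v, w). c v \<circ> w) p \<in> C" using C C' c by auto
next
  fix w assume w: "w \<in> C"
  let ?v = "w N" and ?u = "inv_into UNIV (c (w N)) \<circ> w"
  have v: "?v \<in> V" "c ?v \<in> C" "c ?v N = ?v" using C(4)[OF w] c by auto
  have b: "bij (c ?v)" using C(3) v by blast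
  have "inv_into UNIV (c ?v) (c ?v N) = N" using b by (simp add: bij_is_inj)
  then have "?u N = N" using v(3) by simp
  moreover have "?u \<in> C" using C w v by blast
  ultimately have "?u \<in> C'" using C' by blast
  moreover have "c ?v \<circ> ?u = w" using b by (simp add: fun_eq_iff bij_is_surj surj_f_inv_f)
  ultimately show "\<exists>p\<in>V \<times> C'. w = (\<lambda>(v, w). c v \<circ> w) p"
    using v by (intro bexI[of _ "(?v, ?u)"]) auto
qed

definition centred_step :: "'v set \<Rightarrow> ('v \<Rightarrow> real) \<Rightarrow> real \<Rightarrow> real pmf" where
  "centred_step V k c = map_pmf (\<lambda>v. k v - c) (pmf_of_set V)"

text \<open>When the statistic of a product of representative and stabiliser element splits
  additively, the uniform law on the group is a convolution of uniform laws on the values. The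
  centres \<mu> are arbitrary here. The list is reversed so that the newest step stands at its head,
  as in the recursion of \<open>sum_pmf\<close>.\<close>

lemma insertion_law:
  fixes C :: "nat \<Rightarrow> (int \<Rightarrow> int) set" and V :: "nat \<Rightarrow> int set" and g :: "nat \<Rightarrow> (int \<Rightarrow> int) \<Rightarrow> real"
  assumes C: "\<And>n. finite (C n)" "\<And>n. C n \<noteq> {}" and V: "\<And>n. finite (V (Suc n))" "\<And>n. V (Suc n) \<noteq> {}"
    and b: "\<And>n. bij_betw (\<lambda>(v, w). c n v \<circ> w) (V (Suc n) \<times> C n) (C (Suc n))"
    and g0: "\<And>w. w \<in> C 0 \<Longrightarrow> g 0 w = 0"
    and g: "\<And>n v w. v \<in> V (Suc n) \<Longrightarrow> w \<in> C n \<Longrightarrow> g (Suc n) (c n v \<circ> w) = k (Suc n) v + g n w"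
  shows "map_pmf (g n) (pmf_of_set (C n)) =
    map_pmf (\<lambda>x. x + (\<Sum>j\<in>{1..n}. \<mu> j)) (sum_pmf (map (\<lambda>j. centred_step (V j) (k j) (\<mu> j)) (rev [1..<Suc n])))"
proof (induction n)
  case 0
  have "map_pmf (g 0) (pmf_of_set (C 0)) = map_pmf (\<lambda>_. 0) (pmf_of_set (C 0))"
    by (rule map_pmf_cong) (use g0 C in auto)
  then show ?case by (simp add: map_pmf_const)
next
  case (Suc n)
  have "pmf_of_set (C (Suc n)) = map_pmf (\<lambda>(v, w). c n v \<circ> w) (pmf_of_set (V (Suc n) \<times> C n))"
    by (rule map_pmf_of_set_bij_betw[symmetric, OF b]) (use C V in auto)
  also have "pmf_of_set (V (Suc n) \<times> C n) = pair_pmf (pmf_of_set (V (Suc n))) (pmf_of_set (C n))"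
    using C V by (intro pmf_of_set_Times)
  finally have "map_pmf (g (Suc n)) (pmf_of_set (C (Suc n))) =
    map_pmf (\<lambda>(v, w). g (Suc n) (c n v \<circ> w)) (pair_pmf (pmf_of_set (V (Suc n))) (pmf_of_set (C n)))"
    by (simp add: pmf.map_comp comp_def case_prod_beta')
  also have "\<dots> = map_pmf (\<lambda>(v, w). k (Suc n) v + g n w) (pair_pmf (pmf_of_set (V (Suc n))) (pmf_of_set (C n)))"
    by (rule map_pmf_cong) (use C V g in auto)
  also have "\<dots> = bind_pmf (pmf_of_set (V (Suc n))) (\<lambda>v. map_pmf (\<lambda>x. k (Suc n) v + x) (map_pmf (g n) (pmf_of_set (C n))))"
    by (simp add: pair_pmf_def map_bind_pmf map_pmf_def bind_assoc_pmf bind_return_pmf comp_def)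
  also have "\<dots> = map_pmf (\<lambda>x. x + (\<Sum>j\<in>{1..Suc n}. \<mu> j))
      (sum_pmf (centred_step (V (Suc n)) (k (Suc n)) (\<mu> (Suc n)) # map (\<lambda>j. centred_step (V j) (k j) (\<mu> j)) (rev [1..<Suc n])))"
    unfolding Suc.IH centred_step_def
    by (simp add: map_bind_pmf bind_map_pmf pmf.map_comp comp_def algebra_simps)
  finally show ?case by simp
qed

text \<open>\<open>insert_A n v\<close> and \<open>insert_B n v\<close> (below) are the minimal representatives, for the parabolic subgroup
  fixing the last letter, of the coset of elements with last value \<open>v\<close>.\<close>

definition insert_A :: "nat \<Rightarrow> int \<Rightarrow> int \<Rightarrow> int" where
  "insert_A n v a = (if v \<le> a \<and> a \<le> int n then a + 1 else if a = int n + 1 then v else a)"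

lemma insert_A_perm:
  assumes "v \<in> {1..int (Suc n)}"
  shows "insert_A n v permutes {1..int (Suc n)}"
proof -
  have "inj_on (insert_A n v) {1..int (Suc n)}"
    by (rule inj_onI) (use assms in \<open>auto simp: insert_A_def split: if_splits\<close>)
  moreover have "insert_A n v ` {1..int (Suc n)} \<subseteq> {1..int (Suc n)}"
    using assms by (auto simp: insert_A_def)
  ultimately have "bij_betw (insert_A n v) {1..int (Suc n)} {1..int (Suc n)}"
    by (simp add: bij_betw_def endo_inj_surj)
  then show ?thesis by (rule bij_imp_permutes) (use assms in \<open>auto simp: insert_A_def\<close>)
qed

lemma permutes_fix_last:
  assumes "p permutes {1..int (Suc n)}"
  shows "p permutes {1..int n} \<longleftrightarrow> p (int (Suc n)) = int (Suc n)"
proof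
  assume "p permutes {1..int n}"
  then show "p (int (Suc n)) = int (Suc n)" by (rule permutes_not_in) auto
next
  assume p: "p (int (Suc n)) = int (Suc n)"
  show "p permutes {1..int n}"
  proof (rule permutes_superset[OF assms])
    fix x assume "x \<in> {1..int (Suc n)} - {1..int n}"
    then have "x = int (Suc n)" by auto
    then show "p x = x" using p by simp
  qed
qed

definition inv_A :: "nat \<Rightarrow> (int \<Rightarrow> int) \<Rightarrow> nat" where
  "inv_A n w = card {(i, j). 1 \<le> i \<and> i < j \<and> j \<le> int n \<and> w j < w i}"

lemma finite_int_pairs: "finite {(i :: int, j :: int). - N \<le> i \<and> i \<le> N \<and> - N \<le> j \<and> j \<le> N \<and> R i j}"
  by (rule finite_subset[of _ "{-N..N} \<times> {-N..N}"]) auto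

text \<open>Separates the pairs whose second position is the last one. The bounds on i keep all sets
  finite while allowing the negative first positions of types B and D.\<close>

lemma card_pairs_split:
  fixes R :: "int \<Rightarrow> int \<Rightarrow> bool"
  assumes R: "\<And>i j. R i j \<Longrightarrow> - j \<le> i \<and> i < j"
  shows "card {(i, j). R i j \<and> j \<le> int (Suc n)} =
    card {(i, j). R i j \<and> j \<le> int n} + card {i. R i (int (Suc n))}"
proof -
  have fin: "finite {(i, j). R i j \<and> j \<le> int m}" for m
    by (rule finite_subset[OF _ finite_int_pairs[of "int m" R]]) (use R in fastforce)
  have le: "j \<le> int (Suc n) \<longleftrightarrow> j \<le> int n \<or> j = int (Suc n)" for j by auto
  have "{(i, j). R i j \<and> j \<le> int (Suc n)} =
      {(i, j). R i j \<and> j \<le> int n} \<union> (\<lambda>i. (i, int (Suc n))) ` {i. R i (int (Suc n))}"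
    unfolding le by auto
  moreover have "finite {i. R i (int (Suc n))}"
    by (rule finite_subset[of _ "{- int (Suc n)..int (Suc n)}"]) (use R in fastforce)+
  ultimately have "card {(i, j). R i j \<and> j \<le> int (Suc n)} =
      card {(i, j). R i j \<and> j \<le> int n} + card ((\<lambda>i. (i, int (Suc n))) ` {i. R i (int (Suc n))})"
    using fin by (subst card_Un_disjoint[symmetric]) auto
  then show ?thesis by (subst (asm) card_image) (auto simp: inj_on_def)
qed

text \<open>\<open>insert_A n v\<close> is increasing on the first n letters, so old inversions
  persist and no others arise among them. The new ones pair the last position with the values above
  v.\<close>

lemma inv_A_insert:
  assumes v: "v \<in> {1..int (Suc n)}" and w: "w permutes {1..int n}"
  shows "real (inv_A (Suc n) (insert_A n v \<circ> w)) = (real (Suc n) - real_of_int v) + real (inv_A n w)"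
proof -
  let ?u = "insert_A n v \<circ> w" and ?N = "int (Suc n)"
  have perm: "?u permutes {1..?N}"
    by (rule permutes_compose[OF permutes_subset[OF w]]) (use insert_A_perm[OF v] in auto)
  have "w ?N = ?N" by (rule permutes_not_in[OF w]) auto
  then have last: "?u ?N = v" using v by (auto simp: insert_A_def)
  have mono: "?u j < ?u i \<longleftrightarrow> w j < w i" if "i \<in> {1..int n}" "j \<in> {1..int n}" for i j
    using permutes_in_image[OF w, of i] permutes_in_image[OF w, of j] that by (auto simp: insert_A_def)
  have "inv_A (Suc n) ?u = card {(i, j). (1 \<le> i \<and> i < j \<and> ?u j < ?u i) \<and> j \<le> ?N}"
    unfolding inv_A_def by (intro arg_cong[where f = card]) auto
  also have "\<dots> = card {(i, j). (1 \<le> i \<and> i < j \<and> ?u j < ?u i) \<and> j \<le> int n} +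
      card {i. 1 \<le> i \<and> i < ?N \<and> ?u ?N < ?u i}"
    by (rule card_pairs_split) auto
  also have "{(i, j). (1 \<le> i \<and> i < j \<and> ?u j < ?u i) \<and> j \<le> int n} =
      {(i, j). 1 \<le> i \<and> i < j \<and> j \<le> int n \<and> w j < w i}"
    using mono by auto
  also have "card {i. 1 \<le> i \<and> i < ?N \<and> ?u ?N < ?u i} = card (?u ` {i. 1 \<le> i \<and> i < ?N \<and> ?u ?N < ?u i})"
    by (rule card_image[symmetric]) (rule inj_on_subset[OF permutes_inj[OF perm]], simp)
  also have "?u ` {i. 1 \<le> i \<and> i < ?N \<and> ?u ?N < ?u i} = {v<..?N}"
  proof safe
    fix i assume "1 \<le> i" "i < ?N" "?u ?N < ?u i"
    then show "?u i \<in> {v<..?N}" using permutes_in_image[OF perm, of i] last by auto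
  next
    fix a assume a: "a \<in> {v<..?N}"
    then have "a \<in> ?u ` {1..?N}" using permutes_image[OF perm] v by auto
    then obtain i where i: "i \<in> {1..?N}" "a = ?u i" by auto
    moreover have "i \<noteq> ?N" using i a last by auto
    ultimately show "a \<in> ?u ` {i. 1 \<le> i \<and> i < ?N \<and> ?u ?N < ?u i}" using a last by auto
  qed
  finally show ?thesis using v by (simp add: inv_A_def)
qed

lemma inv_A_law:
  "map_pmf (\<lambda>w. real (inv_A n w)) (pmf_of_set {p. p permutes {1..int n}}) =
    map_pmf (\<lambda>x. x + (\<Sum>j\<in>{1..n}. (real j - 1) / 2))
      (sum_pmf (map (\<lambda>j. centred_step {1..int j} (\<lambda>v. real j - real_of_int v) ((real j - 1) / 2)) (rev [1..<Suc n])))"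
proof (rule insertion_law[where c = insert_A])
  fix n
  show "finite {p. p permutes {1..int n}}" by (simp add: finite_permutations)
  show "{p. p permutes {1..int n}} \<noteq> {}" using permutes_id by blast
  show "bij_betw (\<lambda>(v, w). insert_A n v \<circ> w) ({1..int (Suc n)} \<times> {p. p permutes {1..int n}}) {p. p permutes {1..int (Suc n)}}"
  proof (rule bij_betw_coset[where N = "int (Suc n)"])
    show "{p. p permutes {1..int n}} \<subseteq> {p. p permutes {1..int (Suc n)}}"
      by (auto intro: permutes_subset)
    fix u assume u: "u \<in> {p. p permutes {1..int (Suc n)}}"
    show "u (int (Suc n)) \<in> {1..int (Suc n)}"
      using permutes_in_image[of u "{1..int (Suc n)}" "int (Suc n)"] u by auto
    show "u \<in> {p. p permutes {1..int n}}" if "u (int (Suc n)) = int (Suc n)"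
      using permutes_fix_last u that by blast
  next
    fix u assume "u \<in> {p. p permutes {1..int n}}"
    then show "u (int (Suc n)) = int (Suc n)" by (auto intro!: permutes_not_in[of u "{1..int n}"])
  next
    fix v assume v: "v \<in> {1..int (Suc n)}"
    show "insert_A n v \<in> {p. p permutes {1..int (Suc n)}}" using insert_A_perm[OF v] by simp
    show "insert_A n v (int (Suc n)) = v" using v by (auto simp: insert_A_def)
  qed (use symmetric_group_axioms[where n = "Suc n"] in auto)
  show "real (inv_A (Suc n) (insert_A n v \<circ> w)) = (real (Suc n) - real_of_int v) + real (inv_A n w)"
    if "v \<in> {1..int (Suc n)}" "w \<in> {p. p permutes {1..int n}}" for v w
    using inv_A_insert that by blast
next
  fix w :: "int \<Rightarrow> int"
  have *: "{(i, j). 1 \<le> i \<and> i < j \<and> j \<le> int 0 \<and> w j < w i} = {}" by auto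
  show "real (inv_A 0 w) = 0" unfolding inv_A_def * by simp
qed auto

section \<open>Insertion in types B and D\<close>

definition insert_B :: "nat \<Rightarrow> int \<Rightarrow> int \<Rightarrow> int" where
  "insert_B n v a =
    (if \<bar>v\<bar> \<le> \<bar>a\<bar> \<and> \<bar>a\<bar> \<le> int n then a + sgn a else if \<bar>a\<bar> = int n + 1 then sgn a * v else a)"

lemma insert_B_perm:
  assumes v: "v \<noteq> 0" "\<bar>v\<bar> \<le> int (Suc n)"
  shows "insert_B n v \<in> signed_permutations (Suc n)"
proof -
  have abs_insert: "\<bar>insert_B n v a\<bar> = insert_A n \<bar>v\<bar> \<bar>a\<bar>" for a
    using v by (auto simp: insert_B_def insert_A_def abs_mult abs_sgn_eq abs_if sgn_if)
  have odd: "insert_B n v (- a) = - insert_B n v a" for a by (auto simp: insert_B_def)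
  have "inj_on (insert_B n v) (symmetric_ints (Suc n))"
  proof (rule inj_onI)
    fix a b assume ab: "a \<in> symmetric_ints (Suc n)" "b \<in> symmetric_ints (Suc n)"
      and eq: "insert_B n v a = insert_B n v b"
    have "insert_A n \<bar>v\<bar> \<bar>a\<bar> = insert_A n \<bar>v\<bar> \<bar>b\<bar>" using eq abs_insert by metis
    moreover have "insert_A n \<bar>v\<bar> permutes {1..int (Suc n)}" by (rule insert_A_perm) (use v in auto)
    ultimately have "\<bar>a\<bar> = \<bar>b\<bar>" using permutes_inj injD by metis
    moreover have "a \<noteq> - b"
    proof
      assume "a = - b"
      then have "insert_B n v b = 0" using eq odd[of b] by simp
      then show False using ab v by (auto simp: insert_B_def sgn_if split: if_splits)
    qed
    ultimately show "a = b" by linarith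
  qed
  moreover have "insert_B n v ` symmetric_ints (Suc n) \<subseteq> symmetric_ints (Suc n)"
    using v by (auto simp: insert_B_def sgn_if)
  ultimately have "bij_betw (insert_B n v) (symmetric_ints (Suc n)) (symmetric_ints (Suc n))"
    by (simp add: bij_betw_def endo_inj_surj)
  then have "insert_B n v permutes symmetric_ints (Suc n)"
    by (rule bij_imp_permutes) (use v in \<open>auto simp: insert_B_def\<close>)
  then show ?thesis using odd by (simp add: signed_permutations_def)
qed

lemma signed_permutations_fix_last:
  assumes "p \<in> signed_permutations (Suc n)"
  shows "p \<in> signed_permutations n \<longleftrightarrow> p (int (Suc n)) = int (Suc n)"
proof
  assume "p \<in> signed_permutations n"
  then have "p permutes symmetric_ints n" by (rule signed_perm_facts)
  then show "p (int (Suc n)) = int (Suc n)" by (rule permutes_not_in) auto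
next
  assume p: "p (int (Suc n)) = int (Suc n)"
  have "p permutes symmetric_ints n"
  proof (rule permutes_superset[OF signed_perm_facts(1)[OF assms]])
    fix x assume "x \<in> symmetric_ints (Suc n) - symmetric_ints n"
    then have "x = int (Suc n) \<or> x = - int (Suc n)" by auto
    then show "p x = x" using p signed_perm_facts(3)[OF assms, of "int (Suc n)"] by auto
  qed
  then show "p \<in> signed_permutations n" using assms by (simp add: signed_permutations_def)
qed

lemma signed_permutations_mono: "signed_permutations n \<subseteq> signed_permutations (Suc n)"
proof
  fix p assume p: "p \<in> signed_permutations n"
  have "p permutes symmetric_ints (Suc n)"
    by (rule permutes_subset[OF signed_perm_facts(1)[OF p]]) auto
  then show "p \<in> signed_permutations (Suc n)" using p by (simp add: signed_permutations_def)
qed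

definition negatives :: "nat \<Rightarrow> (int \<Rightarrow> int) \<Rightarrow> nat" where
  "negatives n w = card {i \<in> {1..int n}. w i < 0}"

lemma inv_D_insert:
  assumes v: "v \<noteq> 0" "\<bar>v\<bar> \<le> int (Suc n)" and w: "w \<in> signed_permutations n"
  shows "real (inv_D (Suc n) (insert_B n v \<circ> w)) =
      (real (Suc n) - real_of_int v - (if v < 0 then 2 else 0)) + real (inv_D n w)"
    and "real (negatives (Suc n) (insert_B n v \<circ> w)) = (if v < 0 then 1 else 0) + real (negatives n w)"
proof -
  let ?u = "insert_B n v \<circ> w" and ?N = "int (Suc n)"
  have u: "?u \<in> signed_permutations (Suc n)"
    by (rule signed_permutations_axioms) (use insert_B_perm[OF v] signed_permutations_mono w in auto)
  note perm = signed_perm_facts(1)[OF u]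
  have "w ?N = ?N" by (rule permutes_not_in[OF signed_perm_facts(1)[OF w]]) auto
  then have last: "?u ?N = v" using v by (auto simp: insert_B_def)
  have mono: "?u j < ?u i \<longleftrightarrow> w j < w i" if "i \<noteq> 0" "\<bar>i\<bar> \<le> int n" "j \<noteq> 0" "\<bar>j\<bar> \<le> int n" for i j
    using signed_perm_range[OF w that(1,2)] signed_perm_range[OF w that(3,4)] by (auto simp: insert_B_def sgn_if)
  have "inv_D (Suc n) ?u = card {(i, j). (- j < i \<and> i < j \<and> i \<noteq> 0 \<and> ?u j < ?u i) \<and> j \<le> ?N}"
    unfolding inv_D_def by (intro arg_cong[where f = card]) auto
  also have "\<dots> = card {(i, j). (- j < i \<and> i < j \<and> i \<noteq> 0 \<and> ?u j < ?u i) \<and> j \<le> int n} +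
      card {i. - ?N < i \<and> i < ?N \<and> i \<noteq> 0 \<and> ?u ?N < ?u i}"
    by (rule card_pairs_split) auto
  also have "{(i, j). (- j < i \<and> i < j \<and> i \<noteq> 0 \<and> ?u j < ?u i) \<and> j \<le> int n} =
      {(i, j). - j < i \<and> i < j \<and> i \<noteq> 0 \<and> j \<le> int n \<and> w j < w i}"
  proof -
    have "((- j < i \<and> i < j \<and> i \<noteq> 0 \<and> ?u j < ?u i) \<and> j \<le> int n) =
        (- j < i \<and> i < j \<and> i \<noteq> 0 \<and> j \<le> int n \<and> w j < w i)" for i j
      using mono[of i j] by (cases "- j < i \<and> i < j \<and> i \<noteq> 0 \<and> j \<le> int n") auto
    then show ?thesis by simp
  qed
  also have "card {i. - ?N < i \<and> i < ?N \<and> i \<noteq> 0 \<and> ?u ?N < ?u i} =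
      card (?u ` {i. - ?N < i \<and> i < ?N \<and> i \<noteq> 0 \<and> ?u ?N < ?u i})"
    by (rule card_image[symmetric]) (rule inj_on_subset[OF permutes_inj[OF perm]], simp)
  also have "?u ` {i. - ?N < i \<and> i < ?N \<and> i \<noteq> 0 \<and> ?u ?N < ?u i} = {v<..?N} - {0, - v}"
  proof (intro equalityI subsetI)
    fix x assume "x \<in> ?u ` {i. - ?N < i \<and> i < ?N \<and> i \<noteq> 0 \<and> ?u ?N < ?u i}"
    then obtain i where i: "- ?N < i" "i < ?N" "i \<noteq> 0" "?u ?N < ?u i" and x: "x = ?u i" by blast
    have "\<bar>i\<bar> \<le> ?N" using i by linarith
    note range = signed_perm_range[OF u i(3) this]
    have "?u i \<noteq> - v"
      using signed_perm_facts(6)[OF u, of i ?N] i last by auto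
    then show "x \<in> {v<..?N} - {0, - v}" unfolding x using range i last by (simp add: abs_le_iff)
  next
    fix a assume a: "a \<in> {v<..?N} - {0, - v}"
    then have "a \<in> ?u ` symmetric_ints (Suc n)" unfolding permutes_image[OF perm] using v by auto
    then obtain i where i: "i \<in> symmetric_ints (Suc n)" "a = ?u i" by (elim imageE)
    have "i \<noteq> ?N" using i a last by auto
    moreover have "i \<noteq> - ?N" using i(2) a last signed_perm_facts(3)[OF u, of ?N] by auto
    ultimately have "- ?N < i \<and> i < ?N \<and> i \<noteq> 0 \<and> ?u ?N < ?u i" using a i last by auto
    then show "a \<in> ?u ` {i. - ?N < i \<and> i < ?N \<and> i \<noteq> 0 \<and> ?u ?N < ?u i}" unfolding i(2) by blast
  qed
  finally have eq: "inv_D (Suc n) ?u = inv_D n w + card ({v<..?N} - {0, - v})"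
    unfolding inv_D_def .
  have "real (card ({v<..?N} - {0, - v})) = real (Suc n) - real_of_int v - (if v < 0 then 2 else 0)"
  proof (cases "v < 0")
    case True
    then have "card ({v<..?N} - {0, - v}) = card {v<..?N} - card {0, - v}"
      using v by (intro card_Diff_subset) auto
    then show ?thesis using True v by (simp add: of_nat_diff)
  next
    case False
    then have "{v<..?N} - {0, - v} = {v<..?N}" by auto
    then show ?thesis using False v by simp
  qed
  then show "real (inv_D (Suc n) ?u) = (real (Suc n) - real_of_int v - (if v < 0 then 2 else 0)) + real (inv_D n w)"
    unfolding eq by simp
  have neg: "?u i < 0 \<longleftrightarrow> w i < 0" if "i \<in> {1..int n}" for i
    using signed_perm_range[OF w, of i] that by (auto simp: insert_B_def sgn_if)
  have "{1..?N} = insert ?N {1..int n}" by auto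
  then have "{i \<in> {1..?N}. ?u i < 0} = {i \<in> {?N}. ?u i < 0} \<union> {i \<in> {1..int n}. ?u i < 0}"
    by blast
  also have "{i \<in> {1..int n}. ?u i < 0} = {i \<in> {1..int n}. w i < 0}"
    using neg by blast
  also have "{i \<in> {?N}. ?u i < 0} = (if v < 0 then {?N} else {})" using last by auto
  finally have split: "{i \<in> {1..?N}. ?u i < 0} = (if v < 0 then {?N} else {}) \<union> {i \<in> {1..int n}. w i < 0}" .
  have "card ((if v < 0 then {?N} else {}) \<union> A) = (if v < 0 then 1 else 0) + card A"
    if "finite A" "?N \<notin> A" for A
    using that by auto
  moreover have "finite {i \<in> {1..int n}. w i < 0}"
    by (rule finite_subset[of _ "{1..int n}"]) auto
  moreover have "?N \<notin> {i \<in> {1..int n}. w i < 0}" by auto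
  ultimately have "negatives (Suc n) ?u = (if v < 0 then 1 else 0) + negatives n w"
    unfolding negatives_def split by blast
  then show "real (negatives (Suc n) ?u) = (if v < 0 then 1 else 0) + real (negatives n w)"
    by simp
qed

abbreviation "signed_values n \<equiv> {v :: int. v \<noteq> 0 \<and> \<bar>v\<bar> \<le> int n}"

lemma bij_betw_insert_B:
  "bij_betw (\<lambda>(v, w). insert_B n v \<circ> w) (signed_values (Suc n) \<times> signed_permutations n) (signed_permutations (Suc n))"
proof (rule bij_betw_coset[where N = "int (Suc n)"])
  fix u assume u: "u \<in> signed_permutations (Suc n)"
  show "bij u" using u by (rule signed_perm_facts)
  show "u (int (Suc n)) \<in> signed_values (Suc n)" using signed_perm_range[OF u, of "int (Suc n)"] by simp
  show "u \<in> signed_permutations n" if "u (int (Suc n)) = int (Suc n)"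
    using signed_permutations_fix_last[OF u] that by simp
next
  fix u assume "u \<in> signed_permutations n"
  then show "u (int (Suc n)) = int (Suc n)"
    using signed_permutations_fix_last[of u n] signed_permutations_mono by blast
next
  fix v assume "v \<in> signed_values (Suc n)"
  then show "insert_B n v \<in> signed_permutations (Suc n)" "insert_B n v (int (Suc n)) = v"
    using insert_B_perm[of v n] by (auto simp: insert_B_def)
qed (use signed_permutations_mono signed_permutations_axioms in auto)

text \<open>\<open>h = 1 / 2\<close> is the type B statistic and \<open>h = 1\<close> the type D statistic on the larger group of all signed
  permutations.\<close>

lemma signed_inv_law:
  fixes h :: real
  assumes g: "\<And>n w. g n w = real (inv_D n w) + (2 - 2 * h) * real (negatives n w)"
  shows "map_pmf (g n) (pmf_of_set (signed_permutations n)) =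
    map_pmf (\<lambda>x. x + (\<Sum>j\<in>{1..n}. real j - h))
      (sum_pmf (map (\<lambda>j. centred_step (signed_values j) (\<lambda>v. real j - real_of_int v - (if v < 0 then 2 * h else 0)) (real j - h))
        (rev [1..<Suc n])))"
proof (rule insertion_law[where c = insert_B, OF _ _ _ _ bij_betw_insert_B])
  fix n
  show "finite (signed_permutations n)" by (rule signed_permutations_axioms)
  show "signed_permutations n \<noteq> {}" using signed_permutations_axioms(2)[of n] by blast
  show "finite (signed_values (Suc n))"
    by (rule finite_subset[of _ "{- int (Suc n)..int (Suc n)}"]) auto
  show "signed_values (Suc n) \<noteq> {}" by (auto intro: exI[of _ 1])
  show "g (Suc n) (insert_B n v \<circ> w) = real (Suc n) - real_of_int v - (if v < 0 then 2 * h else 0) + g n w"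
    if "v \<in> signed_values (Suc n)" "w \<in> signed_permutations n" for v w
    using inv_D_insert[of v n w] that by (cases "v < 0") (simp_all add: g algebra_simps)
next
  fix w :: "int \<Rightarrow> int"
  have *: "{(i, j). - j < i \<and> i < j \<and> i \<noteq> 0 \<and> j \<le> int 0 \<and> w j < w i} = {}" by auto
  have **: "{i \<in> {1..int 0}. w i < 0} = {}" by auto
  show "g 0 w = 0" unfolding g inv_D_def negatives_def * ** by simp
qed

section \<open>Symmetry and variance of the insertion steps\<close>

lemma centred_step_symmetric:
  assumes V: "finite V" "V \<noteq> {}" and b: "bij_betw f V V"
    and odd: "\<And>v. v \<in> V \<Longrightarrow> k (f v) - c = - (k v - c)" and le: "\<And>v. v \<in> V \<Longrightarrow> \<bar>k v - c\<bar> \<le> \<rho>"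
  shows "symmetric_pmf \<rho> (centred_step V k c)"
proof -
  have "map_pmf uminus (centred_step V k c) = map_pmf (\<lambda>v. k (f v) - c) (pmf_of_set V)"
    unfolding centred_step_def pmf.map_comp by (rule map_pmf_cong) (use V odd in auto)
  also have "\<dots> = map_pmf (\<lambda>v. k v - c) (map_pmf f (pmf_of_set V))"
    by (simp add: pmf.map_comp comp_def)
  also have "map_pmf f (pmf_of_set V) = pmf_of_set V"
    by (rule map_pmf_of_set_bij_betw[OF b]) (use V in auto)
  finally show ?thesis using V le by (auto simp: symmetric_pmf_def centred_step_def)
qed

lemma centred_step_second_moment:
  assumes "finite V" "V \<noteq> {}"
  shows "second_moment (centred_step V k c) = (\<Sum>v\<in>V. (k v - c)\<^sup>2) / card V"
  using assms by (simp add: centred_step_def integral_pmf_of_set)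

lemma symmetric_pmf_mono: "symmetric_pmf \<rho> p \<Longrightarrow> \<rho> \<le> \<rho>' \<Longrightarrow> symmetric_pmf \<rho>' p"
  unfolding symmetric_pmf_def by force

lemma sum_shifted_squares:
  "(\<Sum>v\<in>{1..int n}. (real_of_int v - c)\<^sup>2) =
    real n * (real n + 1) * (2 * real n + 1) / 6 - c * real n * (real n + 1) + real n * c\<^sup>2"
proof (induction n)
  case (Suc n)
  have "{1..int (Suc n)} = insert (int (Suc n)) {1..int n}" by auto
  then have "(\<Sum>v\<in>{1..int (Suc n)}. (real_of_int v - c)\<^sup>2) = (real (Suc n) - c)\<^sup>2 + (\<Sum>v\<in>{1..int n}. (real_of_int v - c)\<^sup>2)"
    by simp
  then show ?case unfolding Suc.IH by (simp add: power2_eq_square field_simps)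
qed simp

lemma step_A:
  assumes j: "j \<ge> 1"
  defines "p \<equiv> centred_step {1..int j} (\<lambda>v. real j - real_of_int v) ((real j - 1) / 2)"
  shows "symmetric_pmf (real j) p" "second_moment p \<ge> ((real j)\<^sup>2 - 1) / 12"
proof -
  show "symmetric_pmf (real j) p"
    unfolding p_def
  proof (rule centred_step_symmetric)
    show "bij_betw (\<lambda>v. int j + 1 - v) {1..int j} {1..int j}"
      by (rule bij_betw_byWitness[where f' = "\<lambda>v. int j + 1 - v"]) auto
    fix v assume "v \<in> {1..int j}"
    then have "1 \<le> real_of_int v" "real_of_int v \<le> real j" by auto
    then show "\<bar>real j - real_of_int v - (real j - 1) / 2\<bar> \<le> real j" by (simp add: abs_le_iff field_simps)
  qed (use j in \<open>auto simp: field_simps\<close>)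
  have "second_moment p = (\<Sum>v\<in>{1..int j}. (real_of_int v - (real j + 1) / 2)\<^sup>2) / real j"
    unfolding p_def using j
    by (subst centred_step_second_moment) (auto intro!: sum.cong simp: power2_eq_square field_simps)
  also have "\<dots> = ((real j)\<^sup>2 - 1) / 12"
    unfolding sum_shifted_squares using j by (simp add: field_simps power2_eq_square)
  finally show "second_moment p \<ge> ((real j)\<^sup>2 - 1) / 12" by simp
qed

lemma signed_values_eq: "signed_values j = {1..int j} \<union> uminus ` {1..int j}"
proof (intro equalityI subsetI)
  fix v assume "v \<in> signed_values j"
  then show "v \<in> {1..int j} \<union> uminus ` {1..int j}"
    by (cases "v > 0") (auto intro!: image_eqI[of v uminus "- v"])
qed auto

text \<open>After centring, a positive value v contributes h - v and its negative contributes v - h,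
  so negation of v is the symmetry. For both choices of h the second moment is at least that of the
  type A step, and one lower bound serves all three types.\<close>

lemma step_B:
  assumes j: "j \<ge> 1" and h: "h = 1 / 2 \<or> h = 1"
  defines "p \<equiv> centred_step (signed_values j) (\<lambda>v. real j - real_of_int v - (if v < 0 then 2 * h else 0)) (real j - h)"
  shows "symmetric_pmf (real j) p" "second_moment p \<ge> ((real j)\<^sup>2 - 1) / 12"
proof -
  have fin: "finite (signed_values j)" "signed_values j \<noteq> {}" unfolding signed_values_eq using j by auto
  show "symmetric_pmf (real j) p"
    unfolding p_def
  proof (rule centred_step_symmetric[OF fin])
    show "bij_betw uminus (signed_values j) (signed_values j)"
      by (rule bij_betw_byWitness[where f' = uminus]) auto
    fix v assume "v \<in> signed_values j"
    then have "real_of_int v \<ge> 1 \<and> real_of_int v \<le> real j \<or> real_of_int v \<le> - 1 \<and> - real_of_int v \<le> real j"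
      by (auto simp: abs_le_iff)
    then show "\<bar>real j - real_of_int v - (if v < 0 then 2 * h else 0) - (real j - h)\<bar> \<le> real j"
      using h by (auto simp: abs_le_iff)
  qed auto
  have "(\<Sum>v\<in>signed_values j. (real j - real_of_int v - (if v < 0 then 2 * h else 0) - (real j - h))\<^sup>2) =
      (\<Sum>v\<in>{1..int j}. (real j - real_of_int v - (if v < 0 then 2 * h else 0) - (real j - h))\<^sup>2) +
      (\<Sum>v\<in>uminus ` {1..int j}. (real j - real_of_int v - (if v < 0 then 2 * h else 0) - (real j - h))\<^sup>2)"
    unfolding signed_values_eq by (rule sum.union_disjoint) auto
  also have "\<dots> = 2 * (\<Sum>v\<in>{1..int j}. (real_of_int v - h)\<^sup>2)"
    by (subst sum.reindex) (auto simp: inj_on_def power2_commute sum_distrib_left intro!: sum.cong)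
  finally have sum: "(\<Sum>v\<in>signed_values j. (real j - real_of_int v - (if v < 0 then 2 * h else 0) - (real j - h))\<^sup>2) =
      2 * (\<Sum>v\<in>{1..int j}. (real_of_int v - h)\<^sup>2)" .
  have card: "card (signed_values j) = 2 * j"
    unfolding signed_values_eq by (subst card_Un_disjoint) (auto simp: card_image)
  have "second_moment p = 2 * (\<Sum>v\<in>{1..int j}. (real_of_int v - h)\<^sup>2) / real (2 * j)"
    unfolding p_def centred_step_second_moment[OF fin] sum card ..
  also have "\<dots> = (real j + 1) * (2 * real j + 1) / 6 - h * (real j + 1) + h\<^sup>2"
    unfolding sum_shifted_squares using j by (simp add: field_simps)
  also have "\<dots> \<ge> ((real j)\<^sup>2 - 1) / 12"
  proof -
    have "real j \<ge> 1" using j by simp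
    then have "(real j - 1) * (real j - 1) \<ge> 0" "(real j)\<^sup>2 \<ge> real j" by (auto simp: power2_eq_square)
    from h show ?thesis
    proof
      assume h: "h = 1 / 2"
      show ?thesis unfolding h using \<open>(real j)\<^sup>2 \<ge> real j\<close> \<open>real j \<ge> 1\<close>
        by (simp add: power2_eq_square field_simps)
    next
      assume h: "h = 1"
      show ?thesis unfolding h using \<open>(real j - 1) * (real j - 1) \<ge> 0\<close> \<open>real j \<ge> 1\<close>
        by (simp add: power2_eq_square field_simps)
    qed
  qed
  finally show "second_moment p \<ge> ((real j)\<^sup>2 - 1) / 12" by simp
qed

text \<open>The lower bounds (j^2 - 1) / 12 add up to n (2 n^2 + 3 n - 5) / 72, and 3 n - 5 is
  nonnegative from n = 2 on. The left side is the number of steps times the square of their common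
  bound, so 36 is the constant K of \<open>moderate_deviation\<close>.\<close>

lemma step_list_variance:
  assumes step: "\<And>j. j \<ge> 1 \<Longrightarrow> second_moment (p j) \<ge> ((real j)\<^sup>2 - 1) / 12" and n: "n \<ge> 2"
  shows "real n * (real n)\<^sup>2 \<le> 36 * (\<Sum>q\<leftarrow>map p (rev [1..<Suc n]). second_moment q)"
proof -
  have "(\<Sum>q\<leftarrow>map p (rev [1..<Suc m]). second_moment q) \<ge> real m * (2 * (real m)\<^sup>2 + 3 * real m - 5) / 72" for m
  proof (induction m)
    case (Suc m)
    have "(\<Sum>q\<leftarrow>map p (rev [1..<Suc (Suc m)]). second_moment q) =
      second_moment (p (Suc m)) + (\<Sum>q\<leftarrow>map p (rev [1..<Suc m]). second_moment q)" by simp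
    then have "(\<Sum>q\<leftarrow>map p (rev [1..<Suc (Suc m)]). second_moment q) \<ge>
        ((real (Suc m))\<^sup>2 - 1) / 12 + real m * (2 * (real m)\<^sup>2 + 3 * real m - 5) / 72"
      using Suc.IH step[of "Suc m"] by linarith
    moreover have "((real (Suc m))\<^sup>2 - 1) / 12 + real m * (2 * (real m)\<^sup>2 + 3 * real m - 5) / 72 =
      real (Suc m) * (2 * (real (Suc m))\<^sup>2 + 3 * real (Suc m) - 5) / 72"
      by (simp add: power2_eq_square field_simps)
    ultimately show ?case by linarith
  qed simp
  from this[of n] have "36 * (\<Sum>q\<leftarrow>map p (rev [1..<Suc n]). second_moment q) \<ge>
      real n * (2 * (real n)\<^sup>2 + 3 * real n - 5) / 2" by simp
  moreover have "real n * (2 * (real n)\<^sup>2 + 3 * real n - 5) / 2 \<ge> real n * (2 * (real n)\<^sup>2) / 2"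
    using n by (intro divide_right_mono mult_left_mono) auto
  ultimately show ?thesis by simp
qed

text \<open>The sign of the entry \<open>1\<close> or \<open>-1\<close> is invisible to type D inversions, so their law is the same on \<open>D\<^sub>n\<close>
  and on \<open>B\<^sub>n\<close>.\<close>

lemma inv_D_sign_flip:
  assumes w: "w \<in> signed_permutations n"
  shows "inv_D n (signed_transpose 1 (-1) \<circ> w) = inv_D n w"
proof -
  let ?e = "signed_transpose 1 (-1)"
  define P where "P w = {(i :: int, j). - j < i \<and> i < j \<and> i \<noteq> 0 \<and> j \<le> int n \<and> w j < w i}" for w :: "int \<Rightarrow> int"
  \<comment> \<open>Negating the letter 1 in the values changes w i only where \<bar>w i\<bar> = 1,
    and there it amounts to replacing i by - i. If instead the second position carries that letter,
    its comparison with a value of absolute value at least 2 is unaffected. Hence f matches the two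
    sets of pairs.\<close>
  define f where "f = (\<lambda>(i, j :: int). (if \<bar>w i\<bar> = 1 then - i else i, j))"
  have e: "?e a = (if \<bar>a\<bar> = 1 then - a else a)" for a by (auto simp: signed_transpose_def)
  have mapsto: "f (i, j) \<in> P u'"
    if u': "\<And>a. u' (- a) = - u' a" "\<And>a. \<bar>u' a\<bar> = \<bar>w a\<bar>" and u: "\<And>a. u a = ?e (u' a)" and ij: "(i, j) \<in> P u" for u u' i j
  proof -
    have "\<bar>i\<bar> \<noteq> \<bar>j\<bar>" "i \<noteq> 0" "j \<noteq> 0" using ij by (auto simp: P_def)
    then have "\<bar>w i\<bar> \<noteq> \<bar>w j\<bar>" "w i \<noteq> 0" "w j \<noteq> 0"
      using signed_perm_facts(5-7)[OF w] by (auto simp: abs_eq_iff)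
    then have "\<bar>u' i\<bar> \<noteq> \<bar>u' j\<bar>" "u' i \<noteq> 0" "u' j \<noteq> 0" using u'(2) by (metis abs_eq_0)+
    then show ?thesis using ij u'(1)[of i] u'(2)[of i] unfolding P_def f_def u e
      by (auto split: if_splits)
  qed
  have ff: "f (f p) = p" for p
    using signed_perm_facts(3)[OF w] by (auto simp: f_def case_prod_beta)
  have odd: "(?e \<circ> w) (- a) = - (?e \<circ> w) a" for a
    using signed_perm_facts(3)[OF w] by (simp add: e)
  have abs: "\<bar>(?e \<circ> w) a\<bar> = \<bar>w a\<bar>" for a by (simp add: e)
  have "bij_betw f (P (?e \<circ> w)) (P w)"
  proof (rule bij_betw_byWitness[where f' = f])
    show "f ` P (?e \<circ> w) \<subseteq> P w"
      using mapsto[of w "?e \<circ> w"] signed_perm_facts(3)[OF w] by auto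
    show "f ` P w \<subseteq> P (?e \<circ> w)"
      using mapsto[of "?e \<circ> w" w, OF odd abs] by (auto simp: e)
  qed (use ff in auto)
  then have "card (P (?e \<circ> w)) = card (P w)" by (rule bij_betw_same_card)
  then show ?thesis by (simp add: inv_D_def P_def)
qed

text \<open>Left composition with the sign change of the letter 1 exchanges even and odd elements. A
  uniform signed permutation is therefore a uniform even one together with an independent fair coin,
  which the statistic does not see.\<close>

lemma inv_D_law_transfer:
  assumes n: "n \<ge> 1"
  shows "map_pmf (inv_D n) (pmf_of_set (classical_carrier Type_D n)) = map_pmf (inv_D n) (pmf_of_set (signed_permutations n))"
proof -
  let ?e = "signed_transpose 1 (-1)" and ?D = "classical_carrier Type_D n"
  let ?f = "\<lambda>(b, w). if b then ?e \<circ> w else w"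
  have e: "?e \<in> signed_permutations n" using n by (intro signed_transpose_perm) auto
  have ee: "?e \<circ> (?e \<circ> w) = w" for w
    using signed_transpose_involution[of 1 "-1"] by (simp add: comp_assoc[symmetric])
  have se: "sign_product n ?e = -1"
  proof -
    have "{1..int n} = insert 1 {2..int n}" using n by auto
    moreover have "(\<Prod>i\<in>{2..int n}. sgn (?e i)) = 1"
      by (rule prod.neutral) (auto simp: signed_transpose_def)
    ultimately show ?thesis unfolding sign_product_def by (simp add: signed_transpose_def)
  qed
  have sp: "sign_product n w = 1 \<or> sign_product n w = -1" if "w \<in> signed_permutations n" for w
  proof -
    have "\<bar>sign_product n w\<bar> = 1"
      unfolding sign_product_def abs_prod using signed_perm_range(1)[OF that]
      by (intro prod.neutral) (auto simp: abs_sgn_eq)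
    then show ?thesis by linarith
  qed
  have mem: "w \<in> ?D \<longleftrightarrow> w \<in> signed_permutations n \<and> sign_product n w = 1" for w
    unfolding type_D_carrier by simp
  have flip: "?e \<circ> w \<in> signed_permutations n" "sign_product n (?e \<circ> w) = - sign_product n w"
    if "w \<in> signed_permutations n" for w
    using signed_permutations_axioms(3)[OF e that] sign_product_comp[OF e that] se by auto
  have b: "bij_betw ?f (UNIV \<times> ?D) (signed_permutations n)"
  proof (rule bij_betw_byWitness[where f' = "\<lambda>w. if w \<in> ?D then (False, w) else (True, ?e \<circ> w)"])
    show "\<forall>p\<in>UNIV \<times> ?D. (if ?f p \<in> ?D then (False, ?f p) else (True, ?e \<circ> ?f p)) = p"
      using flip ee by (auto simp: mem simp del: classical_carrier.simps)
    show "\<forall>w\<in>signed_permutations n. ?f (if w \<in> ?D then (False, w) else (True, ?e \<circ> w)) = w"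
      using ee by auto
    show "?f ` (UNIV \<times> ?D) \<subseteq> signed_permutations n"
      using flip by (auto simp: mem simp del: classical_carrier.simps)
    show "(\<lambda>w. if w \<in> ?D then (False, w) else (True, ?e \<circ> w)) ` signed_permutations n \<subseteq> UNIV \<times> ?D"
    proof
      fix p assume "p \<in> (\<lambda>w. if w \<in> ?D then (False, w) else (True, ?e \<circ> w)) ` signed_permutations n"
      then obtain w where w: "w \<in> signed_permutations n" "p = (if w \<in> ?D then (False, w) else (True, ?e \<circ> w))"
        by blast
      show "p \<in> UNIV \<times> ?D"
      proof (cases "w \<in> ?D")
        case False
        then have "sign_product n w = -1" using sp[OF w(1)] w(1) by (simp only: mem) auto
        then have "?e \<circ> w \<in> ?D" using flip[OF w(1)] by (simp only: mem) simp
        then show ?thesis using False w by (simp only: if_False) blast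
      qed (use w in \<open>simp only: if_True mem_Times_iff fst_conv snd_conv UNIV_I simp_thms\<close>)
    qed
  qed
  have D: "finite ?D" "?D \<noteq> {}"
    using weyl_group_finite_nonempty[of Type_D n] by (simp_all add: weyl_group_def del: classical_carrier.simps)
  have "map_pmf (inv_D n) (pmf_of_set (signed_permutations n)) =
      map_pmf (inv_D n) (map_pmf ?f (pmf_of_set (UNIV \<times> ?D)))"
    using map_pmf_of_set_bij_betw[OF b] D by simp
  also have "\<dots> = map_pmf (\<lambda>p. inv_D n (snd p)) (pmf_of_set ((UNIV :: bool set) \<times> ?D))"
    unfolding pmf.map_comp
  proof (rule map_pmf_cong[OF refl])
    fix p assume "p \<in> set_pmf (pmf_of_set ((UNIV :: bool set) \<times> ?D))"
    then have "p \<in> UNIV \<times> ?D" using D by (subst (asm) set_pmf_of_set) auto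
    then have "snd p \<in> signed_permutations n" using mem by (auto simp del: classical_carrier.simps)
    then show "(inv_D n \<circ> ?f) p = inv_D n (snd p)"
      using inv_D_sign_flip by (cases p; cases "fst p") simp_all
  qed
  also have "\<dots> = map_pmf (inv_D n) (map_pmf snd (pair_pmf (pmf_of_set (UNIV :: bool set)) (pmf_of_set ?D)))"
    using D by (subst pmf_of_set_Times) (auto simp: pmf.map_comp comp_def)
  finally show ?thesis by (simp add: map_snd_pair_pmf)
qed

text \<open>A pair - j, j is out of order exactly when w j is negative.\<close>

lemma inv_B_eq: "w \<in> signed_permutations n \<Longrightarrow> inv_B n w = inv_D n w + negatives n w"
proof -
  assume w: "w \<in> signed_permutations n"
  let ?P = "{(i, j). - j < i \<and> i < j \<and> i \<noteq> 0 \<and> j \<le> int n \<and> w j < w i}"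
  let ?Q = "(\<lambda>j. (- j, j)) ` {j \<in> {1..int n}. w j < 0}"
  have "{(i, j). - j \<le> i \<and> i < j \<and> i \<noteq> 0 \<and> j \<le> int n \<and> w j < w i} = ?P \<union> ?Q"
    using signed_perm_facts(3)[OF w] by (auto simp: image_iff le_less)
  moreover have "finite ?P"
    by (rule finite_subset[of _ "{- int n..int n} \<times> {- int n..int n}"]) auto
  moreover have "card ?Q = negatives n w" unfolding negatives_def by (rule card_image) (auto simp: inj_on_def)
  moreover have "finite ?Q" by (rule finite_imageI, rule finite_subset[of _ "{1..int n}"]) auto
  moreover have "?P \<inter> ?Q = {}" by auto
  ultimately show "inv_B n w = inv_D n w + negatives n w"
    unfolding inv_B_def inv_D_def by (simp only: card_Un_disjoint)
qed

text \<open>Brings the three types to a common form. The representation is exact, so the constant c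
  is the mean and no approximation of the moments is needed for inversions.\<close>

lemma inv_statistic_law:
  assumes n: "n \<ge> 3"
  shows "\<exists>ps c. map_pmf (\<lambda>w. real (coxeter_inv (W \<tau> n) (gens \<tau> n) w)) (pmf_of_set (carrier (W \<tau> n))) =
      map_pmf (\<lambda>x. x + c) (sum_pmf ps) \<and> (\<forall>p\<in>set ps. symmetric_pmf (real n) p) \<and> length ps = n \<and>
      real n * (real n)\<^sup>2 \<le> 36 * (\<Sum>p\<leftarrow>ps. second_moment p)"
proof -
  have concl: ?thesis
    if law: "map_pmf (\<lambda>w. real (coxeter_inv (W \<tau> n) (gens \<tau> n) w)) (pmf_of_set (carrier (W \<tau> n))) =
        map_pmf (\<lambda>x. x + c) (sum_pmf (map p (rev [1..<Suc n])))"
      and p: "\<And>j. j \<ge> 1 \<Longrightarrow> symmetric_pmf (real j) (p j)" "\<And>j. j \<ge> 1 \<Longrightarrow> second_moment (p j) \<ge> ((real j)\<^sup>2 - 1) / 12"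
    for p :: "nat \<Rightarrow> real pmf" and c
  proof (intro exI conjI)
    show "\<forall>q\<in>set (map p (rev [1..<Suc n])). symmetric_pmf (real n) q"
    proof
      fix q assume "q \<in> set (map p (rev [1..<Suc n]))"
      then obtain j where j: "1 \<le> j" "j \<le> n" "q = p j" by auto
      then show "symmetric_pmf (real n) q" using symmetric_pmf_mono[OF p(1)[OF j(1)], of "real n"] by simp
    qed
    show "real n * (real n)\<^sup>2 \<le> 36 * (\<Sum>q\<leftarrow>map p (rev [1..<Suc n]). second_moment q)"
      by (rule step_list_variance[OF p(2)]) (use n in auto)
  qed (use law in auto)
  have carrier: "carrier (W \<tau> n) = classical_carrier \<tau> n" by (simp add: weyl_group_def)
  have SP: "finite (signed_permutations n)" "signed_permutations n \<noteq> {}"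
    using signed_permutations_axioms(1,2)[of n] by auto
  show ?thesis
  proof (cases \<tau>)
    case Type_A
    have "map_pmf (\<lambda>w. real (coxeter_inv (W \<tau> n) (gens \<tau> n) w)) (pmf_of_set (carrier (W \<tau> n))) =
        map_pmf (\<lambda>w. real (inv_A n w)) (pmf_of_set {p. p permutes {1..int n}})"
      unfolding carrier unfolding Type_A classical_carrier.simps
    proof (rule map_pmf_cong[OF refl])
      fix w assume "w \<in> set_pmf (pmf_of_set {p. p permutes {1..int n}})"
      then have "w permutes {1..int n}" using permutes_id[of "{1..int n}"]
        by (subst (asm) set_pmf_of_set) (auto simp: finite_permutations intro!: exI[of _ id])
      then show "real (coxeter_inv (W Type_A n) (gens Type_A n) w) = real (inv_A n w)"
        unfolding inv_A_def by (simp only: coxeter_inv_A)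
    qed
    also note inv_A_law
    finally show ?thesis by (rule concl) (use step_A in auto)
  next
    case Type_B
    have "map_pmf (\<lambda>w. real (coxeter_inv (W \<tau> n) (gens \<tau> n) w)) (pmf_of_set (carrier (W \<tau> n))) =
        map_pmf (\<lambda>w. real (inv_D n w) + (2 - 2 * (1 / 2)) * real (negatives n w)) (pmf_of_set (signed_permutations n))"
      unfolding carrier unfolding Type_B classical_carrier.simps
      by (rule map_pmf_cong[OF refl]) (use SP n coxeter_inv_B inv_B_eq in auto)
    also note signed_inv_law[where g = "\<lambda>n w. real (inv_D n w) + (2 - 2 * (1 / 2)) * real (negatives n w)", OF refl]
    finally show ?thesis by (rule concl) (use step_B[of _ "1 / 2"] in auto)
  next
    case Type_D
    have "map_pmf (\<lambda>w. real (coxeter_inv (W \<tau> n) (gens \<tau> n) w)) (pmf_of_set (carrier (W \<tau> n))) =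
        map_pmf (\<lambda>w. real (inv_D n w)) (pmf_of_set (carrier (W \<tau> n)))"
    proof (rule map_pmf_cong[OF refl])
      fix w assume "w \<in> set_pmf (pmf_of_set (carrier (W \<tau> n)))"
      then have "w \<in> carrier (W \<tau> n)"
        using weyl_group_finite_nonempty[of \<tau> n] by simp
      then have "w \<in> classical_carrier Type_D n" unfolding carrier unfolding Type_D .
      then show "real (coxeter_inv (W \<tau> n) (gens \<tau> n) w) = real (inv_D n w)"
        unfolding Type_D by (simp only: coxeter_inv_D n)
    qed
    also have "\<dots> = map_pmf real (map_pmf (inv_D n) (pmf_of_set (signed_permutations n)))"
    proof -
      have "carrier (W \<tau> n) = classical_carrier Type_D n" unfolding carrier unfolding Type_D ..
      then have "map_pmf real (map_pmf (inv_D n) (pmf_of_set (signed_permutations n))) =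
          map_pmf real (map_pmf (inv_D n) (pmf_of_set (carrier (W \<tau> n))))"
        using inv_D_law_transfer[of n] n by simp
      then show ?thesis by (simp add: pmf.map_comp comp_def)
    qed
    also have "\<dots> = map_pmf (\<lambda>w. real (inv_D n w) + (2 - 2 * 1) * real (negatives n w)) (pmf_of_set (signed_permutations n))"
      by (simp add: pmf.map_comp comp_def)
    also note signed_inv_law[where g = "\<lambda>n w. real (inv_D n w) + (2 - 2 * 1) * real (negatives n w)", OF refl]
    finally show ?thesis by (rule concl) (use step_B[of _ 1] in auto)
  qed
qed

section \<open>Descents as rounded sums of uniform variables\<close>

lemma standardization:
  fixes f :: "int \<Rightarrow> int"
  assumes inj: "inj_on f {1..int n}"
  obtains \<sigma> where "\<sigma> permutes {1..int n}"
    "\<And>i j. i \<in> {1..int n} \<Longrightarrow> j \<in> {1..int n} \<Longrightarrow> f i < f j \<longleftrightarrow> \<sigma> i < \<sigma> j"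
proof -
  define R where "R i = {k \<in> {1..int n}. f k \<le> f i}" for i
  define \<sigma> where "\<sigma> i = (if i \<in> {1..int n} then int (card (R i)) else i)" for i
  have fin: "finite (R i)" for i by (rule finite_subset[of _ "{1..int n}"]) (auto simp: R_def)
  have less: "\<sigma> i < \<sigma> j" if "i \<in> {1..int n}" "j \<in> {1..int n}" "f i < f j" for i j
  proof -
    have "R i \<subseteq> R j" "j \<in> R j" "j \<notin> R i" using that by (auto simp: R_def)
    then have "R i \<subset> R j" by blast
    then have "card (R i) < card (R j)" by (rule psubset_card_mono[OF fin])
    then show ?thesis using that by (simp add: \<sigma>_def)
  qed
  have iff: "f i < f j \<longleftrightarrow> \<sigma> i < \<sigma> j" if ij: "i \<in> {1..int n}" "j \<in> {1..int n}" for i j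
  proof
    assume "\<sigma> i < \<sigma> j"
    then have "i \<noteq> j" "\<not> \<sigma> j < \<sigma> i" by auto
    then have "f i \<noteq> f j" "\<not> f j < f i" using less[OF ij(2,1)] inj_onD[OF inj _ ij] by auto
    then show "f i < f j" by simp
  qed (rule less[OF ij])
  have "inj_on \<sigma> {1..int n}"
  proof (rule inj_onI)
    fix i j assume ij: "i \<in> {1..int n}" "j \<in> {1..int n}" "\<sigma> i = \<sigma> j"
    then have "\<not> f i < f j" "\<not> f j < f i" using iff by auto
    then show "i = j" using inj_onD[OF inj _ ij(1,2)] by simp
  qed
  moreover have "\<sigma> ` {1..int n} \<subseteq> {1..int n}"
  proof
    fix x assume "x \<in> \<sigma> ` {1..int n}"
    then obtain i where i: "i \<in> {1..int n}" "x = int (card (R i))" by (auto simp: \<sigma>_def)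
    have "i \<in> R i" using i by (simp add: R_def)
    then have "card (R i) \<ge> 1" using fin by (metis One_nat_def Suc_leI card_gt_0_iff empty_iff)
    moreover have "card (R i) \<le> card {1..int n}" by (rule card_mono) (auto simp: R_def)
    ultimately show "x \<in> {1..int n}" using i by simp
  qed
  ultimately have "bij_betw \<sigma> {1..int n} {1..int n}" by (simp add: bij_betw_def endo_inj_surj)
  then have "\<sigma> permutes {1..int n}" by (rule bij_imp_permutes) (auto simp: \<sigma>_def)
  then show ?thesis using iff by (rule that)
qed

abbreviation "perms n \<equiv> {p. p permutes {1..int n}}"

lemma perms_finite_nonempty: "finite (perms n)" "perms n \<noteq> {}"
  using permutes_id[of "{1..int n}"] by (auto simp: finite_permutations intro!: exI[of _ id])

lemma descents_cong:
  "(\<And>i. i \<in> {1..int n} \<Longrightarrow> f i = g i) \<Longrightarrow> descents n f = descents n g"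
  unfolding descents_def by (intro arg_cong[where f = card] Collect_cong) auto

text \<open>Averaging over the action on positions replaces every word by its standardization.\<close>

lemma exchangeable_descents_law:
  fixes word :: "'b \<Rightarrow> int \<Rightarrow> int" and act :: "(int \<Rightarrow> int) \<Rightarrow> 'b \<Rightarrow> 'b"
  assumes X: "finite X" "X \<noteq> {}"
    and inj: "\<And>x. x \<in> X \<Longrightarrow> inj_on (word x) {1..int n}"
    and act: "\<And>\<pi>. \<pi> permutes {1..int n} \<Longrightarrow> bij_betw (act \<pi>) X X"
    and word: "\<And>\<pi> x i. \<pi> permutes {1..int n} \<Longrightarrow> x \<in> X \<Longrightarrow> i \<in> {1..int n} \<Longrightarrow> word (act \<pi> x) i = word x (\<pi> i)"
  shows "map_pmf (\<lambda>x. descents n (word x)) (pmf_of_set X) = map_pmf (descents n) (pmf_of_set (perms n))"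
proof -
  note perms = perms_finite_nonempty[of n]
  let ?d = "\<lambda>x. descents n (word x)"
  have "map_pmf ?d (pmf_of_set X) = bind_pmf (pmf_of_set (perms n)) (\<lambda>\<pi>. map_pmf ?d (pmf_of_set X))"
    by (simp add: bind_pmf_const)
  also have "\<dots> = bind_pmf (pmf_of_set (perms n)) (\<lambda>\<pi>. bind_pmf (pmf_of_set X) (\<lambda>x. return_pmf (descents n (word x \<circ> \<pi>))))"
  proof (rule bind_pmf_cong[OF refl])
    fix \<pi> assume "\<pi> \<in> set_pmf (pmf_of_set (perms n))"
    then have \<pi>: "\<pi> permutes {1..int n}" using perms by (subst (asm) set_pmf_of_set) auto
    have "map_pmf ?d (pmf_of_set X) = map_pmf ?d (map_pmf (act \<pi>) (pmf_of_set X))"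
      using map_pmf_of_set_bij_betw[OF act[OF \<pi>]] X by simp
    also have "\<dots> = map_pmf (\<lambda>x. descents n (word (act \<pi> x))) (pmf_of_set X)"
      by (simp add: pmf.map_comp comp_def)
    also have "\<dots> = map_pmf (\<lambda>x. descents n (word x \<circ> \<pi>)) (pmf_of_set X)"
    proof (rule map_pmf_cong[OF refl])
      fix x assume "x \<in> set_pmf (pmf_of_set X)"
      then have "x \<in> X" using X by simp
      then show "descents n (word (act \<pi> x)) = descents n (word x \<circ> \<pi>)"
        by (intro descents_cong) (simp add: word[OF \<pi>])
    qed
    finally show "map_pmf ?d (pmf_of_set X) = bind_pmf (pmf_of_set X) (\<lambda>x. return_pmf (descents n (word x \<circ> \<pi>)))"
      by (simp add: map_pmf_def)
  qed
  also have "\<dots> = bind_pmf (pmf_of_set X) (\<lambda>x. bind_pmf (pmf_of_set (perms n)) (\<lambda>\<pi>. return_pmf (descents n (word x \<circ> \<pi>))))"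
    by (rule bind_commute_pmf)
  \<comment> \<open>For a fixed word, only its standardization \<sigma> matters for the descents,
    and \<sigma> \<circ> \<pi> is again uniform when \<pi> is. The inner law therefore no longer
    depends on the word.\<close>
  also have "\<dots> = bind_pmf (pmf_of_set X) (\<lambda>x. map_pmf (descents n) (pmf_of_set (perms n)))"
  proof (rule bind_pmf_cong[OF refl])
    fix x assume "x \<in> set_pmf (pmf_of_set X)"
    then have "x \<in> X" using X by simp
    then obtain \<sigma> where \<sigma>: "\<sigma> permutes {1..int n}"
      "\<And>i j. i \<in> {1..int n} \<Longrightarrow> j \<in> {1..int n} \<Longrightarrow> word x i < word x j \<longleftrightarrow> \<sigma> i < \<sigma> j"
      using standardization[OF inj] by metis
    have "map_pmf (\<lambda>\<pi>. descents n (word x \<circ> \<pi>)) (pmf_of_set (perms n)) =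
        map_pmf (\<lambda>\<pi>. descents n (\<sigma> \<circ> \<pi>)) (pmf_of_set (perms n))"
    proof (rule map_pmf_cong[OF refl])
      fix \<pi> assume "\<pi> \<in> set_pmf (pmf_of_set (perms n))"
      then have \<pi>: "\<pi> permutes {1..int n}" using perms by (subst (asm) set_pmf_of_set) auto
      have "word x (\<pi> (i + 1)) < word x (\<pi> i) \<longleftrightarrow> \<sigma> (\<pi> (i + 1)) < \<sigma> (\<pi> i)" if "i \<in> {1..<int n}" for i
        using permutes_in_image[OF \<pi>, of i] permutes_in_image[OF \<pi>, of "i + 1"] that by (intro \<sigma>(2)) auto
      then show "descents n (word x \<circ> \<pi>) = descents n (\<sigma> \<circ> \<pi>)"
        unfolding descents_def comp_apply by (intro arg_cong[where f = card] Collect_cong) blast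
    qed
    also have "\<dots> = map_pmf (descents n) (map_pmf (\<lambda>\<pi>. \<sigma> \<circ> \<pi>) (pmf_of_set (perms n)))"
      by (simp add: pmf.map_comp comp_def)
    also have "map_pmf (\<lambda>\<pi>. \<sigma> \<circ> \<pi>) (pmf_of_set (perms n)) = pmf_of_set (perms n)"
    proof (rule map_pmf_of_set_bij_betw)
      show "bij_betw (\<lambda>\<pi>. \<sigma> \<circ> \<pi>) (perms n) (perms n)"
        by (rule bij_betw_byWitness[where f' = "\<lambda>\<pi>. inv_into UNIV \<sigma> \<circ> \<pi>"])
          (use \<sigma>(1) permutes_inv[OF \<sigma>(1)] in
            \<open>auto simp: permutes_compose comp_assoc[symmetric] permutes_inv_o\<close>)
    qed (use perms in auto)
    finally show "bind_pmf (pmf_of_set (perms n)) (\<lambda>\<pi>. return_pmf (descents n (word x \<circ> \<pi>))) =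
        map_pmf (descents n) (pmf_of_set (perms n))"
      by (simp add: map_pmf_def comp_def)
  qed
  finally show ?thesis by (simp add: bind_pmf_const)
qed

text \<open>Positions are permuted by right composition with \<open>ext \<pi>\<close>, the odd
  extension of \<pi>. It changes no signs, so it lies in type D as well as in type B.\<close>

lemma weyl_descents_law:
  "map_pmf (descents n) (pmf_of_set (classical_carrier \<tau> n)) = map_pmf (descents n) (pmf_of_set (perms n))"
proof (cases "\<tau> = Type_A")
  case False
  let ?C = "classical_carrier \<tau> n"
  have fin: "finite ?C" "?C \<noteq> {}"
    using weyl_group_finite_nonempty[of \<tau> n] by (simp_all add: weyl_group_def)
  have closed: "u \<circ> v \<in> ?C" if "u \<in> ?C" "v \<in> ?C" for u v
    using that False signed_permutations_axioms(3) type_D_axioms(2)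
    by (cases \<tau>) (auto simp del: classical_carrier.simps(3))
  have SP: "?C \<subseteq> signed_permutations n" using False by (cases \<tau>) auto
  define ext where "ext \<pi> = (\<lambda>a. if a < 0 then - \<pi> (- a) else \<pi> a)" for \<pi> :: "int \<Rightarrow> int"
  have ext: "ext \<pi> \<in> ?C" if \<pi>: "\<pi> permutes {1..int n}" for \<pi>
  proof -
    have range: "\<pi> a \<in> {1..int n} \<longleftrightarrow> a \<in> {1..int n}" for a by (rule permutes_in_image[OF \<pi>])
    have out: "\<pi> a = a" if "a \<notin> {1..int n}" for a using permutes_not_in[OF \<pi> that] .
    have inj: "\<pi> a = \<pi> b \<longleftrightarrow> a = b" for a b using permutes_inj[OF \<pi>] by (simp add: inj_eq)
    have pos: "\<pi> a > 0" if "a > 0" for a using range[of a] out[of a] that by (cases "a \<le> int n") auto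
    have "inj_on (ext \<pi>) (symmetric_ints n)"
    proof (rule inj_onI)
      fix a b assume "a \<in> symmetric_ints n" "b \<in> symmetric_ints n" "ext \<pi> a = ext \<pi> b"
      then show "a = b"
        using pos[of a] pos[of b] pos[of "- a"] pos[of "- b"] inj[of a b] inj[of "- a" "- b"]
        by (auto simp: ext_def split: if_splits)
    qed
    moreover have "ext \<pi> ` symmetric_ints n \<subseteq> symmetric_ints n"
    proof
      fix x assume "x \<in> ext \<pi> ` symmetric_ints n"
      then obtain a where "a \<in> symmetric_ints n" "x = ext \<pi> a" by blast
      then show "x \<in> symmetric_ints n" using range[of a] range[of "- a"] by (auto simp: ext_def)
    qed
    ultimately have "bij_betw (ext \<pi>) (symmetric_ints n) (symmetric_ints n)"
      by (simp add: bij_betw_def endo_inj_surj)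
    then have "ext \<pi> permutes symmetric_ints n"
      by (rule bij_imp_permutes) (use out in \<open>auto simp: ext_def\<close>)
    moreover have "ext \<pi> (- a) = - ext \<pi> a" for a using out[of 0] by (auto simp: ext_def)
    ultimately have sp: "ext \<pi> \<in> signed_permutations n" by (simp add: signed_permutations_def)
    moreover have "sign_product n (ext \<pi>) = 1"
      unfolding sign_product_def by (rule prod.neutral) (use pos in \<open>auto simp: ext_def\<close>)
    ultimately show ?thesis using False type_D_carrier[of n] by (cases \<tau>) (auto simp del: classical_carrier.simps(3))
  qed
  show ?thesis
  proof (rule exchangeable_descents_law[where word = "\<lambda>w. w" and act = "\<lambda>\<pi> w. w \<circ> ext \<pi>", OF fin])
    fix w assume w: "w \<in> ?C"
    show "inj_on w {1..int n}" using signed_perm_facts(5)[of w n] w SP by (auto intro: inj_onI)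
  next
    fix \<pi> :: "int \<Rightarrow> int" and w i assume "\<pi> permutes {1..int n}" "w \<in> ?C" "i \<in> {1..int n}"
    then show "(w \<circ> ext \<pi>) i = w (\<pi> i)" by (simp add: ext_def)
  next
    fix \<pi> assume \<pi>: "\<pi> permutes {1..int n}"
    have "surj (ext \<pi>)" using signed_perm_facts(2)[of "ext \<pi>" n] ext[OF \<pi>] SP by (auto simp: bij_def)
    have "inj_on (\<lambda>w. w \<circ> ext \<pi>) ?C"
    proof (rule inj_onI, rule HOL.ext)
      fix u v a assume "u \<circ> ext \<pi> = v \<circ> ext \<pi>"
      moreover obtain b where "a = ext \<pi> b" using \<open>surj (ext \<pi>)\<close> by (metis surjD)
      ultimately show "u a = v a" by (metis comp_apply)
    qed
    moreover have "(\<lambda>w. w \<circ> ext \<pi>) ` ?C \<subseteq> ?C" using closed ext[OF \<pi>] by blast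
    ultimately show "bij_betw (\<lambda>w. w \<circ> ext \<pi>) ?C ?C"
      using endo_inj_surj[OF fin(1)] by (simp add: bij_betw_def)
  qed
qed simp

section \<open>Carries of sums modulo q\<close>

primrec partial_sums :: "nat \<Rightarrow> nat \<Rightarrow> nat list \<Rightarrow> nat list" where
  "partial_sums q a [] = []"
| "partial_sums q a (x # xs) = (a + x) mod q # partial_sums q ((a + x) mod q) xs"

primrec drops :: "nat \<Rightarrow> nat list \<Rightarrow> nat" where
  "drops a [] = 0"
| "drops a (x # xs) = (if x < a then 1 else 0) + drops x xs"

lemma drops_partial_sums:
  "a < q \<Longrightarrow> set xs \<subseteq> {..<q} \<Longrightarrow> drops a (partial_sums q a xs) = (a + sum_list xs) div q"
proof (induction xs arbitrary: a)
  case (Cons x xs)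
  define b where "b = (a + x) mod q"
  have x: "x < q" and b: "b < q" using Cons.prems by (auto simp: b_def)
  have IH: "drops b (partial_sums q b xs) = (b + sum_list xs) div q"
    by (rule Cons.IH[OF b]) (use Cons.prems in auto)
  show ?case
  proof (cases "a + x < q")
    case True
    then have "b = a + x" by (simp add: b_def)
    then show ?thesis using IH by (simp add: b_def[symmetric] add.assoc)
  next
    case False
    moreover have "a + x - q < q" using x Cons.prems(1) by linarith
    ultimately have eq: "a + x = b + q" by (simp add: b_def le_mod_geq)
    then have "b < a" using x by simp
    moreover have "(a + (x + sum_list xs)) div q = Suc ((b + sum_list xs) div q)"
    proof -
      have "a + (x + sum_list xs) = (b + sum_list xs) + q" using eq by simp
      moreover have "((b + sum_list xs) + q) div q = Suc ((b + sum_list xs) div q)" using b by simp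
      ultimately show ?thesis by (simp only:)
    qed
    ultimately show ?thesis using IH by (simp add: b_def[symmetric])
  qed
qed simp

lemma shift_uniform_mod:
  assumes "q > 0"
  shows "map_pmf (\<lambda>x. (a + x) mod q) (pmf_of_set {..<q}) = pmf_of_set {..<q :: nat}"
proof (rule map_pmf_of_set_bij_betw)
  have "inj_on (\<lambda>x. (a + x) mod q) {..<q}"
  proof (rule inj_onI)
    fix x y assume xy: "x \<in> {..<q}" "y \<in> {..<q}" "(a + x) mod q = (a + y) mod q"
    then have "[a + x = a + y] (mod q)" by (simp add: cong_def)
    then have "[x = y] (mod q)" by (simp add: cong_add_lcancel_nat)
    then show "x = y" using xy by (simp add: cong_def)
  qed
  moreover have "(\<lambda>x. (a + x) mod q) ` {..<q} \<subseteq> {..<q}" using assms by auto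
  ultimately show "bij_betw (\<lambda>x. (a + x) mod q) {..<q} {..<q}"
    by (simp add: bij_betw_def endo_inj_surj)
qed (use assms in auto)

text \<open>Translation by a fixed residue preserves the uniform law. Conditionally on the past each
  new residue is uniform, so the residues are again independent uniform letters.\<close>

lemma partial_sums_law:
  assumes "q > 0"
  shows "map_pmf (partial_sums q a) (replicate_pmf n (pmf_of_set {..<q})) = replicate_pmf n (pmf_of_set {..<q})"
proof (induction n arbitrary: a)
  case (Suc n)
  let ?U = "pmf_of_set {..<q}" and ?R = "replicate_pmf n (pmf_of_set {..<q})"
  have "map_pmf (partial_sums q a) (replicate_pmf (Suc n) ?U) =
      bind_pmf ?U (\<lambda>x. map_pmf ((#) ((a + x) mod q)) (map_pmf (partial_sums q ((a + x) mod q)) ?R))"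
    by (simp add: map_bind_pmf pmf.map_comp comp_def map_pmf_def[symmetric])
  also have "\<dots> = bind_pmf (map_pmf (\<lambda>x. (a + x) mod q) ?U) (\<lambda>x. map_pmf ((#) x) ?R)"
    unfolding Suc.IH by (simp add: bind_map_pmf)
  also have "\<dots> = replicate_pmf (Suc n) ?U"
    unfolding shift_uniform_mod[OF assms] by (simp add: map_pmf_def)
  finally show ?case .
qed simp

lemma drops_law:
  assumes "q > 0"
  shows "map_pmf (drops 0) (replicate_pmf n (pmf_of_set {..<q})) =
    map_pmf (\<lambda>xs. sum_list xs div q) (replicate_pmf n (pmf_of_set {..<q}))"
proof -
  have "map_pmf (drops 0) (replicate_pmf n (pmf_of_set {..<q})) =
      map_pmf (drops 0) (map_pmf (partial_sums q 0) (replicate_pmf n (pmf_of_set {..<q})))"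
    by (simp only: partial_sums_law[OF assms])
  also have "\<dots> = map_pmf (\<lambda>xs. sum_list xs div q) (replicate_pmf n (pmf_of_set {..<q}))"
    unfolding pmf.map_comp
  proof (rule map_pmf_cong[OF refl])
    fix xs assume "xs \<in> set_pmf (replicate_pmf n (pmf_of_set {..<q}))"
    moreover have "set_pmf (pmf_of_set {..<q}) = {..<q}" using assms by (intro set_pmf_of_set) auto
    ultimately have "set xs \<subseteq> {..<q}" by (auto simp: set_replicate_pmf)
    then show "(drops 0 \<circ> partial_sums q 0) xs = sum_list xs div q"
      using drops_partial_sums[of 0 q xs] assms by simp
  qed
  finally show ?thesis .
qed

section \<open>Words with and without repeated letters\<close>

lemma replicate_pmf_of_set:
  assumes "finite A" "A \<noteq> {}"
  shows "replicate_pmf n (pmf_of_set A) = pmf_of_set {xs. set xs \<subseteq> A \<and> length xs = n}"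
proof (induction n)
  case 0
  have "{xs. set xs \<subseteq> A \<and> length xs = 0} = {[]}" by auto
  then show ?case by (simp add: pmf_of_set_singleton)
next
  case (Suc n)
  let ?L = "\<lambda>n. {xs. set xs \<subseteq> A \<and> length xs = n}"
  have L: "finite (?L m)" "?L m \<noteq> {}" for m
  proof -
    show "finite (?L m)" using assms(1) by (rule finite_lists_length_eq)
    obtain a where "a \<in> A" using assms(2) by blast
    then have "replicate m a \<in> ?L m" by auto
    then show "?L m \<noteq> {}" by blast
  qed
  have b: "bij_betw (\<lambda>(x, xs). x # xs) (A \<times> ?L n) (?L (Suc n))"
    by (rule bij_betw_byWitness[where f' = "\<lambda>xs. (hd xs, tl xs)"]) (auto simp: length_Suc_conv)
  have "replicate_pmf (Suc n) (pmf_of_set A) = map_pmf (\<lambda>(x, xs). x # xs) (pair_pmf (pmf_of_set A) (pmf_of_set (?L n)))"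
    by (simp add: Suc.IH pair_pmf_def map_bind_pmf)
  also have "\<dots> = map_pmf (\<lambda>(x, xs). x # xs) (pmf_of_set (A \<times> ?L n))"
    using pmf_of_set_Times[OF assms L] by simp
  also have "\<dots> = pmf_of_set (?L (Suc n))"
    by (rule map_pmf_of_set_bij_betw[OF b]) (use assms L[of n] in auto)
  finally show ?case .
qed

definition list_word :: "nat list \<Rightarrow> int \<Rightarrow> int" where
  "list_word xs i = int (xs ! (nat i - 1))"

lemma drops_eq_card: "drops a xs = (if xs \<noteq> [] \<and> hd xs < a then 1 else 0) + card {k. Suc k < length xs \<and> xs ! Suc k < xs ! k}"
proof (induction xs arbitrary: a)
  case (Cons x xs)
  let ?A = "{k. Suc k < length xs \<and> xs ! Suc k < xs ! k}"
  have "{k. Suc k < length (x # xs) \<and> (x # xs) ! Suc k < (x # xs) ! k} =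
      (if xs \<noteq> [] \<and> hd xs < x then {0} else {}) \<union> Suc ` ?A" (is "?L = ?R")
  proof (intro equalityI subsetI)
    fix k assume "k \<in> ?L"
    then show "k \<in> ?R" by (cases k) (auto simp: hd_conv_nth)
  next
    fix k assume "k \<in> ?R"
    then show "k \<in> ?L" by (auto simp: hd_conv_nth split: if_splits)
  qed
  moreover have "finite (Suc ` ?A)" by (rule finite_subset[of _ "{..length xs}"]) auto
  ultimately have "card {k. Suc k < length (x # xs) \<and> (x # xs) ! Suc k < (x # xs) ! k} =
      (if xs \<noteq> [] \<and> hd xs < x then 1 else 0) + card ?A"
    by (auto simp: card_insert_if card_image)
  then show ?case using Cons.IH[of x] by simp
qed simp

text \<open>No letter lies below the starting value 0, so only drops between letters count. List
  index k corresponds to window position k + 1.\<close>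

lemma drops_eq_descents: "drops 0 xs = descents (length xs) (list_word xs)"
proof -
  have "bij_betw (\<lambda>k. int k + 1) {k. Suc k < length xs \<and> xs ! Suc k < xs ! k}
      {i \<in> {1..<int (length xs)}. list_word xs (i + 1) < list_word xs i}"
  proof (rule bij_betw_byWitness[where f' = "\<lambda>i. nat i - 1"])
    show "(\<lambda>k. int k + 1) ` {k. Suc k < length xs \<and> xs ! Suc k < xs ! k}
        \<subseteq> {i \<in> {1..<int (length xs)}. list_word xs (i + 1) < list_word xs i}"
      by (auto simp: list_word_def nat_add_distrib)
    show "(\<lambda>i. nat i - 1) ` {i \<in> {1..<int (length xs)}. list_word xs (i + 1) < list_word xs i}
        \<subseteq> {k. Suc k < length xs \<and> xs ! Suc k < xs ! k}"
      by (auto simp: list_word_def nat_add_distrib Suc_diff_le)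
  qed auto
  from bij_betw_same_card[OF this] show ?thesis by (simp add: drops_eq_card descents_def)
qed

abbreviation "words q n \<equiv> {xs. set xs \<subseteq> {..<q :: nat} \<and> length xs = n}"

abbreviation "injective_words q n \<equiv> {xs. set xs \<subseteq> {..<q :: nat} \<and> length xs = n \<and> distinct xs}"

text \<open>Words without repetition are stable under rearrangement of positions, so
  \<open>exchangeable_descents_law\<close> applies. The action \<open>act\<close> is composition
  with \<pi>, translated from positions starting at 1 to list indices starting at 0.\<close>

lemma injective_words_law:
  assumes "n \<le> q"
  shows "map_pmf (drops 0) (pmf_of_set (injective_words q n)) = map_pmf (descents n) (pmf_of_set (perms n))"
proof -
  let ?E = "injective_words q n"
  have fin: "finite ?E"
    by (rule finite_subset[OF _ finite_lists_length_eq[of "{..<q}" n]]) auto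
  have "[0..<n] \<in> ?E" using assms by auto
  then have ne: "?E \<noteq> {}" by blast
  define act where "act \<pi> xs = map (\<lambda>k. xs ! (nat (\<pi> (int k + 1)) - 1)) [0..<n]" for \<pi> :: "int \<Rightarrow> int" and xs :: "nat list"
  have "map_pmf (drops 0) (pmf_of_set ?E) = map_pmf (\<lambda>xs. descents n (list_word xs)) (pmf_of_set ?E)"
    by (rule map_pmf_cong[OF refl]) (use fin ne in \<open>auto simp: drops_eq_descents\<close>)
  also have "\<dots> = map_pmf (descents n) (pmf_of_set (perms n))"
  proof (rule exchangeable_descents_law[OF fin ne])
    fix xs assume xs: "xs \<in> ?E"
    show "inj_on (list_word xs) {1..int n}"
    proof (rule inj_onI)
      fix i j assume "i \<in> {1..int n}" "j \<in> {1..int n}" "list_word xs i = list_word xs j"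
      then have "nat i - 1 = nat j - 1"
        using xs nth_eq_iff_index_eq[of xs "nat i - 1" "nat j - 1"] by (auto simp: list_word_def)
      then show "i = j" using \<open>i \<in> {1..int n}\<close> \<open>j \<in> {1..int n}\<close> by auto
    qed
  next
    fix \<pi> :: "int \<Rightarrow> int" and xs i assume "\<pi> permutes {1..int n}" "xs \<in> ?E" and i: "i \<in> {1..int n}"
    have "nat i - 1 < n" "int (nat i - 1) + 1 = i" using i by auto
    then show "list_word (act \<pi> xs) i = list_word xs (\<pi> i)" by (simp add: list_word_def act_def)
  next
    fix \<pi> assume \<pi>: "\<pi> permutes {1..int n}"
    define p where "p k = nat (\<pi> (int k + 1)) - 1" for k
    have \<pi>r: "1 \<le> \<pi> (int k + 1) \<and> \<pi> (int k + 1) \<le> int n" if "k < n" for k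
      using permutes_in_image[OF \<pi>, of "int k + 1"] that by auto
    have p: "p k < n" if "k < n" for k using \<pi>r[OF that] by (auto simp: p_def)
    have pinj: "inj_on p {..<n}"
    proof (rule inj_onI)
      fix k l assume kl: "k \<in> {..<n}" "l \<in> {..<n}" "p k = p l"
      then have "\<pi> (int k + 1) = \<pi> (int l + 1)" using \<pi>r[of k] \<pi>r[of l] by (auto simp: p_def)
      then show "k = l" using permutes_inj[OF \<pi>] by (auto simp: inj_eq)
    qed
    have "p ` {..<n} \<subseteq> {..<n}" using p by auto
    then have psurj: "p ` {..<n} = {..<n}" using pinj by (simp add: endo_inj_surj)
    have act_nth: "act \<pi> xs ! k = xs ! p k" "length (act \<pi> xs) = n" if "k < n" for xs k
      using that by (auto simp: act_def p_def)
    have act_eq: "act \<pi> xs = map (\<lambda>k. xs ! p k) [0..<n]" for xs by (simp add: act_def p_def)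
    have "inj_on (act \<pi>) ?E"
    proof (rule inj_onI)
      fix xs ys assume xs: "xs \<in> ?E" and ys: "ys \<in> ?E" and eq: "act \<pi> xs = act \<pi> ys"
      show "xs = ys"
      proof (rule nth_equalityI)
        show "length xs = length ys" using xs ys by simp
        fix k assume "k < length xs"
        then have "k \<in> p ` {..<n}" unfolding psurj using xs by simp
        then obtain l where "l < n" "k = p l" by auto
        then show "xs ! k = ys ! k" using act_nth(1)[of l xs] act_nth(1)[of l ys] eq by simp
      qed
    qed
    moreover have "act \<pi> ` ?E \<subseteq> ?E"
    proof
      fix ys assume "ys \<in> act \<pi> ` ?E"
      then obtain xs where xs: "xs \<in> ?E" and ys: "ys = map (\<lambda>k. xs ! p k) [0..<n]" unfolding act_eq by blast
      have "set ys \<subseteq> set xs" unfolding ys using p xs by auto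
      moreover have "distinct ys"
        unfolding ys distinct_map
      proof (intro conjI inj_onI)
        fix k l assume "k \<in> set [0..<n]" "l \<in> set [0..<n]" "xs ! p k = xs ! p l"
        then show "k = l" using xs p[of k] p[of l] nth_eq_iff_index_eq[of xs "p k" "p l"] inj_onD[OF pinj, of k l] by auto
      qed simp
      ultimately show "ys \<in> ?E" using xs ys by auto
    qed
    ultimately show "bij_betw (act \<pi>) ?E ?E"
      using endo_inj_surj[OF fin] by (simp add: bij_betw_def)
  qed
  finally show ?thesis .
qed

text \<open>The falling factorial counting injective words is at least (q - n)^n, and Bernoulli's
  inequality bounds this below by the fraction 1 - n^2 / q of all words.\<close>

lemma injective_words_fraction:
  assumes "n \<le> q" "q > 0"
  shows "real (card (words q n)) - real (card (injective_words q n)) \<le> (real n)\<^sup>2 / real q * real (card (words q n))"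
proof -
  have W: "card (words q n) = q ^ n" by (subst card_lists_length_eq) auto
  have "injective_words q n = {xs. length xs = n \<and> distinct xs \<and> set xs \<subseteq> {..<q}}" by auto
  then have "card (injective_words q n) = \<Prod>{q - n + 1..q}"
    using card_lists_distinct_length_eq[of "{..<q}" n] assms by simp
  moreover have "(q - n) ^ n \<le> \<Prod>{q - n + 1..q}"
  proof -
    have "(\<Prod>i\<in>{q - n + 1..q}. q - n) \<le> (\<Prod>i\<in>{q - n + 1..q}. i)" by (rule prod_mono) auto
    then show ?thesis using assms by simp
  qed
  ultimately have "(q - n) ^ n \<le> card (injective_words q n)" by (simp only:)
  then have "real ((q - n) ^ n) \<le> real (card (injective_words q n))" by (simp only: of_nat_le_iff)
  moreover have "real ((q - n) ^ n) = (1 - real n / real q) ^ n * real q ^ n"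
    using assms by (simp add: of_nat_diff field_simps power_mult_distrib[symmetric])
  moreover have "1 - (real n)\<^sup>2 / real q \<le> (1 - real n / real q) ^ n"
    using Bernoulli_inequality[of "- (real n / real q)" n] assms by (simp add: field_simps power2_eq_square)
  then have "(1 - (real n)\<^sup>2 / real q) * real q ^ n \<le> (1 - real n / real q) ^ n * real q ^ n"
    by (rule mult_right_mono) simp
  ultimately have "(1 - (real n)\<^sup>2 / real q) * real q ^ n \<le> real (card (injective_words q n))"
    by linarith
  then show ?thesis using W by (simp add: algebra_simps)
qed

text \<open>A test function \<open>g\<close> lets one statement serve tail probabilities and the
  first two moments. The mean over all words is a mixture of the mean over injective words and one
  over words with ties. Both lie between 0 and B, so the error is at most B times the proportion of
  ties.\<close>

lemma descents_vs_sum: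
  fixes g :: "nat \<Rightarrow> real"
  assumes n: "n \<le> q" "q > 0" and g: "\<And>k. k \<le> n \<Longrightarrow> 0 \<le> g k \<and> g k \<le> B"
  shows "\<bar>measure_pmf.expectation (replicate_pmf n (pmf_of_set {..<q})) (\<lambda>xs. g (sum_list xs div q)) -
      measure_pmf.expectation (pmf_of_set (perms n)) (\<lambda>p. g (descents n p))\<bar> \<le> B * ((real n)\<^sup>2 / real q)"
proof -
  let ?L = "words q n" and ?E = "injective_words q n"
  have finL: "finite ?L" by (rule finite_lists_length_eq) simp
  have EL: "?E \<subseteq> ?L" by auto
  have finE: "finite ?E" using EL finL by (rule finite_subset)
  have E: "[0..<n] \<in> ?E" using n by auto
  then have Ene: "?E \<noteq> {}" by blast
  have Lne: "?L \<noteq> {}" using E EL by blast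
  have cE: "real (card ?E) > 0" and cL: "real (card ?L) > 0" using finE Ene finL Lne by (auto simp: card_gt_0_iff)
  have U: "{..<q} \<noteq> {}" using n by auto
  have "drops a xs \<le> length xs" for a xs by (induction xs arbitrary: a) (auto intro: le_SucI)
  then have gb: "0 \<le> g (drops 0 xs) \<and> g (drops 0 xs) \<le> B" if "xs \<in> ?L" for xs using g that by auto
  have "measure_pmf.expectation (replicate_pmf n (pmf_of_set {..<q})) (\<lambda>xs. g (sum_list xs div q)) =
      measure_pmf.expectation (map_pmf (\<lambda>xs. sum_list xs div q) (replicate_pmf n (pmf_of_set {..<q}))) g" by simp
  also have "\<dots> = measure_pmf.expectation (replicate_pmf n (pmf_of_set {..<q})) (\<lambda>xs. g (drops 0 xs))"
    unfolding drops_law[OF n(2), symmetric] by simp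
  also have "\<dots> = (\<Sum>xs\<in>?L. g (drops 0 xs)) / card ?L"
    unfolding replicate_pmf_of_set[OF finite_lessThan U] by (rule integral_pmf_of_set[OF Lne finL])
  finally have 1: "measure_pmf.expectation (replicate_pmf n (pmf_of_set {..<q})) (\<lambda>xs. g (sum_list xs div q)) =
      (\<Sum>xs\<in>?L. g (drops 0 xs)) / card ?L" .
  have "measure_pmf.expectation (pmf_of_set (perms n)) (\<lambda>p. g (descents n p)) =
      measure_pmf.expectation (map_pmf (descents n) (pmf_of_set (perms n))) g" by simp
  also have "\<dots> = measure_pmf.expectation (pmf_of_set ?E) (\<lambda>xs. g (drops 0 xs))"
    unfolding injective_words_law[OF n(1), symmetric] by simp
  also have "\<dots> = (\<Sum>xs\<in>?E. g (drops 0 xs)) / card ?E"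
    by (rule integral_pmf_of_set[OF Ene finE])
  finally have 2: "measure_pmf.expectation (pmf_of_set (perms n)) (\<lambda>p. g (descents n p)) =
      (\<Sum>xs\<in>?E. g (drops 0 xs)) / card ?E" .
  define a where "a = (\<Sum>xs\<in>?E. g (drops 0 xs)) / card ?E"
  define d where "d = (\<Sum>xs\<in>?L - ?E. g (drops 0 xs))"
  have split: "(\<Sum>xs\<in>?L. g (drops 0 xs)) = card ?E * a + d"
    using sum.subset_diff[OF EL finL, of "\<lambda>xs. g (drops 0 xs)"] cE by (simp add: a_def d_def)
  have card_diff: "real (card (?L - ?E)) = real (card ?L) - real (card ?E)"
    using card_Diff_subset[OF finE EL] card_mono[OF finL EL] by (simp add: of_nat_diff)
  have d: "0 \<le> d" "d \<le> B * (real (card ?L) - real (card ?E))"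
  proof -
    show "0 \<le> d" unfolding d_def by (rule sum_nonneg) (use gb in auto)
    have "d \<le> (\<Sum>xs\<in>?L - ?E. B)" unfolding d_def by (rule sum_mono) (use gb in auto)
    then show "d \<le> B * (real (card ?L) - real (card ?E))" using card_diff by (simp add: mult.commute)
  qed
  have a: "0 \<le> a" "a \<le> B"
  proof -
    show "0 \<le> a" unfolding a_def by (intro divide_nonneg_nonneg sum_nonneg) (use gb in auto)
    have "(\<Sum>xs\<in>?E. g (drops 0 xs)) \<le> (\<Sum>xs\<in>?E. B)" by (rule sum_mono) (use gb in auto)
    then show "a \<le> B" unfolding a_def using cE by (simp add: field_simps)
  qed
  define r where "r = real (card ?L) - real (card ?E)"
  have r: "0 \<le> r" "r \<le> (real n)\<^sup>2 / real q * real (card ?L)"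
    using injective_words_fraction[OF n] card_mono[OF finL EL] by (auto simp: r_def)
  have ar: "0 \<le> r * a" "r * a \<le> B * r" using a r(1) mult_right_mono[OF a(2) r(1)] by (auto simp: mult.commute)
  have "\<bar>(card ?E * a + d) / card ?L - a\<bar> = \<bar>d - r * a\<bar> / card ?L"
  proof -
    have "(card ?E * a + d) / card ?L - a = (d - r * a) / card ?L"
      using cL by (simp add: r_def field_simps)
    then show ?thesis by (simp add: abs_divide)
  qed
  also have "\<dots> \<le> B * r / card ?L"
    using d ar by (intro divide_right_mono) (auto simp: abs_le_iff r_def[symmetric])
  also have "\<dots> \<le> B * ((real n)\<^sup>2 / real q * real (card ?L)) / card ?L"
    using a r(2) by (intro divide_right_mono mult_left_mono) auto
  also have "\<dots> = B * ((real n)\<^sup>2 / real q)" using cL by simp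
  finally show ?thesis unfolding 1 2 split a_def[symmetric] .
qed

section \<open>Moments and tails of the rounded sum\<close>

definition uniform_step :: "nat \<Rightarrow> real pmf" where
  "uniform_step q = centred_step {..<q} real ((real q - 1) / 2)"

lemma sum_list_law:
  "map_pmf (\<lambda>xs. real (sum_list xs)) (replicate_pmf n (pmf_of_set {..<q})) =
    map_pmf (\<lambda>x. x + real n * ((real q - 1) / 2)) (sum_pmf (replicate n (uniform_step q)))"
proof (induction n)
  case (Suc n)
  let ?R = "replicate_pmf n (pmf_of_set {..<q})"
  have "map_pmf (\<lambda>xs. real (sum_list xs)) (replicate_pmf (Suc n) (pmf_of_set {..<q})) =
      bind_pmf (pmf_of_set {..<q}) (\<lambda>x. map_pmf (\<lambda>y. real x + y) (map_pmf (\<lambda>xs. real (sum_list xs)) ?R))"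
    by (simp add: map_bind_pmf pmf.map_comp comp_def map_pmf_def[symmetric])
  also have "\<dots> = map_pmf (\<lambda>x. x + real (Suc n) * ((real q - 1) / 2)) (sum_pmf (uniform_step q # replicate n (uniform_step q)))"
    unfolding Suc.IH uniform_step_def centred_step_def
    by (simp add: map_bind_pmf bind_map_pmf pmf.map_comp comp_def algebra_simps add_divide_distrib diff_divide_distrib)
  finally show ?case by simp
qed simp

lemma uniform_step:
  assumes q: "q > 0"
  shows "symmetric_pmf (real q) (uniform_step q)" "second_moment (uniform_step q) = ((real q)\<^sup>2 - 1) / 12"
proof -
  have V: "finite {..<q}" "{..<q} \<noteq> {}" using q by auto
  show "symmetric_pmf (real q) (uniform_step q)"
    unfolding uniform_step_def
  proof (rule centred_step_symmetric[OF V])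
    show "bij_betw (\<lambda>x. q - 1 - x) {..<q} {..<q}"
      by (rule bij_betw_byWitness[where f' = "\<lambda>x. q - 1 - x"]) auto
    fix v assume "v \<in> {..<q}"
    then have v: "v \<le> q - 1" "v < q" by auto
    then show "real (q - 1 - v) - (real q - 1) / 2 = - (real v - (real q - 1) / 2)"
      using q by (simp add: of_nat_diff field_simps)
    show "\<bar>real v - (real q - 1) / 2\<bar> \<le> real q"
      using v q by (auto simp: abs_le_iff field_simps)
  qed
  have sum: "(\<Sum>v<q. (real v - c)\<^sup>2) = (real q - 1) * real q * (2 * real q - 1) / 6 - c * real q * (real q - 1) + real q * c\<^sup>2" for q c
    by (induction q) (auto simp: power2_eq_square field_simps)
  show "second_moment (uniform_step q) = ((real q)\<^sup>2 - 1) / 12"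
    unfolding uniform_step_def centred_step_second_moment[OF V] sum using q
    by (simp add: power2_eq_square field_simps)
qed

lemma expectation_abs_le_sqrt_square:
  fixes f :: "'b \<Rightarrow> real"
  assumes "finite (set_pmf p)"
  shows "measure_pmf.expectation p (\<lambda>x. \<bar>f x\<bar>) \<le> sqrt (measure_pmf.expectation p (\<lambda>x. (f x)\<^sup>2))"
proof (rule real_le_rsqrt)
  note [simp] = integrable_measure_pmf_finite[OF assms]
  let ?m = "measure_pmf.expectation p (\<lambda>x. \<bar>f x\<bar>)"
  have "0 \<le> measure_pmf.expectation p (\<lambda>x. (\<bar>f x\<bar> - ?m)\<^sup>2)" by simp
  also have "\<dots> = measure_pmf.expectation p (\<lambda>x. (f x)\<^sup>2) - ?m\<^sup>2"
    by (simp add: power2_diff algebra_simps power2_eq_square)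
  finally show "?m\<^sup>2 \<le> measure_pmf.expectation p (\<lambda>x. (f x)\<^sup>2)" by simp
qed

abbreviation sd :: "'b pmf \<Rightarrow> ('b \<Rightarrow> real) \<Rightarrow> real" where
  "sd p f \<equiv> sqrt (measure_pmf.variance p f)"

lemma mean_close:
  fixes f g :: "'b \<Rightarrow> real"
  assumes fin: "finite (set_pmf p)" and fg: "\<And>x. x \<in> set_pmf p \<Longrightarrow> \<bar>f x - g x\<bar> \<le> c"
  shows "\<bar>measure_pmf.expectation p f - measure_pmf.expectation p g\<bar> \<le> c"
proof -
  note [simp] = integrable_measure_pmf_finite[OF fin]
  have "\<bar>measure_pmf.expectation p f - measure_pmf.expectation p g\<bar> = \<bar>measure_pmf.expectation p (\<lambda>x. f x - g x)\<bar>"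
    by simp
  also have "\<dots> \<le> measure_pmf.expectation p (\<lambda>x. \<bar>f x - g x\<bar>)" by (rule integral_abs_bound)
  also have "\<dots> \<le> measure_pmf.expectation p (\<lambda>x. c)"
    by (rule integral_mono_AE) (use fg in \<open>auto intro: AE_pmfI\<close>)
  finally show ?thesis by simp
qed

text \<open>Minkowski's inequality. The variance of f is at most its second moment about any point,
  and taking the mean of g as that point avoids a separate comparison of the means.\<close>

lemma sd_le:
  fixes f g :: "'b \<Rightarrow> real"
  assumes fin: "finite (set_pmf p)" and fg: "\<And>x. x \<in> set_pmf p \<Longrightarrow> \<bar>f x - g x\<bar> \<le> c"
  shows "sd p f \<le> sd p g + c"
proof (rule real_le_lsqrt)
  note [simp] = integrable_measure_pmf_finite[OF fin]
  let ?E = "measure_pmf.expectation p"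
  define G where "G x = g x - ?E g" for x
  obtain x where "x \<in> set_pmf p" using set_pmf_not_empty by fast
  then have c: "c \<ge> 0" using fg[of x] by linarith
  then show "0 \<le> sd p g + c" by simp
  have "measure_pmf.variance p f = ?E (\<lambda>x. (f x - ?E g)\<^sup>2) - (?E f - ?E g)\<^sup>2"
    by (simp add: power2_diff algebra_simps power2_eq_square)
  also have "\<dots> \<le> ?E (\<lambda>x. (f x - ?E g)\<^sup>2)" by simp
  also have "\<dots> \<le> ?E (\<lambda>x. (G x)\<^sup>2 + 2 * c * \<bar>G x\<bar> + c\<^sup>2)"
  proof (rule integral_mono_AE)
    show "AE x in measure_pmf p. (f x - ?E g)\<^sup>2 \<le> (G x)\<^sup>2 + 2 * c * \<bar>G x\<bar> + c\<^sup>2"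
    proof (rule AE_pmfI)
      fix x assume "x \<in> set_pmf p"
      then have "\<bar>f x - ?E g\<bar> \<le> \<bar>G x\<bar> + c" using fg[of x] by (auto simp: G_def)
      then have "(f x - ?E g)\<^sup>2 \<le> (\<bar>G x\<bar> + c)\<^sup>2" using abs_le_square_iff[of "f x - ?E g" "\<bar>G x\<bar> + c"] c by simp
      then show "(f x - ?E g)\<^sup>2 \<le> (G x)\<^sup>2 + 2 * c * \<bar>G x\<bar> + c\<^sup>2"
        by (simp add: power2_eq_square algebra_simps)
    qed
  qed auto
  also have "\<dots> = ?E (\<lambda>x. (G x)\<^sup>2) + 2 * c * ?E (\<lambda>x. \<bar>G x\<bar>) + c\<^sup>2" by simp
  also have "\<dots> \<le> ?E (\<lambda>x. (G x)\<^sup>2) + 2 * c * sqrt (?E (\<lambda>x. (G x)\<^sup>2)) + c\<^sup>2"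
    using expectation_abs_le_sqrt_square[OF fin, of G] c by (intro add_mono mult_left_mono) auto
  also have "\<dots> = (sd p g + c)\<^sup>2"
    by (simp add: G_def power2_sum)
  finally show "measure_pmf.variance p f \<le> (sd p g + c)\<^sup>2" .
qed

lemma sd_close:
  fixes f g :: "'b \<Rightarrow> real"
  assumes "finite (set_pmf p)" "\<And>x. x \<in> set_pmf p \<Longrightarrow> \<bar>f x - g x\<bar> \<le> c"
  shows "\<bar>sd p f - sd p g\<bar> \<le> c"
  using sd_le[of p f g c] sd_le[of p g f c] assms by (auto simp: abs_minus_commute abs_le_iff)

lemma sqrt_diff_le: "0 \<le> a \<Longrightarrow> 0 \<le> b \<Longrightarrow> \<bar>a - b\<bar> \<le> 1 \<Longrightarrow> \<bar>sqrt a - sqrt b\<bar> \<le> 1"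
proof -
  have *: "sqrt a \<le> sqrt b + 1" if "0 \<le> b" "a \<le> b + 1" for a b :: real
    using real_sqrt_le_mono[OF that(2)] sqrt_add_le_add_sqrt[OF that(1), of 1] real_sqrt_one by linarith
  assume "0 \<le> a" "0 \<le> b" "\<bar>a - b\<bar> \<le> 1"
  then show ?thesis using *[of b a] *[of a b] by (auto simp: abs_le_iff)
qed

lemma floor_div_bounds:
  assumes "q > 0"
  shows "real (k div q) \<le> real k / real q" "real k / real q \<le> real (k div q) + 1"
proof -
  have *: "real k / real q = real (k div q) + real (k mod q) / real q" 
  proof -
    have "real k = real (k div q * q + k mod q)" by simp
    then have "real k = real (k div q) * real q + real (k mod q)" by (simp only: of_nat_add of_nat_mult)
    then show ?thesis using assms by (simp add: field_simps)
  qed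
  have "real (k mod q) / real q \<le> 1" using assms by (simp add: less_imp_le)
  then show "real (k div q) \<le> real k / real q" "real k / real q \<le> real (k div q) + 1"
    unfolding * by auto
qed

text \<open>The size of \<open>q\<close> makes the contribution of words with ties to the first two moments at most \<open>1\<close>.\<close>

locale descent_statistic =
  fixes \<tau> :: classical_type and m q :: nat
  assumes m: "m \<ge> 1" and q: "q \<ge> 3 * (m + 1) ^ 4"
begin

abbreviation "C \<equiv> pmf_of_set (carrier (W \<tau> m))"
abbreviation "R \<equiv> replicate_pmf m (pmf_of_set {..<q})"
abbreviation "D \<equiv> pmf_of_set (perms m)"
abbreviation "X \<equiv> \<lambda>w. real (coxeter_des (W \<tau> m) (gens \<tau> m) w)"
abbreviation "Y \<equiv> sum_pmf (replicate m (uniform_step q))"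

text \<open>Mean and standard deviation of the sum of the letters divided by q, before rounding
  down.\<close>

definition "centre = real m * ((real q - 1) / 2) / real q"
definition "spread = sqrt (real m * (((real q)\<^sup>2 - 1) / 12)) / real q"

lemma q_pos: "q > 0" and m_le_q: "m \<le> q" and q_ge: "q \<ge> 2"
proof -
  have "m + 1 \<le> (m + 1) ^ 4" by (rule self_le_power) auto
  then show "q > 0" "m \<le> q" "q \<ge> 2" using q m by auto
qed

text \<open>In the first bound, one term controls the difference of the squared means and the other
  that of the second moments; together they keep the variances within 1 of each other. The second
  bound is for the means.\<close>

lemma q_error: "real m ^ 3 / real q * (2 * real m + 1) + real m ^ 4 / real q \<le> 1" "real m ^ 3 / real q \<le> 1"
proof -
  have "real q \<ge> real (3 * (m + 1) ^ 4)" using q by (simp only: of_nat_le_iff)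
  then have q': "real q \<ge> 3 * (real m + 1) ^ 4" by (simp add: add.commute)
  have "real m ^ 3 \<le> (real m + 1) ^ 3" "real m ^ 4 \<le> (real m + 1) ^ 4" by (intro power_mono; simp)+
  moreover have "real m ^ 3 * (2 * real m + 1) \<le> (real m + 1) ^ 3 * (2 * (real m + 1))"
    using calculation(1) by (intro mult_mono) auto
  moreover have "(real m + 1) ^ 3 * (2 * (real m + 1)) = 2 * (real m + 1) ^ 4" by (simp add: eval_nat_numeral)
  ultimately have "real m ^ 3 * (2 * real m + 1) + real m ^ 4 \<le> real q" using q' by linarith
  then show "real m ^ 3 / real q * (2 * real m + 1) + real m ^ 4 / real q \<le> 1"
    using q_pos by (simp add: field_simps)
  have "real m ^ 3 * 1 \<le> real m ^ 3 * (2 * real m + 1)" by (intro mult_left_mono) auto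
  then have "real m ^ 3 \<le> real q" using \<open>real m ^ 3 * (2 * real m + 1) + real m ^ 4 \<le> real q\<close> by (smt (verit) zero_le_power of_nat_0_le_iff)
  then show "real m ^ 3 / real q \<le> 1" using q_pos by simp
qed

lemma fin: "finite (set_pmf C)" "finite (set_pmf D)" "finite (set_pmf R)" "finite (set_pmf Y)"
proof -
  show "finite (set_pmf C)" using weyl_group_finite_nonempty[where \<tau> = \<tau> and n = m] by simp
  show "finite (set_pmf D)" using perms_finite_nonempty[of m] by (subst set_pmf_of_set) auto
  have "finite {xs. set xs \<subseteq> {..<q} \<and> length xs = m}" by (rule finite_lists_length_eq) simp
  moreover have "set_pmf R \<subseteq> {xs. set xs \<subseteq> {..<q} \<and> length xs = m}"
    using q_pos by (subst set_replicate_pmf, subst set_pmf_of_set) (auto simp: lists_eq_set)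
  ultimately show "finite (set_pmf R)" by (rule finite_subset[rotated])
  show "finite (set_pmf Y)"
    by (rule finite_set_sum_pmf) (use uniform_step(1)[OF q_pos] in \<open>auto simp: symmetric_pmf_def\<close>)
qed

lemma X_close: "w \<in> set_pmf C \<Longrightarrow> real (descents m w) \<le> X w \<and> X w \<le> real (descents m w) + 1"
proof -
  assume "w \<in> set_pmf C"
  then have "w \<in> classical_carrier \<tau> m"
    using weyl_group_finite_nonempty[where \<tau> = \<tau> and n = m] by (simp add: weyl_group_def)
  from coxeter_des_bounds[OF this] show ?thesis by simp
qed

lemma C_D: "measure_pmf.expectation C (\<lambda>w. g (descents m w)) = measure_pmf.expectation D (\<lambda>w. g (descents m w))"
  for g :: "nat \<Rightarrow> real"
proof -
  have "map_pmf (descents m) C = map_pmf (descents m) D"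
    using weyl_descents_law[of m \<tau>] by (simp add: weyl_group_def)
  then have "measure_pmf.expectation (map_pmf (descents m) C) g = measure_pmf.expectation (map_pmf (descents m) D) g"
    by (simp only:)
  then show ?thesis by simp
qed

abbreviation "fl \<equiv> \<lambda>xs. real (sum_list xs div q)"
abbreviation "S \<equiv> \<lambda>xs. real (sum_list xs) / real q"

lemma S_law: "map_pmf S R = map_pmf (\<lambda>y. y / real q + centre) Y"
proof -
  have "map_pmf S R = map_pmf (\<lambda>x. x / real q) (map_pmf (\<lambda>xs. real (sum_list xs)) R)"
    by (simp add: pmf.map_comp comp_def)
  then show ?thesis
    unfolding sum_list_law by (simp add: pmf.map_comp comp_def centre_def add_divide_distrib)
qed

lemma S_moments: "measure_pmf.expectation R S = centre" "sd R S = spread"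
proof -
  have Y: "measure_pmf.expectation Y (\<lambda>x. x) = 0" "second_moment Y = real m * (((real q)\<^sup>2 - 1) / 12)"
    using sum_pmf_moments[of "replicate m (uniform_step q)" "real q"] uniform_step[OF q_pos]
    by (auto simp: map_replicate sum_list_replicate)
  note [simp] = integrable_measure_pmf_finite[OF fin(4)]
  have "measure_pmf.expectation R S = measure_pmf.expectation (map_pmf S R) (\<lambda>x. x)" by simp
  also have "\<dots> = centre" unfolding S_law using Y by simp
  finally show E: "measure_pmf.expectation R S = centre" .
  have "measure_pmf.variance R S = measure_pmf.expectation (map_pmf S R) (\<lambda>x. (x - centre)\<^sup>2)" unfolding E by simp
  also have "\<dots> = real m * (((real q)\<^sup>2 - 1) / 12) / (real q)\<^sup>2"
    unfolding S_law by (simp add: power_divide Y)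
  finally have v: "measure_pmf.variance R S = real m * (((real q)\<^sup>2 - 1) / 12) / (real q)\<^sup>2" .
  show "sd R S = spread" unfolding v spread_def real_sqrt_divide by simp
qed

lemma descents_le: "descents m w \<le> m"
proof -
  have "descents m w \<le> card {1..<int m}" unfolding descents_def by (rule card_mono) auto
  then show ?thesis by simp
qed

text \<open>Three links, each costing at most 1: the Coxeter statistic against window descents,
  descents of a uniform permutation against the rounded sum, and the rounded sum against the sum
  itself. Passing from the group to permutations is exact.\<close>

lemma mean_bound: "\<bar>measure_pmf.expectation C X - centre\<bar> \<le> 3"
  and sd_bound: "\<bar>sd C X - spread\<bar> \<le> 3"
proof -
  let ?d = "\<lambda>w. real (descents m w)"
  note [simp] = integrable_measure_pmf_finite[OF fin(2)] integrable_measure_pmf_finite[OF fin(3)]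
  have CX: "\<bar>X w - ?d w\<bar> \<le> 1" if "w \<in> set_pmf C" for w using X_close[OF that] by auto
  have RS: "\<bar>fl xs - S xs\<bar> \<le> 1" for xs using floor_div_bounds[OF q_pos, of "sum_list xs"] by auto
  have Cd: "measure_pmf.expectation C ?d = measure_pmf.expectation D ?d" by (rule C_D)
  have mean: "\<bar>measure_pmf.expectation R fl - measure_pmf.expectation D ?d\<bar> \<le> real m ^ 3 / real q"
    using descents_vs_sum[OF m_le_q q_pos, of real "real m"] by (simp add: eval_nat_numeral)
  then have mean1: "\<bar>measure_pmf.expectation R fl - measure_pmf.expectation D ?d\<bar> \<le> 1"
    using q_error(2) by linarith
  show "\<bar>measure_pmf.expectation C X - centre\<bar> \<le> 3"
    using mean_close[where f = X and g = ?d, OF fin(1) CX] mean_close[where f = fl and g = S, OF fin(3) RS] mean1 unfolding Cd S_moments(1) by linarith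
  have sq: "\<bar>measure_pmf.expectation R (\<lambda>xs. (fl xs)\<^sup>2) - measure_pmf.expectation D (\<lambda>w. (?d w)\<^sup>2)\<bar> \<le> real m ^ 4 / real q"
    using descents_vs_sum[OF m_le_q q_pos, of "\<lambda>k. (real k)\<^sup>2" "(real m)\<^sup>2"]
    by (simp add: eval_nat_numeral power_mono mult_mono)
  define a b where "a = measure_pmf.expectation R fl" and "b = measure_pmf.expectation D ?d"
  have b: "0 \<le> b" "b \<le> real m"
  proof -
    show "0 \<le> b" by (simp add: b_def)
    have "b \<le> measure_pmf.expectation D (\<lambda>_. real m)"
      unfolding b_def by (rule integral_mono) (auto intro: descents_le)
    then show "b \<le> real m" by simp
  qed
  have a: "0 \<le> a" "a \<le> b + 1" using mean1 by (auto simp: a_def b_def)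
  have "\<bar>a\<^sup>2 - b\<^sup>2\<bar> = \<bar>a - b\<bar> * (a + b)"
    using a b by (simp add: power2_eq_square square_diff_square_factored abs_mult)
  also have "\<dots> \<le> real m ^ 3 / real q * (2 * real m + 1)"
    using mean a b by (intro mult_mono) (auto simp: a_def[symmetric] b_def[symmetric])
  finally have ab: "\<bar>a\<^sup>2 - b\<^sup>2\<bar> \<le> real m ^ 3 / real q * (2 * real m + 1)" .
  have vR: "measure_pmf.variance R fl = measure_pmf.expectation R (\<lambda>xs. (fl xs)\<^sup>2) - a\<^sup>2"
    unfolding a_def by (rule measure_pmf.variance_eq) auto
  have vD: "measure_pmf.variance D ?d = measure_pmf.expectation D (\<lambda>w. (?d w)\<^sup>2) - b\<^sup>2"
    unfolding b_def by (rule measure_pmf.variance_eq) auto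
  have "\<bar>measure_pmf.variance R fl - measure_pmf.variance D ?d\<bar> \<le> 1"
    unfolding vR vD using sq ab q_error(1) by linarith
  then have "\<bar>sd R fl - sd D ?d\<bar> \<le> 1" by (intro sqrt_diff_le) auto
  moreover have "sd C ?d = sd D ?d"
    unfolding Cd using C_D[of "\<lambda>k. (real k - b)\<^sup>2"] by (simp add: b_def)
  moreover have "\<bar>sd C X - sd C ?d\<bar> \<le> 1" by (rule sd_close[OF fin(1) CX])
  moreover have "\<bar>sd R fl - sd R S\<bar> \<le> 1" by (rule sd_close[OF fin(3) RS])
  ultimately show "\<bar>sd C X - spread\<bar> \<le> 3" unfolding S_moments(2) by linarith
qed

text \<open>The statistic can exceed the window descents by at most 1, and rounding down can lose at
  most 1. For each inequality only one of the two works against it, so the threshold moves by 1 and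
  not by 2. Ties add an error that is not relative to the tail and must be made small through
  q.\<close>

lemma tail_transfer:
  "measure_pmf.prob (map_pmf X C) {z<..} \<le> measure_pmf.prob Y {real q * (z - 1 - centre)<..} + (real m)\<^sup>2 / real q"
  "measure_pmf.prob Y {real q * (z + 1 - centre)<..} - (real m)\<^sup>2 / real q \<le> measure_pmf.prob (map_pmf X C) {z<..}"
proof -
  have prob: "measure_pmf.prob p {x. Q x} = measure_pmf.expectation p (\<lambda>x. if Q x then 1 else 0)"
    for p :: "'z pmf" and Q
  proof -
    have "measure_pmf.expectation p (\<lambda>x. if Q x then 1 else 0 :: real) = measure_pmf.expectation p (indicator {x. Q x})"
      by (rule Bochner_Integration.integral_cong) (auto simp: indicator_def)
    then show ?thesis by simp
  qed
  have mono: "measure_pmf.prob p {x. Q x} \<le> measure_pmf.prob p {x. Q' x}"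
    if "\<And>x. x \<in> set_pmf p \<Longrightarrow> Q x \<Longrightarrow> Q' x" for p :: "'z pmf" and Q Q'
  proof -
    have "measure_pmf.prob p {x. Q x} = measure_pmf.prob p ({x. Q x} \<inter> set_pmf p)"
      by (rule measure_Int_set_pmf[symmetric])
    also have "\<dots> \<le> measure_pmf.prob p {x. Q' x}"
      by (rule measure_pmf.finite_measure_mono) (use that in auto)
    finally show ?thesis .
  qed
  have X: "measure_pmf.prob (map_pmf X C) {z<..} = measure_pmf.prob C {w. z < X w}"
    by (simp add: vimage_def)
  have CD: "measure_pmf.prob C {w. z < real (descents m w)} = measure_pmf.prob D {w. z < real (descents m w)}" for z
    unfolding prob by (rule C_D)
  have DR: "\<bar>measure_pmf.prob R {xs. z < fl xs} - measure_pmf.prob D {w. z < real (descents m w)}\<bar> \<le> (real m)\<^sup>2 / real q" for z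
    using descents_vs_sum[OF m_le_q q_pos, of "\<lambda>k. if z < real k then 1 else 0" 1] unfolding prob by simp
  have SY: "measure_pmf.prob R {xs. z < S xs} = measure_pmf.prob Y {real q * (z - centre)<..}" for z
  proof -
    have "measure_pmf.prob R {xs. z < S xs} = measure_pmf.prob (map_pmf S R) {z<..}" by (simp add: vimage_def)
    also have "\<dots> = measure_pmf.prob Y {y. z < y / real q + centre}" unfolding S_law by (simp add: vimage_def)
    also have "{y. z < y / real q + centre} = {real q * (z - centre)<..}"
      using q_pos by (auto simp: field_simps)
    finally show ?thesis .
  qed
  have "measure_pmf.prob C {w. z < X w} \<le> measure_pmf.prob C {w. z - 1 < real (descents m w)}"
    by (rule mono) (use X_close in fastforce)
  also have "\<dots> \<le> measure_pmf.prob R {xs. z - 1 < fl xs} + (real m)\<^sup>2 / real q"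
    unfolding CD using DR[of "z - 1"] by linarith
  also have "measure_pmf.prob R {xs. z - 1 < fl xs} \<le> measure_pmf.prob R {xs. z - 1 < S xs}"
    by (rule mono) (use floor_div_bounds(1)[OF q_pos] in \<open>force intro: less_le_trans\<close>)
  finally show "measure_pmf.prob (map_pmf X C) {z<..} \<le> measure_pmf.prob Y {real q * (z - 1 - centre)<..} + (real m)\<^sup>2 / real q"
    unfolding X SY by simp
  have "measure_pmf.prob R {xs. z + 1 < S xs} \<le> measure_pmf.prob R {xs. z < fl xs}"
    by (rule mono) (use floor_div_bounds(2)[OF q_pos] in \<open>smt (verit)\<close>)
  also have "\<dots> \<le> measure_pmf.prob C {w. z < real (descents m w)} + (real m)\<^sup>2 / real q"
    unfolding CD using DR[of z] by linarith
  also have "measure_pmf.prob C {w. z < real (descents m w)} \<le> measure_pmf.prob C {w. z < X w}"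
    by (rule mono) (use X_close in fastforce)
  finally show "measure_pmf.prob Y {real q * (z + 1 - centre)<..} - (real m)\<^sup>2 / real q \<le> measure_pmf.prob (map_pmf X C) {z<..}"
    unfolding X SY by simp
qed

text \<open>From q \<ge> 2 one has q^2 - 1 \<ge> 3 q^2 / 4, which turns 12 into 16. Neither constant
  depends on q, so q may be taken as large as the tie error requires.\<close>

lemma variance_lower: "(real q)\<^sup>2 * real m \<le> 16 * (real m * (((real q)\<^sup>2 - 1) / 12))" "spread \<ge> sqrt (real m) / 4"
proof -
  have "(real q)\<^sup>2 \<ge> 2\<^sup>2" by (rule power_mono) (use q_ge in auto)
  then have q2: "3 * (real q)\<^sup>2 \<le> 4 * ((real q)\<^sup>2 - 1)" by simp
  have gen: "u * M \<le> 16 * (M * ((u - 1) / 12))" if "M * (3 * u) \<le> M * (4 * (u - 1))" for u M :: real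
    using that by (simp add: algebra_simps)
  show 1: "(real q)\<^sup>2 * real m \<le> 16 * (real m * (((real q)\<^sup>2 - 1) / 12))"
    by (rule gen[OF mult_left_mono[OF q2]]) simp
  have "sqrt (real m) * real q / 4 = sqrt ((real q)\<^sup>2 * real m / 16)"
    by (simp add: real_sqrt_mult real_sqrt_divide)
  also have "\<dots> \<le> sqrt (real m * (((real q)\<^sup>2 - 1) / 12))" using 1 by (intro real_sqrt_le_mono) linarith
  finally show "spread \<ge> sqrt (real m) / 4" unfolding spread_def using q_pos by (simp add: field_simps)
qed

end

section \<open>The limit law\<close>

text \<open>The growth hypothesis enters through \<open>\<alpha> n ^ 6\<close>, which equals 8 times
  the cube of ln n. As y is asymptotic to \<alpha>, its sixth power is negligible against the number
  of summands.\<close>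

lemma gumbel_tail:
  fixes ps :: "nat \<Rightarrow> real pmf list" and \<rho> y V :: "nat \<Rightarrow> real" and x K :: real
  defines "\<alpha> \<equiv> \<lambda>n :: nat. sqrt (2 * ln (real n))"
  assumes sym: "\<forall>\<^sub>F n in sequentially. \<forall>p\<in>set (ps n). symmetric_pmf (\<rho> n) p"
    and V: "\<And>n. V n = (\<Sum>p\<leftarrow>ps n. second_moment p)" "\<forall>\<^sub>F n in sequentially. V n > 0"
    and K: "\<forall>\<^sub>F n in sequentially. length (ps n) * (\<rho> n)\<^sup>2 \<le> K * V n"
    and len: "(\<lambda>n. ln (real n) ^ 3 / real (length (ps n))) \<longlonglongrightarrow> 0"
    and y: "(\<lambda>n. \<alpha> n * (y n - \<alpha> n) + (ln (ln (real n)) + ln (4 * pi)) / 2) \<longlonglongrightarrow> x"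
  shows "(\<lambda>n. real n * measure_pmf.prob (sum_pmf (ps n)) {y n * sqrt (V n)<..}) \<longlonglongrightarrow> exp (- x)"
proof -
  note th = gumbel_threshold[OF y[unfolded \<alpha>_def]]
  have "(\<lambda>n. (y n / \<alpha> n) ^ 6 * (8 * (ln (real n) ^ 3 / real (length (ps n))))) \<longlonglongrightarrow> 1 ^ 6 * (8 * 0)"
    unfolding \<alpha>_def by (intro tendsto_intros th(2) len)
  moreover have "\<forall>\<^sub>F n in sequentially. (y n / \<alpha> n) ^ 6 * (8 * (ln (real n) ^ 3 / real (length (ps n)))) = y n ^ 6 / real (length (ps n))"
    using eventually_gt_at_top[of 1]
  proof eventually_elim
    case (elim n)
    then have ln: "ln (real n) > 0" by simp
    have "\<alpha> n ^ 6 = (\<alpha> n ^ 2) ^ 3" by simp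
    also have "\<dots> = 8 * ln (real n) ^ 3" using ln by (simp add: \<alpha>_def power_mult_distrib)
    finally have "\<alpha> n ^ 6 = 8 * ln (real n) ^ 3" .
    then show ?case using ln by (simp add: power_divide)
  qed
  ultimately have err: "(\<lambda>n. y n ^ 6 / real (length (ps n))) \<longlonglongrightarrow> 0"
    using Lim_transform_eventually by fastforce
  have "(\<lambda>n. measure_pmf.prob (sum_pmf (ps n)) {y n * sqrt (V n)<..} / mills (y n) * (real n * mills (y n))) \<longlonglongrightarrow> 1 * exp (- x)"
    by (intro tendsto_mult moderate_deviation[OF sym V K th(1) err] th(3))
  moreover have "\<forall>\<^sub>F n in sequentially. measure_pmf.prob (sum_pmf (ps n)) {y n * sqrt (V n)<..} / mills (y n) * (real n * mills (y n)) =
      real n * measure_pmf.prob (sum_pmf (ps n)) {y n * sqrt (V n)<..}"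
    using th(1)[unfolded filterlim_at_top_dense, rule_format, of 0]
    by eventually_elim (simp add: mills_def)
  ultimately show ?thesis using Lim_transform_eventually by fastforce
qed

text \<open>The threshold limit tolerates changes of y that are o(1 / \<alpha>). As y is asymptotic
  to \<alpha>, the assumed closeness multiplied by \<alpha> is of order \<alpha>^2 / sqrt M, which
  vanishes together with the ratio of the cube of ln n to M.\<close>

lemma gumbel_threshold_perturb:
  fixes y y' :: "nat \<Rightarrow> real" and M :: "nat \<Rightarrow> nat" and x A B :: real
  defines "\<alpha> \<equiv> \<lambda>n :: nat. sqrt (2 * ln (real n))"
  assumes y: "(\<lambda>n. \<alpha> n * (y n - \<alpha> n) + (ln (ln (real n)) + ln (4 * pi)) / 2) \<longlonglongrightarrow> x"
    and M: "(\<lambda>n. ln (real n) ^ 3 / real (M n)) \<longlonglongrightarrow> 0" "\<forall>\<^sub>F n in sequentially. M n > 0"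
    and close: "\<forall>\<^sub>F n in sequentially. \<bar>y' n - y n\<bar> \<le> (A * \<bar>y n\<bar> + B) / sqrt (real (M n))"
  shows "(\<lambda>n. \<alpha> n * (y' n - \<alpha> n) + (ln (ln (real n)) + ln (4 * pi)) / 2) \<longlonglongrightarrow> x"
proof -
  note th = gumbel_threshold[OF y[unfolded \<alpha>_def]]
  have ln1: "\<forall>\<^sub>F n in sequentially. ln (real n) \<ge> 1" by real_asymp
  have pow: "(\<lambda>n. ln (real n) ^ k / real (M n)) \<longlonglongrightarrow> 0" if "k \<le> 3" for k
  proof (rule Lim_null_comparison[OF _ M(1)])
    show "\<forall>\<^sub>F n in sequentially. norm (ln (real n) ^ k / real (M n)) \<le> ln (real n) ^ 3 / real (M n)"
      using ln1 by eventually_elim (use that in \<open>auto intro!: divide_right_mono power_increasing\<close>)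
  qed
  have a2: "(\<lambda>n. (\<alpha> n)\<^sup>2 / sqrt (real (M n))) \<longlonglongrightarrow> 0"
  proof -
    have "(\<lambda>n. 2 * sqrt (ln (real n) ^ 2 / real (M n))) \<longlonglongrightarrow> 2 * sqrt 0"
      by (intro tendsto_intros pow) simp
    moreover have "\<forall>\<^sub>F n in sequentially. 2 * sqrt (ln (real n) ^ 2 / real (M n)) = (\<alpha> n)\<^sup>2 / sqrt (real (M n))"
      using ln1 by eventually_elim (simp add: \<alpha>_def real_sqrt_divide)
    ultimately show ?thesis using Lim_transform_eventually by fastforce
  qed
  have a1: "(\<lambda>n. \<alpha> n / sqrt (real (M n))) \<longlonglongrightarrow> 0"
  proof -
    have "(\<lambda>n. sqrt (2 * (ln (real n) ^ 1 / real (M n)))) \<longlonglongrightarrow> sqrt (2 * 0)"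
      by (intro tendsto_intros pow) simp
    then show ?thesis by (simp add: \<alpha>_def real_sqrt_divide)
  qed
  have ya: "(\<lambda>n. y n / \<alpha> n) \<longlonglongrightarrow> 1" unfolding \<alpha>_def by (rule th(2))
  have "(\<lambda>n. A * ((\<alpha> n)\<^sup>2 / sqrt (real (M n)) * \<bar>y n / \<alpha> n\<bar>) + B * (\<alpha> n / sqrt (real (M n)))) \<longlonglongrightarrow> A * (0 * \<bar>1\<bar>) + B * 0"
    by (intro tendsto_intros a1 a2 ya)
  then have bound: "(\<lambda>n. A * ((\<alpha> n)\<^sup>2 / sqrt (real (M n)) * \<bar>y n / \<alpha> n\<bar>) + B * (\<alpha> n / sqrt (real (M n)))) \<longlonglongrightarrow> 0" by simp
  have diff: "(\<lambda>n. \<alpha> n * (y' n - y n)) \<longlonglongrightarrow> 0"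
  proof (rule Lim_null_comparison[OF _ bound])
    show "\<forall>\<^sub>F n in sequentially. norm (\<alpha> n * (y' n - y n)) \<le>
        A * ((\<alpha> n)\<^sup>2 / sqrt (real (M n)) * \<bar>y n / \<alpha> n\<bar>) + B * (\<alpha> n / sqrt (real (M n)))"
      using close ln1
    proof eventually_elim
      case (elim n)
      have pos: "\<alpha> n > 0" using elim(2) by (simp add: \<alpha>_def)
      have "norm (\<alpha> n * (y' n - y n)) = \<alpha> n * \<bar>y' n - y n\<bar>" using pos by (simp add: abs_mult)
      also have "\<dots> \<le> \<alpha> n * ((A * \<bar>y n\<bar> + B) / sqrt (real (M n)))" using elim(1) pos by (intro mult_left_mono) auto
      also have "\<dots> = A * ((\<alpha> n)\<^sup>2 / sqrt (real (M n)) * \<bar>y n / \<alpha> n\<bar>) + B * (\<alpha> n / sqrt (real (M n)))"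
        using pos by (simp add: abs_divide power2_eq_square add_divide_distrib distrib_left mult_ac)
      finally show ?case .
    qed
  qed
  from tendsto_add[OF diff y] show ?thesis by (simp add: algebra_simps)
qed

lemma inv_tail:
  fixes \<tau> :: "nat \<Rightarrow> classical_type" and m :: "nat \<Rightarrow> nat" and y :: "nat \<Rightarrow> real" and x :: real
  defines "\<alpha> \<equiv> \<lambda>n :: nat. sqrt (2 * ln (real n))"
    and "L \<equiv> \<lambda>n. map_pmf (\<lambda>w. real (coxeter_inv (W (\<tau> n) (m n)) (gens (\<tau> n) (m n)) w)) (pmf_of_set (carrier (W (\<tau> n) (m n))))"
  assumes m: "(\<lambda>n. ln (real n) ^ 3 / real (m n)) \<longlonglongrightarrow> 0" "filterlim m at_top sequentially"
    and y: "(\<lambda>n. \<alpha> n * (y n - \<alpha> n) + (ln (ln (real n)) + ln (4 * pi)) / 2) \<longlonglongrightarrow> x"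
  shows "(\<lambda>n. real n * measure_pmf.prob (L n) {y n * sd (L n) (\<lambda>x. x) + measure_pmf.expectation (L n) (\<lambda>x. x)<..}) \<longlonglongrightarrow> exp (- x)"
proof -
  \<comment> \<open>The law is available only for \<open>m n \<ge> 3\<close>; the guard makes it
    possible to choose decompositions for all n at once.\<close>
  have "\<forall>n. \<exists>pc. m n \<ge> 3 \<longrightarrow> L n = map_pmf (\<lambda>x. x + snd pc) (sum_pmf (fst pc)) \<and>
      (\<forall>p\<in>set (fst pc). symmetric_pmf (real (m n)) p) \<and> length (fst pc) = m n \<and>
      real (m n) * (real (m n))\<^sup>2 \<le> 36 * (\<Sum>p\<leftarrow>fst pc. second_moment p)"
    unfolding L_def using inv_statistic_law by (metis fst_conv snd_conv)
  then obtain pc where pc: "\<And>n. m n \<ge> 3 \<Longrightarrow> L n = map_pmf (\<lambda>x. x + snd (pc n)) (sum_pmf (fst (pc n))) \<and>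
      (\<forall>p\<in>set (fst (pc n)). symmetric_pmf (real (m n)) p) \<and> length (fst (pc n)) = m n \<and>
      real (m n) * (real (m n))\<^sup>2 \<le> 36 * (\<Sum>p\<leftarrow>fst (pc n). second_moment p)"
    by metis
  define ps c where "ps n = fst (pc n)" and "c n = snd (pc n)" for n
  define V where "V n = (\<Sum>p\<leftarrow>ps n. second_moment p)" for n
  have ev: "\<forall>\<^sub>F n in sequentially. m n \<ge> 3" using m(2) by (simp add: filterlim_at_top)
  have P: "L n = map_pmf (\<lambda>x. x + c n) (sum_pmf (ps n))" "\<And>p. p \<in> set (ps n) \<Longrightarrow> symmetric_pmf (real (m n)) p"
    "length (ps n) = m n" "real (m n) * (real (m n))\<^sup>2 \<le> 36 * V n" if "m n \<ge> 3" for n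
    using pc[OF that] by (auto simp: ps_def c_def V_def)
  have lim: "(\<lambda>n. real n * measure_pmf.prob (sum_pmf (ps n)) {y n * sqrt (V n)<..}) \<longlonglongrightarrow> exp (- x)"
  proof (rule gumbel_tail[where \<rho> = "\<lambda>n. real (m n)" and K = 36])
    show "\<forall>\<^sub>F n in sequentially. \<forall>p\<in>set (ps n). symmetric_pmf (real (m n)) p"
      using ev by eventually_elim (use P in auto)
    show "\<forall>\<^sub>F n in sequentially. V n > 0"
      using ev
    proof eventually_elim
      case (elim n)
      then have "real (m n) * (real (m n))\<^sup>2 > 0" by simp
      then show ?case using P(4)[OF elim] by linarith
    qed
    show "\<forall>\<^sub>F n in sequentially. real (length (ps n)) * (real (m n))\<^sup>2 \<le> 36 * V n"
      using ev by eventually_elim (use P in auto)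
    have "\<forall>\<^sub>F n in sequentially. ln (real n) ^ 3 / real (m n) = ln (real n) ^ 3 / real (length (ps n))"
      using ev by eventually_elim (use P in auto)
    with m(1) show "(\<lambda>n. ln (real n) ^ 3 / real (length (ps n))) \<longlonglongrightarrow> 0"
      by (rule Lim_transform_eventually)
    show "(\<lambda>n. sqrt (2 * ln (real n)) * (y n - sqrt (2 * ln (real n))) + (ln (ln (real n)) + ln (4 * pi)) / 2) \<longlonglongrightarrow> x"
      using y by (simp add: \<alpha>_def)
  qed (simp add: V_def)
  have "\<forall>\<^sub>F n in sequentially. real n * measure_pmf.prob (sum_pmf (ps n)) {y n * sqrt (V n)<..} =
      real n * measure_pmf.prob (L n) {y n * sd (L n) (\<lambda>x. x) + measure_pmf.expectation (L n) (\<lambda>x. x)<..}"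
    using ev
  proof eventually_elim
    case (elim n)
    have "finite (set_pmf (sum_pmf (ps n)))"
      by (rule finite_set_sum_pmf) (use P(2)[OF elim] in \<open>auto simp: symmetric_pmf_def\<close>)
    note [simp] = integrable_measure_pmf_finite[OF this]
    have mom: "measure_pmf.expectation (sum_pmf (ps n)) (\<lambda>x. x) = 0" "second_moment (sum_pmf (ps n)) = V n"
      using sum_pmf_moments[of "ps n", OF P(2)[OF elim]] by (auto simp: V_def)
    have E: "measure_pmf.expectation (L n) (\<lambda>x. x) = c n"
      unfolding P(1)[OF elim] using mom by simp
    moreover have "measure_pmf.variance (L n) (\<lambda>x. x) = V n"
      unfolding E unfolding P(1)[OF elim] using mom by simp
    ultimately show ?case unfolding P(1)[OF elim] by (simp add: vimage_def greaterThan_def)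
  qed
  with lim show ?thesis by (rule Lim_transform_eventually)
qed

lemma des_tail:
  fixes \<tau> :: "nat \<Rightarrow> classical_type" and m :: "nat \<Rightarrow> nat" and y :: "nat \<Rightarrow> real" and x :: real
  defines "\<alpha> \<equiv> \<lambda>n :: nat. sqrt (2 * ln (real n))"
    and "L \<equiv> \<lambda>n. map_pmf (\<lambda>w. real (coxeter_des (W (\<tau> n) (m n)) (gens (\<tau> n) (m n)) w)) (pmf_of_set (carrier (W (\<tau> n) (m n))))"
  assumes m: "(\<lambda>n. ln (real n) ^ 3 / real (m n)) \<longlonglongrightarrow> 0" "filterlim m at_top sequentially"
    and y: "(\<lambda>n. \<alpha> n * (y n - \<alpha> n) + (ln (ln (real n)) + ln (4 * pi)) / 2) \<longlonglongrightarrow> x"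
  shows "(\<lambda>n. real n * measure_pmf.prob (L n) {y n * sd (L n) (\<lambda>x. x) + measure_pmf.expectation (L n) (\<lambda>x. x)<..}) \<longlonglongrightarrow> exp (- x)"
proof -
  \<comment> \<open>The first factors are what \<open>descent_statistic\<close> demands. The last
    one brings n times the tie error (m n)^2 / q n down to at most 1 / n.\<close>
  define q where "q n = 3 * (m n + 1) ^ 4 * (n + 1) ^ 2" for n
  define c where "c n = descent_statistic.centre (m n) (q n)" for n
  define \<sigma> where "\<sigma> n = descent_statistic.spread (m n) (q n)" for n
  define s where "s n = sd (L n) (\<lambda>x. x)" for n
  define \<mu> where "\<mu> n = measure_pmf.expectation (L n) (\<lambda>x. x)" for n
  define V where "V n = (\<Sum>p\<leftarrow>replicate (m n) (uniform_step (q n)). second_moment p)" for n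
  define Y where "Y n = sum_pmf (replicate (m n) (uniform_step (q n)))" for n
  \<comment> \<open>The threshold built from the true mean and deviation, shifted by the rounding
    error d and expressed in the units of the unrounded sum.\<close>
  define y' where "y' d n = (y n * s n + \<mu> n + d - c n) / \<sigma> n" for d n
  have ev: "\<forall>\<^sub>F n in sequentially. m n \<ge> 1" using m(2) by (simp add: filterlim_at_top)
  have loc: "descent_statistic (m n) (q n)" if "m n \<ge> 1" for n
    using that by unfold_locales (auto simp: q_def)
  have qpos: "q n > 0" for n by (simp add: q_def)
  have \<sigma>_pos: "\<sigma> n > 0" and \<sigma>_ge: "\<sigma> n \<ge> sqrt (real (m n)) / 4" if "m n \<ge> 1" for n
  proof -
    show "\<sigma> n \<ge> sqrt (real (m n)) / 4"
      unfolding \<sigma>_def by (rule descent_statistic.variance_lower(2)[OF loc[OF that]])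
    moreover have "sqrt (real (m n)) > 0" using that by simp
    ultimately show "\<sigma> n > 0" by linarith
  qed
  have V_eq: "V n = real (m n) * (((real (q n))\<^sup>2 - 1) / 12)" for n
    using uniform_step(2)[OF qpos] by (simp add: V_def map_replicate sum_list_replicate)
  have sqrtV: "sqrt (V n) = real (q n) * \<sigma> n" if "m n \<ge> 1" for n
    using qpos[of n] unfolding V_eq \<sigma>_def descent_statistic.spread_def[OF loc[OF that]] by simp
  have lim: "(\<lambda>n. real n * measure_pmf.prob (Y n) {real (q n) * (y n * s n + \<mu> n + d - c n)<..}) \<longlonglongrightarrow> exp (- x)"
    if d: "\<bar>d\<bar> \<le> 1" for d
  proof -
    have "(\<lambda>n. real n * measure_pmf.prob (sum_pmf (replicate (m n) (uniform_step (q n)))) {y' d n * sqrt (V n)<..}) \<longlonglongrightarrow> exp (- x)"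
    proof (rule gumbel_tail[where \<rho> = "\<lambda>n. real (q n)" and K = 16])
      show "\<forall>\<^sub>F n in sequentially. \<forall>p\<in>set (replicate (m n) (uniform_step (q n))). symmetric_pmf (real (q n)) p"
        using uniform_step(1)[OF qpos] by auto
      have K: "real (m n) * (real (q n))\<^sup>2 \<le> 16 * V n" if "m n \<ge> 1" for n
        using descent_statistic.variance_lower(1)[OF loc[OF that]] unfolding V_eq by (simp add: mult.commute)
      then show "\<forall>\<^sub>F n in sequentially. real (length (replicate (m n) (uniform_step (q n)))) * (real (q n))\<^sup>2 \<le> 16 * V n"
        using ev by (auto elim: eventually_mono)
      show "\<forall>\<^sub>F n in sequentially. V n > 0"
        using ev
      proof eventually_elim
        case (elim n)
        have "real (m n) * (real (q n))\<^sup>2 > 0" using elim qpos[of n] by simp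
        then show ?case using K[OF elim] by linarith
      qed
      show "(\<lambda>n. sqrt (2 * ln (real n)) * (y' d n - sqrt (2 * ln (real n))) + (ln (ln (real n)) + ln (4 * pi)) / 2) \<longlonglongrightarrow> x"
      proof (rule gumbel_threshold_perturb[OF y[unfolded \<alpha>_def] m(1)])
        show "\<forall>\<^sub>F n in sequentially. m n > 0" using ev by eventually_elim simp
        \<comment> \<open>The numerator combines the error 3 of the deviation, the error 3 of the
          mean and the shift of at most 1, giving 3 \<bar>y\<bar> + 4. Dividing by a spread of at
          least sqrt m / 4 multiplies both constants by 4.\<close>
        show "\<forall>\<^sub>F n in sequentially. \<bar>y' d n - y n\<bar> \<le> (12 * \<bar>y n\<bar> + 16) / sqrt (real (m n))"
          using ev
        proof eventually_elim
          case (elim n)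
          have sb: "\<bar>s n - \<sigma> n\<bar> \<le> 3" and mb: "\<bar>\<mu> n - c n\<bar> \<le> 3"
            using descent_statistic.sd_bound[OF loc[OF elim], of "\<tau> n"]
              descent_statistic.mean_bound[OF loc[OF elim], of "\<tau> n"]
            by (simp_all add: s_def \<mu>_def c_def \<sigma>_def L_def)
          have "y' d n - y n = (y n * (s n - \<sigma> n) + (\<mu> n - c n) + d) / \<sigma> n"
            using \<sigma>_pos[OF elim] by (simp add: y'_def field_simps)
          also have "\<bar>\<dots>\<bar> = \<bar>y n * (s n - \<sigma> n) + (\<mu> n - c n) + d\<bar> / \<sigma> n"
            using \<sigma>_pos[OF elim] by (simp add: abs_divide)
          also have "\<dots> \<le> (3 * \<bar>y n\<bar> + 4) / \<sigma> n"
          proof (rule divide_right_mono)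
            have "\<bar>y n * (s n - \<sigma> n)\<bar> \<le> \<bar>y n\<bar> * 3"
              unfolding abs_mult using sb by (intro mult_left_mono) auto
            then show "\<bar>y n * (s n - \<sigma> n) + (\<mu> n - c n) + d\<bar> \<le> 3 * \<bar>y n\<bar> + 4"
              using mb d by linarith
          qed (use \<sigma>_pos[OF elim] in simp)
          also have "\<dots> \<le> (3 * \<bar>y n\<bar> + 4) / (sqrt (real (m n)) / 4)"
            using \<sigma>_ge[OF elim] elim \<sigma>_pos[OF elim] by (intro divide_left_mono) auto
          finally show ?case by (simp add: field_simps)
        qed
      qed
    qed (use m(1) in \<open>simp_all add: V_def\<close>)
    moreover have "\<forall>\<^sub>F n in sequentially. real n * measure_pmf.prob (sum_pmf (replicate (m n) (uniform_step (q n)))) {y' d n * sqrt (V n)<..} =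
        real n * measure_pmf.prob (Y n) {real (q n) * (y n * s n + \<mu> n + d - c n)<..}"
      using ev
    proof eventually_elim
      case (elim n)
      have "y' d n * sqrt (V n) = real (q n) * (y n * s n + \<mu> n + d - c n)"
        unfolding sqrtV[OF elim] y'_def using \<sigma>_pos[OF elim] by simp
      then show ?case by (simp add: Y_def)
    qed
    ultimately show ?thesis by (rule Lim_transform_eventually)
  qed
  have tie: "(\<lambda>n. real n * ((real (m n))\<^sup>2 / real (q n))) \<longlonglongrightarrow> 0"
  proof (rule Lim_null_comparison)
    show "(\<lambda>n. 1 / real n) \<longlonglongrightarrow> 0" by (rule lim_const_over_n)
    show "\<forall>\<^sub>F n in sequentially. norm (real n * ((real (m n))\<^sup>2 / real (q n))) \<le> 1 / real n"
      using eventually_gt_at_top[of 0]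
    proof eventually_elim
      case (elim n)
      have "(real (m n))\<^sup>2 * (real n)\<^sup>2 \<le> real (q n)"
      proof -
        have "(m n)\<^sup>2 \<le> (m n + 1) ^ 4" using power_mono[of "m n" "m n + 1" 2] power_increasing[of 2 4 "m n + 1"] by linarith
        moreover have "n\<^sup>2 \<le> (n + 1)\<^sup>2" by (rule power_mono) auto
        ultimately have "(m n)\<^sup>2 * n\<^sup>2 \<le> (m n + 1) ^ 4 * (n + 1)\<^sup>2" by (rule mult_le_mono)
        also have "\<dots> \<le> q n" by (simp add: q_def)
        finally have "real ((m n)\<^sup>2 * n\<^sup>2) \<le> real (q n)" by (simp only: of_nat_le_iff)
        then show ?thesis by simp
      qed
      then show ?case using elim qpos[of n] by (simp add: field_simps power2_eq_square)
    qed
  qed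
  have up: "(\<lambda>n. real n * measure_pmf.prob (Y n) {real (q n) * (y n * s n + \<mu> n + (-1) - c n)<..} + real n * ((real (m n))\<^sup>2 / real (q n))) \<longlonglongrightarrow> exp (- x) + 0"
    by (intro tendsto_add lim tie) simp
  have lo: "(\<lambda>n. real n * measure_pmf.prob (Y n) {real (q n) * (y n * s n + \<mu> n + 1 - c n)<..} - real n * ((real (m n))\<^sup>2 / real (q n))) \<longlonglongrightarrow> exp (- x) - 0"
    by (intro tendsto_diff lim tie) simp
  have "(\<lambda>n. real n * measure_pmf.prob (L n) {y n * s n + \<mu> n<..}) \<longlonglongrightarrow> exp (- x)"
  proof (rule tendsto_sandwich[OF _ _ lo[simplified] up[simplified]])
    show "\<forall>\<^sub>F n in sequentially. real n * measure_pmf.prob (Y n) {real (q n) * (y n * s n + \<mu> n + 1 - c n)<..} - real n * (real (m n))\<^sup>2 / real (q n)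
        \<le> real n * measure_pmf.prob (L n) {y n * s n + \<mu> n<..}"
      using ev
    proof eventually_elim
      case (elim n)
      have "real n * (measure_pmf.prob (Y n) {real (q n) * (y n * s n + \<mu> n + 1 - c n)<..} - (real (m n))\<^sup>2 / real (q n))
          \<le> real n * measure_pmf.prob (L n) {y n * s n + \<mu> n<..}"
        unfolding Y_def L_def c_def
        by (intro mult_left_mono descent_statistic.tail_transfer(2)[OF loc[OF elim]]) simp
      then show ?case by (simp add: right_diff_distrib)
    qed
    show "\<forall>\<^sub>F n in sequentially. real n * measure_pmf.prob (L n) {y n * s n + \<mu> n<..} \<le>
        real n * measure_pmf.prob (Y n) {real (q n) * (y n * s n + \<mu> n - 1 - c n)<..} + real n * (real (m n))\<^sup>2 / real (q n)"
      using ev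
    proof eventually_elim
      case (elim n)
      have "real n * measure_pmf.prob (L n) {y n * s n + \<mu> n<..} \<le>
          real n * (measure_pmf.prob (Y n) {real (q n) * (y n * s n + \<mu> n - 1 - c n)<..} + (real (m n))\<^sup>2 / real (q n))"
        unfolding Y_def L_def c_def
        by (intro mult_left_mono descent_statistic.tail_transfer(1)[OF loc[OF elim]]) simp
      then show ?case by (simp add: distrib_left)
    qed
  qed
  then show ?thesis unfolding s_def \<mu>_def .
qed

text \<open>The scale is the quotient of s by \<alpha>, not their product: at height \<alpha> a
  shift of the normalised threshold by x / \<alpha> changes the normal tail by the factor exp (- x),
  whereas a shift by \<alpha> x would drive the probability to 0 or 1 for every nonzero x.\<close>

theorem theorem4p2:
  fixes \<tau> :: "nat \<Rightarrow> classical_type"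
    and m :: "nat \<Rightarrow> nat"
    and stat :: "(int \<Rightarrow> int) monoid \<Rightarrow> (int \<Rightarrow> int) set \<Rightarrow> (int \<Rightarrow> int) \<Rightarrow> nat"
    and P :: "nat \<Rightarrow> 'a measure"
    and X :: "nat \<Rightarrow> nat \<Rightarrow> 'a \<Rightarrow> real"
    and \<mu> s \<alpha> \<beta> a b :: "nat \<Rightarrow> real"
    and x :: real
  assumes irreducible:
      "\<And>n. n \<ge> 1 \<Longrightarrow> coxeter_irreducible (weyl_group (\<tau> n) (m n)) (weyl_generators (\<tau> n) (m n))"
    and rank_growth:
      "(\<lambda>n. ln (real n) ^ 3) \<in> o(\<lambda>n. real (weyl_rank (\<tau> n) (m n)))"
    and stat: "stat \<in> {coxeter_inv, coxeter_des}"
    and prob: "\<And>n. n \<ge> 1 \<Longrightarrow> prob_space (P n)"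
    and indep: "\<And>n. n \<ge> 1 \<Longrightarrow> prob_space.indep_vars (P n) (\<lambda>_. borel) (X n) {1..n}"
    and distributed_as_stat:
      "\<And>n i. 1 \<le> i \<Longrightarrow> i \<le> n \<Longrightarrow>
         distr (P n) borel (X n i) =
         distr (measure_pmf (pmf_of_set (carrier (weyl_group (\<tau> n) (m n))))) borel
           (\<lambda>w. real (stat (weyl_group (\<tau> n) (m n)) (weyl_generators (\<tau> n) (m n)) w))"
    and \<mu>: "\<And>n. \<mu> n = prob_space.expectation (P n) (X n 1)"
    and s: "\<And>n. s n = sqrt (prob_space.variance (P n) (X n 1))"
    and \<alpha>: "\<And>n. \<alpha> n = sqrt (2 * ln (real n))"
    and \<beta>: "\<And>n. \<beta> n = \<alpha> n - (ln (ln (real n)) + ln (4 * pi)) / (2 * \<alpha> n)"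
    and a: "\<And>n. a n = s n / \<alpha> n"
    and b: "\<And>n. b n = \<beta> n * s n + \<mu> n"
  shows "(\<lambda>n. measure (P n) {\<omega> \<in> space (P n). Max ((\<lambda>i. X n i \<omega>) ` {1..n}) \<le> a n * x + b n})
           \<longlonglongrightarrow> exp (- exp (- x))"
proof -
  define g where "g n = (\<lambda>w. real (stat (W (\<tau> n) (m n)) (gens (\<tau> n) (m n)) w))" for n
  define L where "L n = map_pmf (g n) (pmf_of_set (carrier (W (\<tau> n) (m n))))" for n
  define y where "y n = x / \<alpha> n + \<beta> n" for n
  have "(\<lambda>n. real (weyl_rank (\<tau> n) (m n))) \<in> O(\<lambda>n. real (m n))"
    by (rule bigoI[where c = 1]) (simp add: weyl_rank_le)
  with rank_growth have small: "(\<lambda>n. ln (real n) ^ 3) \<in> o(\<lambda>n. real (m n))"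
    by (rule landau_o.small_big_trans)
  then have m1: "(\<lambda>n. ln (real n) ^ 3 / real (m n)) \<longlonglongrightarrow> 0" by (rule smalloD_tendsto)
  \<comment> \<open>The cube of ln n is unbounded and eventually below \<open>m n\<close>, so the
    growth hypothesis also forces the number of letters to infinity, which the laws for large
    \<open>m n\<close> require.\<close>
  have m2: "filterlim m at_top sequentially"
  proof -
    have "filterlim (\<lambda>n. ln (real n) ^ 3) at_top sequentially" by real_asymp
    moreover have "\<forall>\<^sub>F n in sequentially. ln (real n) ^ 3 \<le> real (m n)"
      using landau_o.smallD[OF small, of 1] by (auto elim: eventually_mono)
    ultimately have "filterlim (\<lambda>n. real (m n)) at_top sequentially" by (rule filterlim_at_top_mono)
    then show ?thesis by (simp add: filterlim_sequentially_iff_filterlim_real)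
  qed
  have \<alpha>pos: "\<forall>\<^sub>F n in sequentially. \<alpha> n > 0"
    using eventually_gt_at_top[of 1] by eventually_elim (simp add: \<alpha>)
  have y: "(\<lambda>n. sqrt (2 * ln (real n)) * (y n - sqrt (2 * ln (real n))) + (ln (ln (real n)) + ln (4 * pi)) / 2) \<longlonglongrightarrow> x"
  proof (rule tendsto_eventually)
    \<comment> \<open>For the exact threshold x / \<alpha> + \<beta> the logarithmic correction in
      \<beta> cancels, and the expression is equal to x as soon as \<alpha> is positive.\<close>
    show "\<forall>\<^sub>F n in sequentially. sqrt (2 * ln (real n)) * (y n - sqrt (2 * ln (real n))) + (ln (ln (real n)) + ln (4 * pi)) / 2 = x"
      using \<alpha>pos by eventually_elim (simp add: y_def \<beta> \<alpha>[symmetric] field_simps)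
  qed
  have tail: "(\<lambda>n. real n * measure_pmf.prob (L n) {y n * sd (L n) (\<lambda>x. x) + measure_pmf.expectation (L n) (\<lambda>x. x)<..}) \<longlonglongrightarrow> exp (- x)"
    using stat inv_tail[OF m1 m2 y, of \<tau>] des_tail[OF m1 m2 y, of \<tau>] by (auto simp: L_def g_def)
  have "(\<lambda>n. (1 - measure_pmf.prob (L n) {y n * sd (L n) (\<lambda>x. x) + measure_pmf.expectation (L n) (\<lambda>x. x)<..}) ^ n) \<longlonglongrightarrow> exp (- exp (- x))"
    by (rule one_minus_power_limit[OF tail]) simp
  moreover have "\<forall>\<^sub>F n in sequentially.
      (1 - measure_pmf.prob (L n) {y n * sd (L n) (\<lambda>x. x) + measure_pmf.expectation (L n) (\<lambda>x. x)<..}) ^ n =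
      measure (P n) {\<omega> \<in> space (P n). Max ((\<lambda>i. X n i \<omega>) ` {1..n}) \<le> a n * x + b n}"
    using eventually_ge_at_top[of 1]
  proof eventually_elim
    case (elim n)
    interpret prob_space "P n" by (rule prob[OF elim])
    have rv: "X n 1 \<in> borel_measurable (P n)" using indep[OF elim] elim by (auto simp: indep_vars_def)
    have d: "distr (P n) borel (X n i) = distr (measure_pmf (pmf_of_set (carrier (W (\<tau> n) (m n))))) borel (g n)"
      if "1 \<le> i" "i \<le> n" for i
      unfolding g_def by (rule distributed_as_stat[OF that])
    note mom = moments_via_pmf[OF rv d[OF order_refl elim]]
    have "\<mu> n = measure_pmf.expectation (L n) (\<lambda>x. x)" unfolding \<mu> mom(1) L_def ..
    moreover have "s n = sd (L n) (\<lambda>x. x)" unfolding s mom(2) L_def ..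
    ultimately have "y n * sd (L n) (\<lambda>x. x) + measure_pmf.expectation (L n) (\<lambda>x. x) = a n * x + b n"
      by (simp add: y_def a b algebra_simps)
    then show ?case
      using prob_Max_iid[OF indep[OF elim] elim d] by (simp add: L_def)
  qed
  ultimately show ?thesis by (rule Lim_transform_eventually)
qed

end
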